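(* Let $\Delta$ be a homology $d$-manifold with boundary, let $\sigma=\{z_1,\dots,z_d\}$ be an interior $(d-1)$-face of $\Delta$ with $\partial\overline\sigma\subseteq\partial\Delta$, and let $\widetilde\Delta^\sigma$ be obtained from $\Delta$ by simplicial handle deletion over $\sigma$ (as defined in the context). Then (i) $\widetilde\Delta^\sigma$ is a homology $d$-manifold with boundary, and (ii) $\Delta=(\widetilde\Delta^\sigma)^{\overline\psi}$, where $\psi:\sigma^+\to\sigma$ is the bijection $\psi(z_i^+)=z_i$ (and $\psi$ is an admissible bijection between facets of $\partial\widetilde\Delta^\sigma$).
   Context: Fix a field $\mathbb{F}$; all homology is with coefficients in $\mathbb{F}$. For a face $\sigma$ of $\Delta$, ${\rm lk}_\Delta(\sigma)=\{\tau\setminus\sigma:\sigma\subseteq\tau\in\Delta\}$; $\Delta[W]=\{\alpha\in\Delta:\alpha\subseteq W\}$; $\overline\sigma$ is the complex of all subsets of $\sigma$ and $\partial\overline\sigma$ of its proper subsets. A $d$-dimensional simplicial complex $S$ is a homology $d$-sphere if for every face $\sigma$ of dimension $i\ge -1$, ${\rm lk}_S(\sigma)$ has the same $\mathbb{F}$-homology as the $(d-i-1)$-sphere. A $d$-dimensional complex $B$ is a homology $d$-ball if (i) $B$ has trivial reduced homology, (ii) for each face $\sigma$ of dimension $i\le d-1$ the reduced homology of ${\rm lk}_B(\sigma)$ is trivial or that of the $(d-i-1)$-sphere, (iii) $\partial B=\{\sigma\in B:-1<\dim\sigma<d,\ \widetilde H_{d-\dim\sigma-1}({\rm lk}_B(\sigma))=0\}\cup\{\emptyset\}$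 is a homology $(d-1)$-sphere. A homology $d$-manifold is a complex whose vertex links are homology $(d-1)$-spheres or balls; its boundary is defined by the same formula, and it is "with boundary" if $\partial\Delta\ne\{\emptyset\}$; interior faces are those not in $\partial\Delta$. Components: if $B$ is a homology $d$-ball on vertex set $V$ and $\rho$ an interior $(d-1)$-face with $\partial\overline\rho\subseteq\partial B$, contained in facets $\{x\}\cup\rho$ and $\{y\}\cup\rho$, then $B[V\setminus\rho]$ has exactly two components with vertex sets $W_1\ni x$, $W_2\ni y$; the $x$-component of $B$ w.r.t. $\rho$ is $B[W_1\cup\rho]$ and the $y$-component is $B[W_2\cup\rho]$. Setup: let $\{x\}\cup\sigma$, $\{y\}\cup\sigma$ be the facets of $\Delta$ containing $\sigma$; for each $k$, ${\rm lk}_\Delta(z_k)$ is a homology $(d-1)$-ball in which $\sigma\setminus\{z_k\}$ is such a face. Let $R=\{\alpha\in\Delta:\alpha\cap\sigma\ne\emptyset,\ \alpha\not\subseteq\sigma\}$, $R_x(k)=\{\alpha\in R: z_k\in\alpha,\ \alpha\setminus\{z_k\}$ lies in the $x$-component of ${\rm lk}_\Delta(z_k)$ w.r.t. $\sigma\setminus\{z_k\}\}$, $X=\bigcup_{k=1}^dR_x(k)$. Simplicial handle deletion: take new vertices $z_1^+,\dots,z_d^+$, $\sigma^+=\{z_1^+,\dots,z_d^+\}$; for $\alpha=\alpha'\cup\{z_{i_1},\dots,z_{i_\ell}\}\in X$ with $\alpha'\cap\sigma=\emptyset$ put $\alpha^+=\alpha'\cup\{z_{i_1}^+,\dots,z_{i_\ell}^+\}$;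 then $\widetilde\Delta^\sigma=\{\alpha\in\Delta:\alpha\notin X\}\cup\{\alpha^+:\alpha\in X\}\cup\overline{\sigma^+}$. Simplicial handle addition: for a homology $d$-manifold with boundary $\Gamma$ on vertex set $V$ and facets $\rho,\tau$ of $\partial\Gamma$, a bijection $\psi:\rho\to\tau$ is admissible if ${\rm lk}_\Gamma(v)\cap{\rm lk}_\Gamma(\psi(v))=\{\emptyset\}$ for every $v\in\rho$; with $\psi_+:V\to V\setminus\rho$ equal to $\psi$ on $\rho$ and the identity elsewhere, $\Gamma^{\overline\psi}=\{\psi_+(\alpha):\alpha\in\Gamma\}$. *)

theory Defs
  imports Main "HOL.Vector_Spaces" "HOL-Library.Function_Algebras"
begin

definition scomplex :: "'a set set \<Rightarrow> bool" where
  "scomplex K \<longleftrightarrow> finite K \<and> (\<forall>s\<in>K. finite s) \<and> {} \<in> K \<and> (\<forall>s\<in>K. \<forall>t. t \<subseteq> s \<longrightarrow> t \<in> K)"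

definition vert :: "'a set set \<Rightarrow> 'a set" where
  "vert K = \<Union>K"

definition fdim :: "'a set \<Rightarrow> int" where
  "fdim s = int (card s) - 1"

definition cdim :: "'a set set \<Rightarrow> int" where
  "cdim K = Max (fdim ` K)"

definition lk :: "'a set set \<Rightarrow> 'a set \<Rightarrow> 'a set set" where
  "lk K s = {t - s | t. t \<in> K \<and> s \<subseteq> t}"

definition induced :: "'a set set \<Rightarrow> 'a set \<Rightarrow> 'a set set" where
  "induced K W = {a \<in> K. a \<subseteq> W}"

definition closure_of_face :: "'a set \<Rightarrow> 'a set set" where
  "closure_of_face s = Pow s"

definition bd_of_face :: "'a set \<Rightarrow> 'a set set" where
  "bd_of_face s = {t. t \<subset> s}"

definition facet :: "'a set set \<Rightarrow> 'a set \<Rightarrow> bool" where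
  "facet K s \<longleftrightarrow> s \<in> K \<and> (\<forall>t\<in>K. s \<subseteq> t \<longrightarrow> t = s)"

text \<open>Chains are finitely supported functions from faces to 'k; the chain group in card index
  k (i.e. dimension k-1, index 0 is the augmentation degree -1 spanned by the empty face).
  Orientation is induced by the linear order on vertices.\<close>

definition chains :: "'k::field itself \<Rightarrow> 'a set set \<Rightarrow> nat \<Rightarrow> ('a set \<Rightarrow> 'k) set" where
  "chains F K k = {c. \<forall>s. c s \<noteq> 0 \<longrightarrow> s \<in> K \<and> card s = k}"

definition osign :: "'a::linorder \<Rightarrow> 'a set \<Rightarrow> 'k::field" where
  "osign v t = (- 1) ^ card {u \<in> t. u < v}"

definition bdry :: "'a::linorder set set \<Rightarrow> ('a set \<Rightarrow> 'k::field) \<Rightarrow> ('a set \<Rightarrow> 'k)" where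
  "bdry K c = (\<lambda>t. \<Sum>v\<in>{v. v \<notin> t \<and> insert v t \<in> K}. osign v t * c (insert v t))"

definition cscale :: "'k::field \<Rightarrow> ('a set \<Rightarrow> 'k) \<Rightarrow> ('a set \<Rightarrow> 'k)" where
  "cscale a c = (\<lambda>s. a * c s)"

definition cycles :: "'k::field itself \<Rightarrow> 'a::linorder set set \<Rightarrow> nat \<Rightarrow> ('a set \<Rightarrow> 'k) set" where
  "cycles F K k = {c \<in> chains F K k. bdry K c = (\<lambda>_. 0)}"

definition boundaries :: "'k::field itself \<Rightarrow> 'a::linorder set set \<Rightarrow> nat \<Rightarrow> ('a set \<Rightarrow> 'k) set" where
  "boundaries F K k = bdry K ` chains F K (Suc k)"

definition rbetti_card :: "'k::field itself \<Rightarrow> 'a::linorder set set \<Rightarrow> nat \<Rightarrow> nat" where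
  "rbetti_card F K k = vector_space.dim (cscale :: 'k \<Rightarrow> _) (cycles F K k)
                       - vector_space.dim (cscale :: 'k \<Rightarrow> _) (boundaries F K k)"

definition rbetti :: "'k::field itself \<Rightarrow> 'a::linorder set set \<Rightarrow> int \<Rightarrow> nat" where
  "rbetti F K j = (if j < -1 then 0 else rbetti_card F K (nat (j + 1)))"

definition acyclic_red :: "'k::field itself \<Rightarrow> 'a::linorder set set \<Rightarrow> bool" where
  "acyclic_red F K \<longleftrightarrow> (\<forall>j. rbetti F K j = 0)"

definition sphere_homology :: "'k::field itself \<Rightarrow> int \<Rightarrow> 'a::linorder set set \<Rightarrow> bool" where
  "sphere_homology F n K \<longleftrightarrow> (\<forall>j. rbetti F K j = (if j = n then 1 else 0))"

definition hsphere :: "'k::field itself \<Rightarrow> int \<Rightarrow> 'a::linorder set set \<Rightarrow> bool" where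
  "hsphere F d S \<longleftrightarrow> scomplex S \<and> cdim S = d \<and>
     (\<forall>s\<in>S. sphere_homology F (d - fdim s - 1) (lk S s))"

definition bdc :: "'k::field itself \<Rightarrow> int \<Rightarrow> 'a::linorder set set \<Rightarrow> 'a set set" where
  "bdc F d K = {s \<in> K. -1 < fdim s \<and> fdim s < d \<and> rbetti F (lk K s) (d - fdim s - 1) = 0} \<union> {{}}"

definition hball :: "'k::field itself \<Rightarrow> int \<Rightarrow> 'a::linorder set set \<Rightarrow> bool" where
  "hball F d B \<longleftrightarrow> scomplex B \<and> cdim B = d \<and> acyclic_red F B \<and>
     (\<forall>s\<in>B. fdim s \<le> d - 1 \<longrightarrow>
        acyclic_red F (lk B s) \<or> sphere_homology F (d - fdim s - 1) (lk B s)) \<and>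
     hsphere F (d - 1) (bdc F d B)"

definition hmanifold :: "'k::field itself \<Rightarrow> int \<Rightarrow> 'a::linorder set set \<Rightarrow> bool" where
  "hmanifold F d K \<longleftrightarrow> scomplex K \<and>
     (\<forall>v\<in>vert K. hsphere F (d - 1) (lk K {v}) \<or> hball F (d - 1) (lk K {v}))"

definition hmanifold_with_boundary :: "'k::field itself \<Rightarrow> int \<Rightarrow> 'a::linorder set set \<Rightarrow> bool" where
  "hmanifold_with_boundary F d K \<longleftrightarrow> hmanifold F d K \<and> bdc F d K \<noteq> {{}}"

definition edges :: "'a set set \<Rightarrow> ('a \<times> 'a) set" where
  "edges K = {(u, w). {u, w} \<in> K}"

definition comp_verts :: "'a set set \<Rightarrow> 'a \<Rightarrow> 'a set" where
  "comp_verts K x = {w. (x, w) \<in> (edges K)\<^sup>*}"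

definition xcomponent :: "'a set set \<Rightarrow> 'a set \<Rightarrow> 'a \<Rightarrow> 'a set set" where
  "xcomponent B \<rho> x = induced B (comp_verts (induced B (vert B - \<rho>)) x \<union> \<rho>)"

definition Rset :: "'a set set \<Rightarrow> 'a set \<Rightarrow> 'a set set" where
  "Rset \<Delta> \<sigma> = {\<alpha> \<in> \<Delta>. \<alpha> \<inter> \<sigma> \<noteq> {} \<and> \<not> \<alpha> \<subseteq> \<sigma>}"

definition Rx :: "'a set set \<Rightarrow> 'a set \<Rightarrow> 'a \<Rightarrow> 'a \<Rightarrow> 'a set set" where
  "Rx \<Delta> \<sigma> x z = {\<alpha> \<in> Rset \<Delta> \<sigma>. z \<in> \<alpha> \<and> \<alpha> - {z} \<in> xcomponent (lk \<Delta> {z}) (\<sigma> - {z}) x}"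

definition Xset :: "'a set set \<Rightarrow> 'a set \<Rightarrow> 'a \<Rightarrow> 'a set set" where
  "Xset \<Delta> \<sigma> x = (\<Union>z\<in>\<sigma>. Rx \<Delta> \<sigma> x z)"

text \<open>p maps each z_i to the new vertex z_i^+.\<close>
definition plus_face :: "'a set \<Rightarrow> ('a \<Rightarrow> 'a) \<Rightarrow> 'a set \<Rightarrow> 'a set" where
  "plus_face \<sigma> p \<alpha> = (\<alpha> - \<sigma>) \<union> p ` (\<alpha> \<inter> \<sigma>)"

definition handle_deletion :: "'a set set \<Rightarrow> 'a set \<Rightarrow> 'a \<Rightarrow> ('a \<Rightarrow> 'a) \<Rightarrow> 'a set set" where
  "handle_deletion \<Delta> \<sigma> x p =
     {\<alpha> \<in> \<Delta>. \<alpha> \<notin> Xset \<Delta> \<sigma> x} \<union> plus_face \<sigma> p ` Xset \<Delta> \<sigma> x \<union> closure_of_face (p ` \<sigma>)"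

definition admissible :: "'a set set \<Rightarrow> 'a set \<Rightarrow> 'a set \<Rightarrow> ('a \<Rightarrow> 'a) \<Rightarrow> bool" where
  "admissible \<Gamma> \<rho> \<tau> \<psi> \<longleftrightarrow> bij_betw \<psi> \<rho> \<tau> \<and> (\<forall>v\<in>\<rho>. lk \<Gamma> {v} \<inter> lk \<Gamma> {\<psi> v} = {{}})"

definition handle_addition :: "'a set set \<Rightarrow> 'a set \<Rightarrow> ('a \<Rightarrow> 'a) \<Rightarrow> 'a set set" where
  "handle_addition \<Gamma> \<rho> \<psi> = (\<lambda>\<alpha>. (\<lambda>v. if v \<in> \<rho> then \<psi> v else v) ` \<alpha>) ` \<Gamma>"

end

theory Submission
  imports Defs
begin

text \<open>Over a face \<open>s\<close> with \<open>\<emptyset> \<noteq> s \<subseteq> \<sigma>\<close>, removing the vertices of \<open>\<sigma> - s\<close> one at a time from the acyclic complex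
  \<open>lk \<Delta> s\<close> leaves a complex whose degree 0 homology is generated by \<open>[x] - [y]\<close>. Hence what remains has
  exactly the two components of \<open>x\<close> and \<open>y\<close>, and being on the side of \<open>x\<close> does not depend on the vertex of
  \<open>\<sigma>\<close> from which one looks. So \<open>\<Delta>\<close> is a union of two halves, and the handle deletion glues one half to a
  relabelled copy of the other. The star of a vertex outside \<open>\<sigma>\<close> only gets relabelled. The link of a face
  \<open>s \<subseteq> \<sigma>\<close> becomes one half of \<open>lk \<Delta> s\<close>, which is acyclic because the two halves meet in a simplex; its
  boundary is one half of the sphere \<open>lk (\<partial>\<Delta>) s\<close>, capped off by \<open>\<sigma> - s\<close>. The capped half is a sphere because
  a chain bounded by the fundamental cycle of \<open>lk (\<partial>\<Delta>) s\<close> has full support, so that its restriction to one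
  half has a boundary passing through \<open>\<sigma> - s\<close>.\<close>

section \<open>Simplicial chains\<close>

text \<open>The definition of a homology manifold only constrains links of nonempty faces, so the
  global homology of \<open>\<Delta>\<close> never enters. The halves therefore separate
  \<open>\<Delta>\<close> near \<open>\<sigma>\<close> only: a vertex off \<open>\<sigma>\<close>
  may lie on different sides as seen from different vertices of \<open>\<sigma>\<close>. The
  homology computation rests on one fact: if \<open>K\<close> is acyclic, deleting a vertex
  \<open>w\<close> leaves exactly the reduced homology of the link of \<open>w\<close>. In
  \<open>lk \<Delta> s\<close> that link is the same kind of complex with \<open>w\<close> moved
  into \<open>s\<close>, so the induction ends at \<open>lk \<Delta> \<sigma>\<close>, the two
  points \<open>x\<close> and \<open>y\<close>. The obstacle is the boundary. A vertex link is a
  ball only if its boundary is a sphere, so links in the boundary complex have to be computed too,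
  and there the complex to be cut is a sphere. That the boundary of the simplex
  \<open>\<sigma> - s\<close> really separates it is a statement of Jordan type; it is read off from
  a chain one dimension higher in the acyclic \<open>lk \<Delta> s\<close>, instead of from
  duality.\<close>

interpretation cs: vector_space "cscale :: 'k::field \<Rightarrow> ('a set \<Rightarrow> 'k) \<Rightarrow> _"
  by unfold_locales (auto simp: cscale_def algebra_simps)

text \<open>\<open>bdry\<close> relative to a fixed finite vertex set, so that chains of all complexes on it share one operator.\<close>

definition D :: "'a::linorder set \<Rightarrow> ('a set \<Rightarrow> 'k::field) \<Rightarrow> 'a set \<Rightarrow> 'k" where
  "D V c t = (\<Sum>v\<in>V - t. osign v t * c (insert v t))"

text \<open>The boundary of the faces through \<open>w\<close>, read on the faces avoiding
  \<open>w\<close> (see \<open>D_split\<close>). With this sign it anticommutes with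
  \<open>D\<close>; it is the chain form of the connecting map to the link of
  \<open>w\<close>.\<close>

definition lnk :: "'a::linorder \<Rightarrow> ('a set \<Rightarrow> 'k::field) \<Rightarrow> 'a set \<Rightarrow> 'k" where
  "lnk w c t = (if w \<in> t then 0 else osign w t * c (insert w t))"

definition point :: "'a \<Rightarrow> 'a set \<Rightarrow> 'k::field" where
  "point v t = (if t = {v} then 1 else 0)"

definition restr :: "('a set \<Rightarrow> bool) \<Rightarrow> ('a set \<Rightarrow> 'k::field) \<Rightarrow> 'a set \<Rightarrow> 'k" where
  "restr P c t = (if P t then c t else 0)"

lemma osign_sq [simp]: "osign v t * osign v t = (1::'k::field)"
  by (simp add: osign_def flip: power_add mult_2)

lemma osign_sq_left [simp]: "osign v t * (osign v t * y) = (y::'k::field)"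
  by (simp flip: mult.assoc)

lemma osign_nz [simp]: "osign v t \<noteq> (0::'k::field)"
  by (simp add: osign_def)

lemma osign_empty [simp]: "osign v {} = (1::'k::field)"
  by (simp add: osign_def)

lemma osign_insert:
  assumes "finite t" "w \<notin> t"
  shows "osign v (insert w t) = (if w < v then - osign v t else osign v t :: 'k::field)"
proof (cases "w < v")
  case True
  then have "{u \<in> insert w t. u < v} = insert w {u \<in> t. u < v}" by auto
  then show ?thesis using assms True by (simp add: osign_def)
next
  case False
  then have "{u \<in> insert w t. u < v} = {u \<in> t. u < v}" by auto
  then show ?thesis using False by (simp add: osign_def)
qed

lemma osign_anticommute:
  assumes "finite t" "v \<notin> t" "w \<notin> t" "v \<noteq> w"
  shows "osign v t * osign w (insert v t) = - (osign w t * osign v (insert w t) :: 'k::field)"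
  using assms by (cases "v < w") (auto simp: osign_insert)

lemma D_add: "D V (c + e) = D V c + D V e"
  by (rule ext) (simp add: D_def algebra_simps sum.distrib)

lemma D_diff: "D V (c - e) = D V c - D V e"
  by (rule ext) (simp add: D_def algebra_simps sum_subtractf)

lemma D_scale: "D V (cscale a c) = cscale a (D V c)"
  by (rule ext) (simp add: D_def cscale_def sum_distrib_left algebra_simps)

lemma D_zero [simp]: "D V 0 = 0"
  by (rule ext) (simp add: D_def)

lemma D_nonzeroD:
  assumes "D V c t \<noteq> 0"
  obtains v where "v \<in> V" "v \<notin> t" "c (insert v t) \<noteq> 0"
  using assms unfolding D_def by (metis (no_types, lifting) Diff_iff mult_zero_right sum.neutral)

lemma D_outside: "\<forall>s. c s \<noteq> 0 \<longrightarrow> s \<subseteq> V \<Longrightarrow> \<not> t \<subseteq> V \<Longrightarrow> D V c t = 0"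
  by (meson D_nonzeroD subset_insertI subset_trans)

lemma D_D:
  fixes c :: "'a::linorder set \<Rightarrow> 'k::field"
  assumes V: "finite V" and c: "\<forall>s. c s \<noteq> 0 \<longrightarrow> s \<subseteq> V"
  shows "D V (D V c) = 0"
proof
  fix t :: "'a set"
  show "D V (D V c) t = 0 t"
  proof (cases "t \<subseteq> V")
    case False
    have "\<forall>s. D V c s \<noteq> 0 \<longrightarrow> s \<subseteq> V" using D_outside c by blast
    then show ?thesis using D_outside False by (metis zero_fun_apply)
  next
    case True
    then have t: "finite t" using V finite_subset by blast
    define W where "W = V - t"
    define g where "g = (\<lambda>(v, w). osign v t * (osign w (insert v t) * c (insert w (insert v t))))"
    have W: "finite W" using V by (simp add: W_def)
    have anti: "g (w, v) = - g (v, w)" if "v \<in> W" "w \<in> W" "v < w" for v w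
      using osign_anticommute[OF t, of v w, where 'k='k] that
      by (simp add: g_def W_def insert_commute flip: mult.assoc)
    define L where "L = {(v, w). v \<in> W \<and> w \<in> W \<and> v < w}"
    have L: "finite L" by (rule finite_subset[of _ "W \<times> W"]) (auto simp: L_def W)
    define R where "R = {(v, w). v \<in> W \<and> w \<in> W \<and> w < v}"
    have R: "finite R" by (rule finite_subset[of _ "W \<times> W"]) (auto simp: R_def W)
    have S: "(SIGMA v:W. W - {v}) = L \<union> R"
      by (auto simp: L_def R_def linorder_neq_iff)
    have disj: "L \<inter> R = {}"
      by (auto simp: L_def R_def)
    have "D V (D V c) t = (\<Sum>v\<in>W. \<Sum>w\<in>W - {v}. g (v, w))"
    proof -
      have "D V (D V c) t = (\<Sum>v\<in>W. osign v t * (\<Sum>w\<in>W - {v}. osign w (insert v t) * c (insert w (insert v t))))"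
        unfolding D_def W_def Diff_insert[of V] ..
      also have "\<dots> = (\<Sum>v\<in>W. \<Sum>w\<in>W - {v}. g (v, w))"
        unfolding g_def prod.case sum_distrib_left ..
      finally show ?thesis .
    qed
    also have "\<dots> = sum g (SIGMA v:W. W - {v})"
      using W by (subst sum.Sigma) auto
    also have "\<dots> = sum g L + sum g R"
      unfolding S using L R disj by (rule sum.union_disjoint)
    also have "sum g R = (\<Sum>p\<in>L. - g p)"
      by (rule sum.reindex_bij_witness[of _ prod.swap prod.swap]) (auto simp: L_def R_def anti)
    finally show ?thesis by (simp add: sum_negf)
  qed
qed

lemma D_split:
  assumes "finite V" "w \<in> V" "w \<notin> t"
  shows "D V c t = D V (restr (\<lambda>s. w \<notin> s) c) t + lnk w c t"
proof -
  have "D V c t = osign w t * c (insert w t) + (\<Sum>v\<in>V - t - {w}. osign v t * c (insert v t))"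
    unfolding D_def using assms by (subst sum.remove[of _ w]) auto
  also have "(\<Sum>v\<in>V - t - {w}. osign v t * c (insert v t))
      = (\<Sum>v\<in>V - t - {w}. osign v t * restr (\<lambda>s. w \<notin> s) c (insert v t))"
    using assms by (intro sum.cong) (auto simp: restr_def)
  also have "\<dots> = D V (restr (\<lambda>s. w \<notin> s) c) t"
    unfolding D_def using assms by (subst (2) sum.remove[of _ w]) (auto simp: restr_def)
  finally show ?thesis using assms by (simp add: lnk_def)
qed

lemma D_lnk:
  fixes c :: "'a::linorder set \<Rightarrow> 'k::field"
  assumes V: "finite V" "w \<in> V" and c: "\<forall>s. c s \<noteq> 0 \<longrightarrow> s \<subseteq> V"
  shows "D V (lnk w c) = - lnk w (D V c)"
proof
  fix t
  consider "\<not> t \<subseteq> V" | "w \<in> t" | "t \<subseteq> V" "w \<notin> t" by blast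
  then show "D V (lnk w c) t = (- lnk w (D V c)) t"
  proof cases
    case 1
    then have "D V (lnk w c) t = 0"
      using c by (intro D_outside) (auto simp: lnk_def)
    moreover have "D V c (insert w t) = 0"
      using 1 c by (intro D_outside) auto
    ultimately show ?thesis by (simp add: lnk_def)
  next
    case 2
    then show ?thesis by (simp add: lnk_def D_def)
  next
    case 3
    then have t: "finite t" using V finite_subset by blast
    have "D V (lnk w c) t = (\<Sum>v\<in>V - t - {w}. osign v t * lnk w c (insert v t))"
      unfolding D_def using V 3 by (subst sum.remove[of _ w]) (auto simp: lnk_def)
    also have "\<dots> = (\<Sum>v\<in>V - insert w t. - (osign w t * (osign v (insert w t) * c (insert v (insert w t)))))"
      using osign_anticommute[OF t _ 3(2), where 'k='k] 3(2)
      by (intro sum.cong) (auto simp: lnk_def insert_commute simp flip: mult.assoc)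
    also have "\<dots> = (- lnk w (D V c)) t"
      using 3 by (simp add: lnk_def D_def sum_distrib_left sum_negf)
    finally show ?thesis .
  qed
qed

lemma chains_iff: "c \<in> chains F K k \<longleftrightarrow> (\<forall>s. c s \<noteq> 0 \<longrightarrow> s \<in> K \<and> card s = k)"
  by (simp add: chains_def)

lemma chains_onD: "c \<in> chains F K k \<Longrightarrow> K \<subseteq> Pow V \<Longrightarrow> \<forall>s. c s \<noteq> 0 \<longrightarrow> s \<subseteq> V"
  by (auto simp: chains_def)

lemma chains_mono: "c \<in> chains F K k \<Longrightarrow> K \<subseteq> L \<Longrightarrow> c \<in> chains F L k"
  by (auto simp: chains_def)

lemma chains_add: "c \<in> chains F K k \<Longrightarrow> e \<in> chains F K k \<Longrightarrow> c + e \<in> chains F K k"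
  by (auto simp: chains_def) (metis add.right_neutral)+

lemma chains_diff: "c \<in> chains F K k \<Longrightarrow> e \<in> chains F K k \<Longrightarrow> c - e \<in> chains F K k"
  by (auto simp: chains_def) (metis diff_zero)+

lemma chains_scale: "c \<in> chains F K k \<Longrightarrow> cscale a c \<in> chains F K k"
  by (auto simp: chains_def cscale_def)

lemma chains_zero: "0 \<in> chains F K k"
  by (auto simp: chains_def)

lemma D_chains:
  assumes c: "c \<in> chains F K (Suc k)" and K: "\<And>s t. s \<in> K \<Longrightarrow> t \<subseteq> s \<Longrightarrow> t \<in> K"
  shows "D V c \<in> chains F K k"
  unfolding chains_iff
proof (intro allI impI)
  fix t assume "D V c t \<noteq> 0"
  then obtain v where v: "v \<notin> t" "c (insert v t) \<noteq> 0" by (rule D_nonzeroD)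
  then have "insert v t \<in> K" and card: "card (insert v t) = Suc k" using c by (auto simp: chains_iff)
  then have "t \<in> K" using K by blast
  moreover have "finite (insert v t)" using card card_gt_0_iff by fastforce
  ultimately show "t \<in> K \<and> card t = k" using v card by simp
qed

lemma bdry_eq_D:
  assumes "finite V" "K \<subseteq> Pow V" "c \<in> chains F K k"
  shows "bdry K c = D V c"
proof
  fix t
  show "bdry K c t = D V c t"
    unfolding bdry_def D_def using assms
    by (intro sum.mono_neutral_left) (auto simp: chains_iff)
qed

text \<open>Exactness in the reduced sense: \<open>k = 0\<close> is included, so the empty face has
  to bound and \<open>{{}}\<close> is not acyclic.\<close>

definition acyc :: "'k::field itself \<Rightarrow> 'a::linorder set set \<Rightarrow> bool" where
  "acyc F K \<longleftrightarrow> (\<forall>k. cycles F K k \<subseteq> boundaries F K k)"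

text \<open>The index \<open>n\<close> counts vertices: a \<open>k\<close>-sphere has \<open>n = k + 1\<close>.\<close>

definition sph :: "'k::field itself \<Rightarrow> nat \<Rightarrow> 'a::linorder set set \<Rightarrow> bool" where
  "sph F n K \<longleftrightarrow> (\<forall>k. k \<noteq> n \<longrightarrow> cycles F K k \<subseteq> boundaries F K k) \<and>
     (\<exists>g \<in> cycles F K n - boundaries F K n. \<forall>c \<in> cycles F K n. \<exists>a. c - cscale a g \<in> boundaries F K n)"

context
  fixes F :: "'k::field itself" and V :: "'a::linorder set" and K :: "'a set set"
  assumes V: "finite V" and K: "K \<subseteq> Pow V"
begin

lemma cycles_iff: "c \<in> cycles F K k \<longleftrightarrow> c \<in> chains F K k \<and> D V c = 0"
  unfolding cycles_def mem_Collect_eq zero_fun_def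
  using bdry_eq_D[OF V K, of c F k] by auto

lemma boundaries_iff: "c \<in> boundaries F K k \<longleftrightarrow> (\<exists>b \<in> chains F K (Suc k). c = D V b)"
  unfolding boundaries_def image_iff by (intro bex_cong refl) (use bdry_eq_D[OF V K] in metis)

end

section \<open>Betti numbers and exactness\<close>

context vector_space
begin

text \<open>Betti numbers are natural differences of dimensions in a function space that may have
  infinite dimension. Extending a basis of \<open>U\<close> to one of \<open>W\<close> turns the
  difference into the size of a finite set; \<open>T\<close> supplies the finiteness.\<close>

lemma subspace_dim_diff_cases:
  assumes UW: "U \<subseteq> W" and U: "subspace U" and T: "finite T" "W \<subseteq> span T"
  obtains B C where "B \<subseteq> C" "finite C" "independent C" "span B = U" "C \<subseteq> W" "W \<subseteq> span C"
    "dim W - dim U = card (C - B)" "dim U = card B"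
proof -
  obtain B where B: "B \<subseteq> U" "independent B" "U \<subseteq> span B" "card B = dim U"
    using basis_exists by blast
  obtain C where C: "B \<subseteq> C" "C \<subseteq> W" "independent C" "W \<subseteq> span C"
    using maximal_independent_subset_extend[of B W] B UW by blast
  have fin: "finite C" using independent_span_bound[OF T(1) C(3)] C(2) T(2) by blast
  have "dim W = card C" using C basis_card_eq_dim by metis
  then have d: "dim W - dim U = card (C - B)" using B C fin by (simp add: card_Diff_subset finite_subset)
  have "span B = U" using B U span_minimal by blast
  then show ?thesis using that[OF C(1) fin C(3) _ C(2,4) d B(4)[symmetric]] by blast
qed

lemma dim_diff_eq_0_iff:
  assumes "U \<subseteq> W" "subspace U" "finite T" "W \<subseteq> span T"
  shows "dim W - dim U = 0 \<longleftrightarrow> W \<subseteq> U"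
proof
  obtain B C where BC: "B \<subseteq> C" "finite C" "span B = U" "W \<subseteq> span C" "dim W - dim U = card (C - B)"
    using subspace_dim_diff_cases[OF assms] by metis
  assume "dim W - dim U = 0"
  then have "C = B" using BC by auto
  then show "W \<subseteq> U" using BC by simp
next
  assume "W \<subseteq> U"
  then have "W = U" using assms by blast
  then show "dim W - dim U = 0" by simp
qed

lemma dim_diff_eq_1_iff:
  assumes UW: "U \<subseteq> W" and U: "subspace U" and W: "subspace W" and T: "finite T" "W \<subseteq> span T"
  shows "dim W - dim U = 1 \<longleftrightarrow> (\<exists>g\<in>W - U. \<forall>c\<in>W. \<exists>a. c - scale a g \<in> U)"
proof -
  obtain B C where BC: "B \<subseteq> C" "finite C" "independent C" "span B = U" "C \<subseteq> W" "W \<subseteq> span C"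
    "dim W - dim U = card (C - B)" "dim U = card B"
    using subspace_dim_diff_cases[OF UW U T] by metis
  show ?thesis
  proof
    assume "dim W - dim U = 1"
    then obtain g where g: "C - B = {g}" using BC card_1_singletonE by metis
    then have C: "C = insert g B" "g \<notin> B" using BC by auto
    then have "g \<notin> U" using BC independent_insert by auto
    moreover have "g \<in> W" using C BC by auto
    moreover have "\<exists>a. c - scale a g \<in> U" if "c \<in> W" for c
      using that BC C span_breakdown_eq by auto
    ultimately show "\<exists>g\<in>W - U. \<forall>c\<in>W. \<exists>a. c - scale a g \<in> U" by blast
  next
    assume "\<exists>g\<in>W - U. \<forall>c\<in>W. \<exists>a. c - scale a g \<in> U"
    then obtain g where g: "g \<in> W" "g \<notin> U" "\<And>c. c \<in> W \<Longrightarrow> \<exists>a. c - scale a g \<in> U" by blast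
    have "independent B" using BC independent_mono by blast
    then have ind: "independent (insert g B)" using g BC independent_insertI by blast
    have "g \<notin> B" using g BC span_superset by blast
    then have "card (insert g B) = Suc (card B)" using BC finite_subset by (metis card_insert_disjoint)
    moreover have "insert g B \<subseteq> W" using g BC by blast
    moreover have "W \<subseteq> span (insert g B)" using g(3) BC span_breakdown_eq by auto
    ultimately have "dim W = Suc (card B)" using dim_unique ind by blast
    then show "dim W - dim U = 1" using BC by simp
  qed
qed

end

lemma scomplex_Pow: "scomplex K \<Longrightarrow> K \<subseteq> Pow (vert K)"
  by (auto simp: vert_def)

lemma scomplex_finite_vert: "scomplex K \<Longrightarrow> finite (vert K)"
  by (auto simp: vert_def scomplex_def)

lemma scomplex_subset: "scomplex K \<Longrightarrow> s \<in> K \<Longrightarrow> t \<subseteq> s \<Longrightarrow> t \<in> K"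
  by (auto simp: scomplex_def)

lemma chains_span:
  fixes F :: "'k::field itself" and K :: "'a set set"
  assumes "finite K"
  obtains T where "finite T" "chains F K k \<subseteq> cs.span T"
proof
  define ind where "ind = (\<lambda>(s::'a set) t. if t = s then 1 else 0 :: 'k)"
  show "finite (ind ` K)" using assms by simp
  show "chains F K k \<subseteq> cs.span (ind ` K)"
  proof
    fix c assume "c \<in> chains F K k"
    then have c: "\<And>s. s \<notin> K \<Longrightarrow> c s = 0" by (auto simp: chains_iff)
    have "c = (\<Sum>s\<in>K. cscale (c s) (ind s))"
    proof
      fix t
      have "(\<Sum>s\<in>K. cscale (c s) (ind s)) t = (\<Sum>s\<in>K. c s * ind s t)"
        using assms by (induction K rule: finite_induct) (auto simp: cscale_def)
      also have "\<dots> = c t"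
        using assms c by (simp add: ind_def if_distrib[of "(*) _"] cong: if_cong)
      finally show "c t = (\<Sum>s\<in>K. cscale (c s) (ind s)) t" ..
    qed
    also have "\<dots> \<in> cs.span (ind ` K)"
      by (intro cs.span_sum cs.span_scale cs.span_base) auto
    finally show "c \<in> cs.span (ind ` K)" .
  qed
qed

context
  fixes F :: "'k::field itself" and K :: "'a::linorder set set"
  assumes K: "scomplex K"
begin

lemmas cycles_vert = cycles_iff[OF scomplex_finite_vert[OF K] scomplex_Pow[OF K]]
lemmas boundaries_vert = boundaries_iff[OF scomplex_finite_vert[OF K] scomplex_Pow[OF K]]

lemma boundaries_subset_cycles: "boundaries F K k \<subseteq> cycles F K k"
proof
  fix c assume "c \<in> boundaries F K k"
  then obtain b where b: "b \<in> chains F K (Suc k)" "c = D (vert K) b" by (auto simp: boundaries_vert)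
  then have "c \<in> chains F K k" using D_chains scomplex_subset[OF K] by blast
  moreover have "D (vert K) c = 0"
    using b D_D[OF scomplex_finite_vert[OF K] chains_onD[OF b(1) scomplex_Pow[OF K]]] by simp
  ultimately show "c \<in> cycles F K k" by (simp add: cycles_vert)
qed

lemma subspace_boundaries: "cs.subspace (boundaries F K k)"
proof (rule cs.subspaceI)
  show "0 \<in> boundaries F K k" by (auto simp: boundaries_vert intro!: bexI[of _ 0] chains_zero)
next
  fix c e assume "c \<in> boundaries F K k" "e \<in> boundaries F K k"
  then show "c + e \<in> boundaries F K k" by (auto simp: boundaries_vert simp flip: D_add intro: chains_add)
next
  fix a c assume "c \<in> boundaries F K k"
  then show "cscale a c \<in> boundaries F K k" by (auto simp: boundaries_vert simp flip: D_scale intro: chains_scale)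
qed

lemma subspace_cycles: "cs.subspace (cycles F K k)"
proof (rule cs.subspaceI)
  show "0 \<in> cycles F K k" by (auto simp: cycles_vert intro!: chains_zero)
next
  fix c e assume "c \<in> cycles F K k" "e \<in> cycles F K k"
  then show "c + e \<in> cycles F K k" by (auto simp: cycles_vert D_add intro: chains_add)
next
  fix a c assume "c \<in> cycles F K k"
  then show "cscale a c \<in> cycles F K k" by (simp add: cycles_vert D_scale chains_scale)
qed

lemma cycles_span: obtains T where "finite T" "cycles F K k \<subseteq> cs.span T"
proof -
  have "finite K" using K by (simp add: scomplex_def)
  then obtain T where "finite T" "chains F K k \<subseteq> cs.span T" by (rule chains_span)
  moreover have "cycles F K k \<subseteq> chains F K k" by (auto simp: cycles_vert)
  ultimately show ?thesis using that by (meson order_trans)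
qed

lemma rbetti_card_eq_0_iff: "rbetti_card F K k = 0 \<longleftrightarrow> cycles F K k \<subseteq> boundaries F K k"
proof -
  obtain T where "finite T" "cycles F K k \<subseteq> cs.span T" by (rule cycles_span)
  then show ?thesis unfolding rbetti_card_def
    by (rule cs.dim_diff_eq_0_iff[OF boundaries_subset_cycles subspace_boundaries])
qed

lemma rbetti_card_eq_1_iff: "rbetti_card F K k = 1 \<longleftrightarrow>
  (\<exists>g\<in>cycles F K k - boundaries F K k. \<forall>c\<in>cycles F K k. \<exists>a. c - cscale a g \<in> boundaries F K k)"
proof -
  obtain T where "finite T" "cycles F K k \<subseteq> cs.span T" by (rule cycles_span)
  then show ?thesis unfolding rbetti_card_def
    by (rule cs.dim_diff_eq_1_iff[OF boundaries_subset_cycles subspace_boundaries subspace_cycles])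
qed

lemma acyclic_red_iff: "acyclic_red F K \<longleftrightarrow> acyc F K"
proof
  assume L: "acyclic_red F K"
  show "acyc F K"
    unfolding acyc_def
  proof
    fix k
    have "rbetti F K (int k - 1) = 0" using L by (simp add: acyclic_red_def)
    then show "cycles F K k \<subseteq> boundaries F K k" by (simp add: rbetti_def rbetti_card_eq_0_iff)
  qed
qed (auto simp: acyclic_red_def acyc_def rbetti_def rbetti_card_eq_0_iff)

text \<open>The bound on \<open>m\<close> matters: \<open>rbetti\<close> vanishes below degree -1,
  whereas \<open>nat (m + 1)\<close> would turn every smaller \<open>m\<close> into 0, the index of
  the empty sphere.\<close>

lemma sphere_homology_iff: "sphere_homology F m K \<longleftrightarrow> -1 \<le> m \<and> sph F (nat (m + 1)) K"
proof
  assume L: "sphere_homology F m K"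
  have m: "-1 \<le> m"
  proof (rule ccontr)
    assume "\<not> -1 \<le> m"
    then have "rbetti F K m = 0" by (simp add: rbetti_def)
    then show False using L unfolding sphere_homology_def by (metis zero_neq_one)
  qed
  have "rbetti_card F K k = (if k = nat (m + 1) then 1 else 0)" for k
  proof -
    have "rbetti F K (int k - 1) = (if int k - 1 = m then 1 else 0)"
      using L unfolding sphere_homology_def by blast
    then show ?thesis using m by (auto simp: rbetti_def split: if_splits)
  qed
  then show "-1 \<le> m \<and> sph F (nat (m + 1)) K"
    unfolding sph_def rbetti_card_eq_0_iff[symmetric] rbetti_card_eq_1_iff[symmetric] using m by simp
next
  assume "-1 \<le> m \<and> sph F (nat (m + 1)) K"
  then show "sphere_homology F m K"
    unfolding sph_def rbetti_card_eq_0_iff[symmetric] rbetti_card_eq_1_iff[symmetric] sphere_homology_def rbetti_def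
    by auto
qed

end

lemma not_acyc_sph: "sph F n K \<Longrightarrow> \<not> acyc F K"
  unfolding sph_def acyc_def by blast

lemma sph_unique: "sph F n K \<Longrightarrow> sph F m K \<Longrightarrow> n = m"
  unfolding sph_def by blast

section \<open>Acyclic complexes and homology spheres\<close>

lemma acyc_iff_D:
  assumes "finite V" "K \<subseteq> Pow V"
  shows "acyc F K \<longleftrightarrow> (\<forall>k. \<forall>c\<in>chains F K k. D V c = 0 \<longrightarrow> (\<exists>b\<in>chains F K (Suc k). c = D V b))"
  unfolding acyc_def subset_iff cycles_iff[OF assms] boundaries_iff[OF assms] by blast

lemma acycD:
  assumes "acyc F K" "finite V" "K \<subseteq> Pow V" "c \<in> chains F K k" "D V c = 0"
  obtains b where "b \<in> chains F K (Suc k)" "c = D V b"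
  using assms acyc_iff_D[OF assms(2,3)] by blast

lemma acycI:
  assumes "finite V" "K \<subseteq> Pow V"
    and "\<And>k c. c \<in> chains F K k \<Longrightarrow> D V c = 0 \<Longrightarrow> \<exists>b\<in>chains F K (Suc k). c = D V b"
  shows "acyc F K"
  unfolding acyc_iff_D[OF assms(1,2)] using assms(3) by simp

lemma sph_iff_D:
  assumes "finite V" "K \<subseteq> Pow V"
  shows "sph F n K \<longleftrightarrow>
    (\<forall>k. k \<noteq> n \<longrightarrow> (\<forall>c\<in>chains F K k. D V c = 0 \<longrightarrow> (\<exists>b\<in>chains F K (Suc k). c = D V b))) \<and>
    (\<exists>g\<in>chains F K n. D V g = 0 \<and> (\<forall>b\<in>chains F K (Suc n). g \<noteq> D V b) \<and>
       (\<forall>c\<in>chains F K n. D V c = 0 \<longrightarrow> (\<exists>a. \<exists>b\<in>chains F K (Suc n). c - cscale a g = D V b)))"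
  by (simp add: sph_def subset_iff cycles_iff[OF assms] boundaries_iff[OF assms] Bex_def Ball_def conj_assoc imp_conjL)

lemma sph_cycle:
  assumes "sph F n K" "finite V" "K \<subseteq> Pow V" "k \<noteq> n" "c \<in> chains F K k" "D V c = 0"
  obtains b where "b \<in> chains F K (Suc k)" "c = D V b"
  using sph_iff_D[OF assms(2,3), THEN iffD1, OF assms(1), THEN conjunct1, rule_format, OF assms(4-6)]
  by (elim bexE) (rule that)

lemma sph_gen:
  assumes "sph F n K" "finite V" "K \<subseteq> Pow V"
  obtains g where "g \<in> chains F K n" "D V g = 0" "\<And>b. b \<in> chains F K (Suc n) \<Longrightarrow> g \<noteq> D V b"
    "\<And>c. c \<in> chains F K n \<Longrightarrow> D V c = 0 \<Longrightarrow> \<exists>a. \<exists>b\<in>chains F K (Suc n). c - cscale a g = D V b"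
  using sph_iff_D[OF assms(2,3), THEN iffD1, OF assms(1), THEN conjunct2]
  by (elim bexE conjE) (rule that, auto)

lemma chains_top: "(\<And>s. s \<in> K \<Longrightarrow> card s < k) \<Longrightarrow> c \<in> chains F K k \<Longrightarrow> c = 0"
  by (force simp: chains_iff)

text \<open>A generator that does not bound is nonzero, so its support contains a face of size
  \<open>n\<close>. This supplies the dimension of the boundary of a ball.\<close>

lemma sph_dim:
  assumes K: "scomplex K" and "sph F n K"
  obtains s where "s \<in> K" "card s = n"
proof -
  obtain g where g: "g \<in> chains F K n" "\<And>b. b \<in> chains F K (Suc n) \<Longrightarrow> g \<noteq> D (vert K) b"
    using sph_gen[OF assms(2) scomplex_finite_vert[OF K] scomplex_Pow[OF K]] by metis
  have "g \<noteq> 0" using g(2)[OF chains_zero] by simp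
  then show ?thesis using g(1) that by (force simp: chains_iff)
qed

lemma D_chain_0:
  assumes "finite V" "K \<subseteq> Pow V" "c \<in> chains F K 0"
  shows "D V c = 0"
proof (rule ext, rule ccontr)
  fix t assume "D V c t \<noteq> 0 t"
  then obtain v where "c (insert v t) \<noteq> 0" by (auto elim: D_nonzeroD)
  then have "card (insert v t) = 0" "insert v t \<subseteq> V" using assms by (auto simp: chains_iff)
  then show False using assms(1) by (metis card_0_eq finite_subset insert_not_empty)
qed

text \<open>This is the sphere of dimension -1, which occurs as the link of every face of maximal
  size.\<close>

lemma sph_0_empty:
  fixes F :: "'k::field itself"
  shows "sph F 0 {{} :: 'a::linorder set}"
proof -
  have no: "b = 0" if "b \<in> chains F {{}} (Suc k)" for b :: "'a set \<Rightarrow> 'k" and k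
    using that by (intro chains_top) auto
  have 1: "finite ({}::'a set)" "{{}} \<subseteq> Pow ({}::'a set)" by auto
  define g where "g = (\<lambda>s::'a set. if s = {} then 1 else 0 :: 'k)"
  have g: "g \<in> chains F {{}} 0" by (auto simp: g_def chains_iff)
  have g0: "g \<noteq> 0" by (auto simp: g_def fun_eq_iff)
  have gen: "c - cscale (c {}) g = D {} 0" if "c \<in> chains F {{}} 0" for c
    using that by (force simp: g_def cscale_def chains_iff fun_eq_iff)
  show ?thesis
    unfolding sph_iff_D[OF 1]
  proof (rule conjI)
    have triv: "\<exists>b\<in>chains F {{}} (Suc k). c = D {} b" if "k \<noteq> 0" "c \<in> chains F {{}} k"
      for k and c :: "'a set \<Rightarrow> 'k"
    proof -
      have "c = 0" using no[of c "k - 1"] that by simp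
      then show ?thesis by (intro bexI[of _ 0]) (simp_all add: chains_zero)
    qed
    show "\<forall>k. k \<noteq> 0 \<longrightarrow> (\<forall>c\<in>chains F {{}::'a set} k. D {} c = 0 \<longrightarrow> (\<exists>b\<in>chains F {{}} (Suc k). c = D {} b))"
      by (intro allI impI ballI triv)
    have "g \<noteq> D {} b" if "b \<in> chains F {{}} (Suc 0)" for b
      using no[OF that] g0 by simp
    moreover have "\<exists>a. \<exists>b\<in>chains F {{}} (Suc 0). c - cscale a g = D {} b" if "c \<in> chains F {{}} 0" for c
      using gen[OF that] by (intro exI bexI) (auto intro: chains_zero)
    ultimately show "\<exists>g\<in>chains F {{}::'a set} 0. D {} g = 0 \<and> (\<forall>b\<in>chains F {{}} (Suc 0). g \<noteq> D {} b) \<and>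
       (\<forall>c\<in>chains F {{}} 0. D {} c = 0 \<longrightarrow> (\<exists>a. \<exists>b\<in>chains F {{}} (Suc 0). c - cscale a g = D {} b))"
      using g D_chain_0[OF 1 g] by (intro bexI[of _ g]) simp_all
  qed
qed

text \<open>A simplex is a cone with apex \<open>w\<close>. The chain \<open>b\<close> is the cone
  over the part of \<open>c\<close> avoiding \<open>w\<close>. Its boundary is \<open>c\<close> on
  the faces avoiding \<open>w\<close> by construction, and on the faces through \<open>w\<close>
  because \<open>c\<close> is a cycle.\<close>

lemma acyc_Pow:
  fixes F :: "'k::field itself" and r :: "'a::linorder set"
  assumes r: "finite r" "r \<noteq> {}"
  shows "acyc F (Pow r)"
proof (rule acycI[OF r(1) order_refl])
  fix k and c :: "'a set \<Rightarrow> 'k" assume c: "c \<in> chains F (Pow r) k" and Dc: "D r c = 0"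
  obtain w where w: "w \<in> r" using r by auto
  define b where "b = (\<lambda>t. if w \<in> t then osign w (t - {w}) * c (t - {w}) else 0 :: 'k)"
  have b: "b \<in> chains F (Pow r) (Suc k)"
    unfolding chains_iff
  proof (intro allI impI)
    fix t assume "b t \<noteq> 0"
    then have t: "w \<in> t" "c (t - {w}) \<noteq> 0" by (auto simp: b_def split: if_splits)
    then have "t - {w} \<subseteq> r" "card (t - {w}) = k" using c by (auto simp: chains_iff)
    moreover have "t = insert w (t - {w})" using t by blast
    ultimately show "t \<in> Pow r \<and> card t = Suc k"
      using w r(1) by (metis PowI card_insert_disjoint finite_subset insert_subset Diff_iff singletonI)
  qed
  have on: "\<forall>s. c s \<noteq> 0 \<longrightarrow> s \<subseteq> r" "\<forall>s. b s \<noteq> 0 \<longrightarrow> s \<subseteq> r"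
    using chains_onD[OF c] chains_onD[OF b] by auto
  have lnkb: "lnk w b = restr (\<lambda>s. w \<notin> s) c"
    by (auto simp: lnk_def b_def restr_def fun_eq_iff)
  have b0: "restr (\<lambda>s. w \<notin> s) b = 0"
    by (auto simp: b_def restr_def fun_eq_iff)
  have off: "D r b t = c t" if "w \<notin> t" for t
    using D_split[OF r(1) w that, of b] that by (simp add: b0 lnkb restr_def)
  have "D r b = c"
  proof
    fix t
    show "D r b t = c t"
    proof (cases "w \<in> t")
      case True
      then obtain u where u: "t = insert w u" "w \<notin> u" by (meson mk_disjoint_insert)
      have "lnk w (D r b) u = - D r (lnk w b) u"
        by (simp add: D_lnk[OF r(1) w on(2)])
      also have "\<dots> = lnk w c u"
        using D_split[OF r(1) w u(2), of c] by (simp add: lnkb Dc add_eq_0_iff)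
      finally show ?thesis using u by (simp add: lnk_def)
    qed (rule off)
  qed
  then show "\<exists>b\<in>chains F (Pow r) (Suc k). c = D r b" using b by blast
qed

lemma restr_chains: "c \<in> chains F K k \<Longrightarrow> restr P c \<in> chains F {s \<in> K. P s} k"
  by (auto simp: chains_iff restr_def)

text \<open>Mayer--Vietoris in the only form needed: \<open>D (restr Kx b)\<close> is carried by
  \<open>Kx \<inter> Ky\<close>, so it can be filled inside the acyclic complex \<open>P\<close>.\<close>

lemma boundary_push:
  fixes F :: "'k::field itself"
  assumes V: "finite V" "P \<subseteq> Pow V" "Kx \<union> Ky \<subseteq> Pow V"
    and P: "acyc F P" "Kx \<inter> Ky \<subseteq> P"
    and Kx: "\<And>s t. s \<in> Kx \<Longrightarrow> t \<subseteq> s \<Longrightarrow> t \<in> Kx" and Ky: "\<And>s t. s \<in> Ky \<Longrightarrow> t \<subseteq> s \<Longrightarrow> t \<in> Ky"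
    and b: "b \<in> chains F (Kx \<union> Ky) (Suc k)" and h: "D V b \<in> chains F Ky k"
  obtains b' where "b' \<in> chains F (Ky \<union> P) (Suc k)" "D V b' = D V b"
proof -
  \<comment> \<open>Faces common to both parts are assigned to \<open>Ky\<close>. So
    \<open>bx\<close> lives on \<open>Kx\<close>, and its boundary, the difference of
    \<open>D V b\<close> and \<open>D V by'\<close>, lies on \<open>Ky\<close> as well.\<close>
  define by' where "by' = restr (\<lambda>s. s \<in> Ky) b"
  define bx where "bx = b - by'"
  have by': "by' \<in> chains F Ky (Suc k)"
    using restr_chains[OF b, of "\<lambda>s. s \<in> Ky"] unfolding by'_def by (rule chains_mono) auto
  have bx: "bx \<in> chains F Kx (Suc k)"
    using b by (auto simp: bx_def by'_def restr_def chains_iff)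
  have e: "D V bx = D V b - D V by'" by (simp add: bx_def D_diff)
  have "D V bx \<in> chains F Kx k" using D_chains[OF bx] Kx by blast
  moreover have "D V bx \<in> chains F Ky k"
    unfolding e using D_chains[OF by'] Ky by (intro chains_diff h) blast
  ultimately have "D V bx \<in> chains F P k" using P(2) by (auto simp: chains_iff)
  moreover have "D V (D V bx) = 0"
    using V bx by (intro D_D chains_onD[of _ F Kx "Suc k"]) auto
  ultimately obtain f where f: "f \<in> chains F P (Suc k)" "D V bx = D V f"
    using acycD[OF P(1) V(1,2)] by metis
  show ?thesis
  proof
    show "by' + f \<in> chains F (Ky \<union> P) (Suc k)"
      using by' f(1) by (intro chains_add) (auto elim: chains_mono)
    show "D V (by' + f) = D V b"
      using e f(2) by (simp add: D_add)
  qed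
qed

section \<open>Invariance under relabelling of vertices\<close>

text \<open>The sign of the permutation by which \<open>f\<close> reorders \<open>s\<close>.\<close>

definition reorder :: "('a::linorder \<Rightarrow> 'a) \<Rightarrow> 'a set \<Rightarrow> 'k::field" where
  "reorder f s = (-1) ^ card {(a, b). a \<in> s \<and> b \<in> s \<and> a < b \<and> f b < f a}"

lemma reorder_sq [simp]: "reorder f s * reorder f s = (1::'k::field)"
  by (simp add: reorder_def flip: power_add mult_2)

lemma reorder_sq_left [simp]: "reorder f s * (reorder f s * y) = (y::'k::field)"
  by (simp flip: mult.assoc)

lemma reorder_nz [simp]: "reorder f s \<noteq> (0::'k::field)"
  by (simp add: reorder_def)

text \<open>The vertices of \<open>t\<close> below \<open>v\<close> before or after applying
  \<open>f\<close> fall into three classes: \<open>A\<close> both before and after, \<open>B\<close>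
  only after, \<open>C\<close> only before. Inserting \<open>v\<close> creates the inversions
  counted by \<open>B\<close> and \<open>C\<close>, so the two exponents differ by twice the size of
  \<open>C\<close>.\<close>

lemma reorder_insert:
  assumes t: "finite t" "v \<notin> t" and f: "inj_on f (insert v t)"
  shows "osign v t * reorder f (insert v t) = (reorder f t * osign (f v) (f ` t) :: 'k::field)"
proof -
  define S where "S = (\<lambda>s. {(a, b). a \<in> s \<and> b \<in> s \<and> a < b \<and> f b < f a})"
  define A B C where "A = {u \<in> t. u < v \<and> f u < f v}" and "B = {u \<in> t. v < u \<and> f u < f v}"
    and "C = {u \<in> t. u < v \<and> f v < f u}"
  note defs = A_def B_def C_def
  have fin: "finite A" "finite B" "finite C" using t by (auto simp: defs)
  have finS: "finite (S t)" by (rule finite_subset[of _ "t \<times> t"]) (auto simp: S_def t)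
  have ne: "f u \<noteq> f v" "u \<noteq> v" if "u \<in> t" for u using f t that by (auto simp: inj_on_def)
  have "S (insert v t) = S t \<union> ((\<lambda>u. (u, v)) ` C \<union> Pair v ` B)"
    by (auto simp: S_def defs)
  moreover have "S t \<inter> ((\<lambda>u. (u, v)) ` C \<union> Pair v ` B) = {}"
    using t by (auto simp: S_def)
  moreover have "(\<lambda>u. (u, v)) ` C \<inter> Pair v ` B = {}"
    using t by (auto simp: defs)
  ultimately have 1: "card (S (insert v t)) = card (S t) + (card C + card B)"
    using fin finS by (simp add: card_Un_disjoint card_image inj_on_def)
  have "{u \<in> t. u < v} = A \<union> C" using ne by (auto simp: defs linorder_neq_iff)
  moreover have "A \<inter> C = {}" by (auto simp: defs)
  ultimately have 2: "card {u \<in> t. u < v} = card A + card C"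
    using fin by (simp add: card_Un_disjoint)
  have "{w \<in> f ` t. w < f v} = f ` (A \<union> B)" using ne by (auto simp: defs linorder_neq_iff)
  moreover have "A \<inter> B = {}" by (auto simp: defs)
  moreover have "inj_on f (A \<union> B)" using f by (rule inj_on_subset) (auto simp: defs)
  ultimately have 3: "card {w \<in> f ` t. w < f v} = card A + card B"
    using fin by (simp add: card_Un_disjoint card_image)
  have r: "reorder f s = (-1) ^ card (S s)" for s by (simp add: reorder_def S_def)
  have "osign v t * reorder f (insert v t) = (-1) ^ (card A + card C) * (-1) ^ (card (S t) + (card C + card B))"
    by (simp add: osign_def r 2 1)
  also have "\<dots> = ((-1) ^ (card (S t) + (card A + card B)) :: 'k)"
    by (simp add: power_add mult_ac)
  also have "\<dots> = reorder f t * osign (f v) (f ` t)"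
    by (simp add: osign_def r 3 power_add)
  finally show ?thesis .
qed

context
  fixes f :: "'a::linorder \<Rightarrow> 'a" and V :: "'a set" and K :: "'a set set" and F :: "'k::field itself"
  assumes f: "inj_on f V" and V: "finite V" and K: "K \<subseteq> Pow V"
begin

text \<open>Sorting the image of a face costs the sign \<open>reorder f t\<close>, which makes this
  a chain map from the relabelled complex back to \<open>K\<close>. Going backwards keeps the
  inverse of \<open>f\<close> out of the computation of \<open>D_pull\<close>.\<close>

definition pull :: "('a set \<Rightarrow> 'k) \<Rightarrow> 'a set \<Rightarrow> 'k" where
  "pull c t = (if t \<subseteq> V then reorder f t * c (f ` t) else 0)"

lemma D_pull: "D V (pull c) = pull (D (f ` V) c)"
proof
  fix t
  show "D V (pull c) t = pull (D (f ` V) c) t"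
  proof (cases "t \<subseteq> V")
    case False
    then show ?thesis by (subst D_outside) (auto simp: pull_def)
  next
    case True
    have t: "finite t" using True V finite_subset by blast
    have fV: "f ` V - f ` t = f ` (V - t)" using inj_on_image_set_diff[OF f _ True] by blast
    have "D V (pull c) t = (\<Sum>v\<in>V - t. (osign v t * reorder f (insert v t)) * c (f ` insert v t))"
      unfolding D_def using True by (intro sum.cong) (auto simp: pull_def)
    also have "\<dots> = (\<Sum>v\<in>V - t. reorder f t * (osign (f v) (f ` t) * c (insert (f v) (f ` t))))"
    proof (rule sum.cong[OF refl])
      fix v assume "v \<in> V - t"
      then have "inj_on f (insert v t)" using True by (intro inj_on_subset[OF f]) auto
      then show "(osign v t * reorder f (insert v t)) * c (f ` insert v t) =
          reorder f t * (osign (f v) (f ` t) * c (insert (f v) (f ` t)))"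
        using reorder_insert[OF t, of v f, where 'k='k] \<open>v \<in> V - t\<close> by (simp add: mult.assoc)
    qed
    also have "\<dots> = reorder f t * D (f ` V) c (f ` t)"
      unfolding D_def fV sum_distrib_left
      using inj_on_subset[OF f, of "V - t"] by (subst sum.reindex) auto
    finally show ?thesis using True by (simp add: pull_def)
  qed
qed

lemma image_eq_iff: "s \<subseteq> V \<Longrightarrow> f ` s \<in> (`) f ` K \<longleftrightarrow> s \<in> K"
  using inj_on_image_eq_iff[OF f] K by (auto simp: image_iff)

lemma pull_chains: "c \<in> chains F ((`) f ` K) k \<Longrightarrow> pull c \<in> chains F K k"
  unfolding chains_iff
proof (intro allI impI)
  fix s assume c: "\<forall>s. c s \<noteq> 0 \<longrightarrow> s \<in> (`) f ` K \<and> card s = k" and "pull c s \<noteq> 0"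
  then have s: "s \<subseteq> V" "c (f ` s) \<noteq> 0" by (auto simp: pull_def split: if_splits)
  then have "f ` s \<in> (`) f ` K" "card (f ` s) = k" using c by auto
  then show "s \<in> K \<and> card s = k"
    using image_eq_iff[OF s(1)] card_image[OF inj_on_subset[OF f s(1)]] by simp
qed

lemma pull_surj:
  assumes b: "b \<in> chains F K k"
  obtains c where "c \<in> chains F ((`) f ` K) k" "pull c = b"
proof
  define g where "g = the_inv_into V f"
  define c where "c = (\<lambda>s. if s \<subseteq> f ` V then reorder f (g ` s) * b (g ` s) else 0)"
  have gf: "g ` f ` t = t" if "t \<subseteq> V" for t
    using that f by (force simp: g_def image_image the_inv_into_f_f)
  have fg: "f ` g ` s = s" if "s \<subseteq> f ` V" for s
    using that f by (force simp: g_def image_image f_the_inv_into_f)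
  show "pull c = b"
    using b K by (fastforce simp: pull_def c_def gf image_mono chains_iff)
  show "c \<in> chains F ((`) f ` K) k"
    unfolding chains_iff
  proof (intro allI impI)
    fix s assume "c s \<noteq> 0"
    then have s: "s \<subseteq> f ` V" "b (g ` s) \<noteq> 0" by (auto simp: c_def split: if_splits)
    then have gs: "g ` s \<in> K" "card (g ` s) = k" using b by (auto simp: chains_iff)
    then have "card (f ` (g ` s)) = k" using K card_image[OF inj_on_subset[OF f, of "g ` s"]] by auto
    then show "s \<in> (`) f ` K \<and> card s = k" using gs fg[OF s(1)] by (metis imageI)
  qed
qed

lemma pull_diff: "pull (c - e) = pull c - pull e"
  by (auto simp: pull_def fun_eq_iff algebra_simps)

lemma pull_scale: "pull (cscale a c) = cscale a (pull c)"
  by (auto simp: pull_def fun_eq_iff cscale_def)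

lemma pull_zero: "pull 0 = 0"
  by (auto simp: pull_def fun_eq_iff)

lemma image_vertices: "finite (f ` V)" "(`) f ` K \<subseteq> Pow (f ` V)"
  using V K by auto

text \<open>No information is lost by \<open>pull\<close> on chains of the relabelled complex,
  because every subset of the image of \<open>V\<close> is the image of a subset of
  \<open>V\<close>. So fillings found in \<open>K\<close> can be carried over.\<close>

lemma cycle_image:
  assumes c: "c \<in> chains F ((`) f ` K) k" and "b \<in> chains F K (Suc k)" "pull c = D V b"
  obtains b' where "b' \<in> chains F ((`) f ` K) (Suc k)" "c = D (f ` V) b'"
proof -
  obtain b' where b': "b' \<in> chains F ((`) f ` K) (Suc k)" "pull b' = b"
    using pull_surj[OF assms(2)] by metis
  then have e: "pull c = pull (D (f ` V) b')" using assms(3) by (simp flip: D_pull)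
  have on: "\<forall>s. b' s \<noteq> 0 \<longrightarrow> s \<subseteq> f ` V" using chains_onD[OF b'(1) image_vertices(2)] .
  have "c s = D (f ` V) b' s" for s
  proof (cases "s \<subseteq> f ` V")
    case True
    then obtain t where t: "t \<subseteq> V" "s = f ` t" by (auto simp: subset_image_iff)
    have "pull c t = pull (D (f ` V) b') t" using e by simp
    then show ?thesis using t by (simp add: pull_def)
  next
    case False
    then have "c s = 0" using chains_onD[OF c image_vertices(2)] by blast
    then show ?thesis using D_outside[OF on False] by simp
  qed
  then show ?thesis using that b'(1) by blast
qed

lemma acyc_image:
  assumes "acyc F K"
  shows "acyc F ((`) f ` K)"
proof (rule acycI[OF image_vertices])
  fix k c assume c: "c \<in> chains F ((`) f ` K) k" "D (f ` V) c = 0"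
  then have "D V (pull c) = 0" by (simp add: D_pull pull_zero)
  then obtain b where "b \<in> chains F K (Suc k)" "pull c = D V b"
    using acycD[OF assms V K pull_chains[OF c(1)]] by metis
  then show "\<exists>b\<in>chains F ((`) f ` K) (Suc k). c = D (f ` V) b"
    by (metis cycle_image[OF c(1)])
qed

lemma sph_image:
  assumes "sph F n K"
  shows "sph F n ((`) f ` K)"
proof -
  let ?K = "(`) f ` K"
  obtain g where g: "g \<in> chains F K n" "D V g = 0"
    and gb: "\<And>b. b \<in> chains F K (Suc n) \<Longrightarrow> g \<noteq> D V b"
    and gen: "\<And>c. c \<in> chains F K n \<Longrightarrow> D V c = 0 \<Longrightarrow> \<exists>a. \<exists>b\<in>chains F K (Suc n). c - cscale a g = D V b"
    by (rule sph_gen[OF assms V K], rule that)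
  obtain g' where g': "g' \<in> chains F ?K n" "pull g' = g" using pull_surj[OF g(1)] .
  have cyc: "D V (pull c) = 0" if "D (f ` V) c = 0" for c using that by (simp add: D_pull pull_zero)
  have *: "\<exists>b\<in>chains F ?K (Suc k). c = D (f ` V) b"
    if "k \<noteq> n" and c: "c \<in> chains F ?K k" "D (f ` V) c = 0" for k c
  proof -
    obtain b where "b \<in> chains F K (Suc k)" "pull c = D V b"
      using sph_cycle[OF assms V K \<open>k \<noteq> n\<close> pull_chains[OF c(1)] cyc[OF c(2)]] .
    then show ?thesis by (metis cycle_image[OF c(1)])
  qed
  have Dg': "D (f ` V) g' = 0"
  proof
    fix s
    show "D (f ` V) g' s = 0 s"
    proof (cases "s \<subseteq> f ` V")
      case True
      then obtain t where t: "t \<subseteq> V" "s = f ` t" by (auto simp: subset_image_iff)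
      have "pull (D (f ` V) g') t = 0" using g g' by (simp flip: D_pull)
      then show ?thesis using t by (simp add: pull_def)
    next
      case False
      then show ?thesis using D_outside[OF chains_onD[OF g'(1) image_vertices(2)] False] by simp
    qed
  qed
  have nb: "g' \<noteq> D (f ` V) b" if "b \<in> chains F ?K (Suc n)" for b
    using gb[OF pull_chains[OF that]] g'(2) by (metis D_pull)
  have gen': "\<exists>a. \<exists>b\<in>chains F ?K (Suc n). c - cscale a g' = D (f ` V) b"
    if c: "c \<in> chains F ?K n" "D (f ` V) c = 0" for c
  proof -
    obtain a b where b: "b \<in> chains F K (Suc n)" "pull c - cscale a g = D V b"
      using gen[OF pull_chains[OF c(1)] cyc[OF c(2)]] by blast
    have "c - cscale a g' \<in> chains F ?K n" using c g' by (intro chains_diff chains_scale)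
    moreover have "pull (c - cscale a g') = D V b" using b g' by (simp add: pull_diff pull_scale)
    ultimately show ?thesis using cycle_image[OF _ b(1)] by metis
  qed
  show ?thesis
    unfolding sph_iff_D[OF image_vertices]
    by (rule conjI, intro allI impI ballI *, assumption+, rule bexI[OF _ g'(1)])
      (intro conjI ballI impI Dg' nb gen')
qed

end

section \<open>Links and connectedness\<close>

lemma lk_iff: "t \<in> lk K s \<longleftrightarrow> t \<inter> s = {} \<and> t \<union> s \<in> K"
proof
  assume "t \<in> lk K s"
  then show "t \<inter> s = {} \<and> t \<union> s \<in> K" by (auto simp: lk_def Un_absorb2)
next
  assume "t \<inter> s = {} \<and> t \<union> s \<in> K"
  moreover have "t = (t \<union> s) - s" using calculation by blast
  ultimately show "t \<in> lk K s" unfolding lk_def by blast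
qed

lemma lk_empty [simp]: "lk K {} = K"
  by (auto simp: lk_iff)

lemma lk_lk: "s \<inter> t = {} \<Longrightarrow> lk (lk K s) t = lk K (s \<union> t)"
  by (auto simp: lk_iff Un_assoc Un_commute Un_left_commute)

lemma lk_lk_diff: "s \<subseteq> t \<Longrightarrow> lk (lk K s) (t - s) = lk K t"
  by (subst lk_lk) (auto simp: Un_absorb1)

lemma lk_subset: "scomplex K \<Longrightarrow> lk K s \<subseteq> K"
  by (auto simp: lk_iff intro: scomplex_subset)

lemma scomplex_empty [simp]: "{} \<in> K" if "scomplex K"
  using that by (simp add: scomplex_def)

lemma scomplex_face_finite: "scomplex K \<Longrightarrow> s \<in> K \<Longrightarrow> finite s"
  by (simp add: scomplex_def)

lemma scomplex_lk:
  assumes K: "scomplex K" and s: "s \<in> K"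
  shows "scomplex (lk K s)"
  unfolding scomplex_def
proof (intro conjI ballI allI impI)
  have "finite K" using K by (simp add: scomplex_def)
  then show "finite (lk K s)" using lk_subset[OF K] finite_subset by blast
  show "{} \<in> lk K s" using s by (simp add: lk_iff)
  fix t assume t: "t \<in> lk K s"
  then show "finite t" using scomplex_face_finite[OF K] by (auto simp: lk_iff)
  fix u assume "u \<subseteq> t"
  then show "u \<in> lk K s" using t K by (auto simp: lk_iff intro: scomplex_subset[OF K, of "t \<union> s"])
qed

lemma not_acyc_empty: "\<not> acyc F {{}}"
  using not_acyc_sph[OF sph_0_empty] .

text \<open>Here \<open>m\<close> is the size of a top face, one more than the dimension. Then
  \<open>m - card t\<close> is the size of the top faces of the link of \<open>t\<close>, which is
  the indexing of \<open>sph\<close>.\<close>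

definition lk_ok :: "'k::field itself \<Rightarrow> nat \<Rightarrow> 'a::linorder set set \<Rightarrow> 'a set \<Rightarrow> bool" where
  "lk_ok F m K t \<longleftrightarrow> acyc F (lk K t) \<or> sph F (m - card t) (lk K t)"

text \<open>Purity: a maximal face has link \<open>{{}}\<close>, which is not acyclic and is a
  sphere only for index 0, so the condition on links determines its size.\<close>

lemma facet_extend:
  assumes K: "scomplex K" and m: "\<And>t. t \<in> K \<Longrightarrow> card t \<le> m"
    and ok: "\<And>t. t \<in> K \<Longrightarrow> s \<subseteq> t \<Longrightarrow> lk_ok F m K t" and s: "s \<in> K"
  obtains f where "f \<in> K" "s \<subseteq> f" "card f = m"
proof -
  have "finite K" using K by (simp add: scomplex_def)
  then obtain f where f: "f \<in> K" "s \<subseteq> f" and max: "\<And>t. t \<in> K \<Longrightarrow> f \<subseteq> t \<Longrightarrow> t = f"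
    using finite_has_maximal2[OF _ s] by metis
  have "lk K f = {{}}"
  proof -
    have "t = {}" if "t \<in> lk K f" for t
      using max[of "t \<union> f"] that by (auto simp: lk_iff)
    moreover have "{} \<in> lk K f" using f by (simp add: lk_iff)
    ultimately show ?thesis by blast
  qed
  then have "sph F (m - card f) {{} :: 'a set}"
    using ok[OF f] not_acyc_empty unfolding lk_ok_def by metis
  then have "m - card f = 0" by (rule sph_unique[OF _ sph_0_empty])
  then show ?thesis using that[OF f] m[OF f(1)] by simp
qed

section \<open>Degree zero homology and connectedness by edges\<close>

lemma D_point: "finite V \<Longrightarrow> u \<in> V \<Longrightarrow> D V (point u) t = (if t = {} then 1 else 0 :: 'k::field)"
proof (cases "t = {}")
  assume V: "finite V" "u \<in> V" and "t = {}"
  then have "D V (point u) t = (\<Sum>v\<in>V. if v = u then 1 else 0 :: 'k)"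
    unfolding D_def by (intro sum.cong) (auto simp: point_def)
  then show ?thesis using V \<open>t = {}\<close> by simp
next
  assume "t \<noteq> {}"
  then have "point u (insert v t) = (0::'k)" if "v \<in> V - t" for v
    using that by (auto simp: point_def)
  then show ?thesis using \<open>t \<noteq> {}\<close> by (simp add: D_def)
qed

lemma point_chains: "{u} \<in> K \<Longrightarrow> point u \<in> chains F K 1"
  by (auto simp: chains_iff point_def)

lemma D_point_diff: "finite V \<Longrightarrow> u \<in> V \<Longrightarrow> w \<in> V \<Longrightarrow> D V (point u - point w) = (0 :: _ \<Rightarrow> 'k::field)"
  by (rule ext) (simp add: D_diff D_point)

lemma D_empty_eq: "D V c {} = (\<Sum>v\<in>V. c {v})"
  by (simp add: D_def)

lemma D_restr_closed:
  assumes K: "K \<subseteq> Pow V" and b: "b \<in> chains F K 2"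
    and C: "\<And>u w. {u, w} \<in> K \<Longrightarrow> u \<in> C \<Longrightarrow> w \<in> C"
  shows "D V (restr (\<lambda>s. s \<subseteq> C) b) {v} = (if v \<in> C then D V b {v} else 0)"
proof (cases "v \<in> C")
  case True
  have "restr (\<lambda>s. s \<subseteq> C) b (insert w {v}) = b (insert w {v})" for w
    using b C[of v w] True by (auto simp: restr_def chains_iff insert_commute)
  then show ?thesis using True by (simp add: D_def)
qed (simp add: D_def restr_def)

text \<open>Restricting a chain of edges to those inside \<open>C\<close> restricts its boundary to
  \<open>C\<close>. Applying \<open>D\<close> once more and evaluating at the empty face gives the
  sum of the coefficients, which must vanish.\<close>

lemma sum_component:
  fixes b :: "'a::linorder set \<Rightarrow> 'k::field"
  assumes V: "finite V" and K: "K \<subseteq> Pow V" and b: "b \<in> chains F K 2"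
    and C: "\<And>u w. {u, w} \<in> K \<Longrightarrow> u \<in> C \<Longrightarrow> w \<in> C"
  shows "(\<Sum>v\<in>V \<inter> C. D V b {v}) = 0"
proof -
  let ?b = "restr (\<lambda>s. s \<subseteq> C) b"
  have "\<forall>s. ?b s \<noteq> 0 \<longrightarrow> s \<subseteq> V" using chains_onD[OF b K] by (auto simp: restr_def)
  then have "0 = D V (D V ?b) {}" by (simp add: D_D[OF V])
  also have "\<dots> = (\<Sum>v\<in>V. if v \<in> C then D V b {v} else 0)"
    using D_restr_closed[OF K b C] by (simp add: D_empty_eq[of V "D V ?b"])
  also have "\<dots> = (\<Sum>v\<in>V \<inter> C. D V b {v})"
    using V by (simp add: sum.inter_restrict)
  finally show ?thesis by simp
qed

lemma sum_point: "finite V \<Longrightarrow> (\<Sum>v\<in>V. point u {v}) = (if u \<in> V then 1 else 0 :: 'k::field)"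
  by (simp add: point_def)

text \<open>Vanishing degree zero homology as a propagation principle: a property of vertices that
  is passed along edges holds everywhere if it holds once. Otherwise the coefficients of
  \<open>point u - point w\<close> over \<open>C\<close> would add up to 1, although this chain is a
  boundary.\<close>

lemma connected_closed_set:
  fixes F :: "'k::field itself"
  assumes V: "finite V" and K: "K \<subseteq> Pow V"
    and conn: "\<And>c. c \<in> chains F K 1 \<Longrightarrow> D V c = 0 \<Longrightarrow> \<exists>b\<in>chains F K 2. c = D V b"
    and C: "\<And>u w. {u, w} \<in> K \<Longrightarrow> u \<in> C \<Longrightarrow> w \<in> C"
    and uw: "{u} \<in> K" "{w} \<in> K" "u \<in> C"
  shows "w \<in> C"
proof (rule ccontr)
  assume w: "w \<notin> C"
  have V': "u \<in> V" "w \<in> V" using uw K by auto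
  obtain b :: "'a set \<Rightarrow> 'k" where b: "b \<in> chains F K 2" "point u - point w = D V b"
    using conn[OF chains_diff[OF point_chains[OF uw(1)] point_chains[OF uw(2)]] D_point_diff[OF V V']] by blast
  have "(\<Sum>v\<in>V \<inter> C. (point u - point w :: _ \<Rightarrow> 'k) {v}) = 0"
    unfolding b(2) using sum_component[OF V K b(1) C] .
  moreover have "(\<Sum>v\<in>V \<inter> C. (point u - point w :: _ \<Rightarrow> 'k) {v}) = 1"
    using V V' uw w by (simp add: sum_subtractf sum_point)
  ultimately show False by simp
qed

lemma lnk_chains:
  assumes "c \<in> chains F K (Suc m)"
  shows "lnk v c \<in> chains F (lk K {v}) m"
  unfolding chains_iff
proof (intro allI impI)
  fix t assume "lnk v c t \<noteq> 0"
  then have t: "v \<notin> t" "c (insert v t) \<noteq> 0" by (auto simp: lnk_def split: if_splits)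
  then have *: "insert v t \<in> K" "card (insert v t) = Suc m" using assms by (auto simp: chains_iff)
  then have "finite (insert v t)" by (metis card.infinite nat.distinct(1))
  then show "t \<in> lk K {v} \<and> card t = m" using t * by (simp add: lk_iff)
qed

lemma lnk_nonzero_iff: "v \<in> s \<Longrightarrow> lnk v c (s - {v}) \<noteq> 0 \<longleftrightarrow> c s \<noteq> 0"
  by (simp add: lnk_def insert_absorb)

text \<open>A relative top cycle of a homology sphere or ball does not vanish on any facet: by induction
  this holds around each vertex, and connectedness propagates it from vertex to vertex.\<close>

lemma full_support:
  fixes F :: "'k::field itself" and K :: "'a::linorder set set"
  assumes V: "finite V"
  shows "scomplex K \<Longrightarrow> K \<subseteq> Pow V \<Longrightarrow> (\<And>t. t \<in> K \<Longrightarrow> card t \<le> m) \<Longrightarrow> (\<And>t. t \<in> K \<Longrightarrow> lk_ok F m K t)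
    \<Longrightarrow> c \<in> chains F K m \<Longrightarrow> (\<And>t. D V c t \<noteq> 0 \<Longrightarrow> acyc F (lk K t)) \<Longrightarrow> c \<noteq> 0
    \<Longrightarrow> f \<in> K \<Longrightarrow> card f = m \<Longrightarrow> c f \<noteq> 0"
proof (induction m arbitrary: K c f)
  case 0
  obtain s where "c s \<noteq> 0" using 0(7) by (auto simp: fun_eq_iff)
  moreover from this have "s \<in> K" "card s = 0" using 0(5) by (auto simp: chains_iff)
  moreover have "t = {}" if "t \<in> K" "card t = 0" for t
    using scomplex_face_finite[OF 0(1)] that by auto
  ultimately show ?case using 0(8,9) by metis
next
  case (Suc m)
  note K = Suc.prems(1,2) and cards = Suc.prems(3) and ok = Suc.prems(4) and c = Suc.prems(5)
    and bd = Suc.prems(6)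
  note con = chains_onD[OF c K(2)]
  \<comment> \<open>The link of \<open>v\<close> inherits the hypotheses with \<open>m\<close> in
    place of \<open>Suc m\<close>, and \<open>lnk v c\<close> is a relative cycle in it. So if
    \<open>c\<close> is nonzero on one top face through \<open>v\<close>, it is nonzero on all of
    them.\<close>
  have star: "c g \<noteq> 0" if g: "g \<in> K" "v \<in> g" "card g = Suc m" and v: "lnk v c \<noteq> 0" for v g
  proof -
    have vK: "{v} \<in> K" "v \<in> V" using scomplex_subset[OF K(1) g(1), of "{v}"] g K(2) by auto
    have ins: "v \<notin> t" "insert v t \<in> K" "card (insert v t) = Suc (card t)" if "t \<in> lk K {v}" for t
      using that scomplex_face_finite[OF K(1), of "insert v t"] by (auto simp: lk_iff)
    have lkv: "lk (lk K {v}) t = lk K (insert v t)" if "v \<notin> t" for t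
      using lk_lk[of "{v}" t] that by simp
    have "lnk v c (g - {v}) \<noteq> 0"
    proof (rule Suc.IH[of "lk K {v}" "lnk v c"])
      show "scomplex (lk K {v})" by (rule scomplex_lk[OF K(1) vK(1)])
      show "lk K {v} \<subseteq> Pow V" using lk_subset[OF K(1)] K(2) by blast
      show "card t \<le> m" if "t \<in> lk K {v}" for t using ins[OF that] cards by force
      show "lk_ok F m (lk K {v}) t" if "t \<in> lk K {v}" for t
        using ins[OF that] lkv[of t] ok[of "insert v t"] by (simp add: lk_ok_def)
      show "lnk v c \<in> chains F (lk K {v}) m" by (rule lnk_chains[OF c])
      show "acyc F (lk (lk K {v}) t)" if "D V (lnk v c) t \<noteq> 0" for t
      proof -
        have "lnk v (D V c) t \<noteq> 0" using that D_lnk[OF V vK(2) con] by simp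
        then have "v \<notin> t" "D V c (insert v t) \<noteq> 0" by (auto simp: lnk_def split: if_splits)
        then show ?thesis using bd lkv by simp
      qed
      show "lnk v c \<noteq> 0" by (rule v)
      show "g - {v} \<in> lk K {v}" using g by (simp add: lk_iff insert_absorb)
      show "card (g - {v}) = m" using g by simp
    qed
    then show ?thesis using lnk_nonzero_iff[OF g(2)] by metis
  qed
  show ?case
  proof (rule ccontr)
    assume "\<not> c f \<noteq> 0"
    then have cf: "c f = 0" by simp
    obtain s where s: "c s \<noteq> 0" using Suc.prems(7) by (auto simp: fun_eq_iff)
    then have sK: "s \<in> K" "card s = Suc m" using c by (auto simp: chains_iff)
    obtain u where u: "u \<in> s" using sK by fastforce
    obtain w where w: "w \<in> f" using Suc.prems(9) by fastforce
    have nz: "lnk a c \<noteq> 0" if "c g \<noteq> 0" "a \<in> g" for a g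
    proof -
      have "lnk a c (g - {a}) \<noteq> 0" using lnk_nonzero_iff[OF that(2)] that(1) by metis
      then show ?thesis by auto
    qed
    have wC: "lnk w c = 0" using star[OF Suc.prems(8) w Suc.prems(9)] cf by blast
    have uw: "{u} \<in> K" "{w} \<in> K" using scomplex_subset[OF K(1)] sK(1) Suc.prems(8) u w by auto
    then have uwV: "u \<in> V" "w \<in> V" using K by auto
    have uw_ne: "u \<noteq> w" using wC nz[OF s u] by auto
    have K_ok: "acyc F K \<or> sph F (Suc m) K" using ok[of "{}"] K by (simp add: lk_ok_def)
    \<comment> \<open>For \<open>m = 0\<close> there are no edges to travel along, and a sphere is a
      pair of points; its cycles are compared with \<open>point u - point w\<close> directly. For
      larger \<open>m\<close>, purity shows that the vertices with nonzero \<open>lnk v c\<close>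
      form a set closed under edges.\<close>
    show False
    proof (cases "m = 0")
      case True
      define q :: "'a set \<Rightarrow> 'k" where "q = point u - point w"
      have q: "q \<in> chains F K 1" "D V q = 0"
        unfolding q_def using chains_diff[OF point_chains[OF uw(1)] point_chains[OF uw(2)]] D_point_diff[OF V uwV] by auto
      have qu: "q {u} = 1" "q {w} = -1" using uw_ne by (auto simp: q_def point_def)
      have top: "b = 0" if "b \<in> chains F K (Suc 1)" for b
        using that cards True by (intro chains_top[OF _ that]) (use le_imp_less_Suc in fastforce)
      have single: "s = {u}" "f = {w}"
        using u w sK(2) Suc.prems(9) True by (auto simp: card_Suc_eq)
      show False
      proof (cases "acyc F K")
        case True
        obtain b where "b \<in> chains F K (Suc 1)" "q = D V b"
          using acycD[OF True V K(2) q] by blast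
        then show False using top[of b] qu by simp
      next
        case False
        then have sph: "sph F 1 K" using K_ok \<open>m = 0\<close> by simp
        have "D V c \<in> chains F K 0" using D_chains[of c F K 0] c scomplex_subset[OF K(1)] \<open>m = 0\<close> by auto
        then have DK: "t \<in> K \<and> card t = 0" if "D V c t \<noteq> 0" for t using that by (simp add: chains_iff)
        have "D V c t = 0" for t
        proof (rule ccontr)
          assume *: "D V c t \<noteq> 0"
          then have "t = {}" using DK[OF *] scomplex_face_finite[OF K(1), of t] by simp
          then show False using bd[OF *] False by simp
        qed
        then have Dc: "D V c = 0" by (simp add: fun_eq_iff)
        obtain g where g: "\<And>e. e \<in> chains F K 1 \<Longrightarrow> D V e = 0 \<Longrightarrow> \<exists>a. \<exists>b\<in>chains F K (Suc 1). e - cscale a g = D V b"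
          by (rule sph_gen[OF sph V K(2)], rule that)
        have c1: "c \<in> chains F K 1" using c \<open>m = 0\<close> by simp
        have ex: "\<exists>a. \<forall>t. e t = a * g t" if e: "e \<in> chains F K 1" "D V e = 0" for e
        proof -
          obtain a b where b: "b \<in> chains F K (Suc 1)" "e - cscale a g = D V b" using g[OF e] by blast
          have "b = 0" using b(1) by (rule top)
          then have "e - cscale a g = 0" using b(2) by simp
          then show ?thesis by (auto simp: cscale_def fun_eq_iff)
        qed
        obtain a where a: "\<And>t. c t = a * g t" using ex[OF c1 Dc] by blast
        obtain a' where a': "\<And>t. q t = a' * g t" using ex[OF q] by blast
        have "g {w} \<noteq> 0" using a'[of "{w}"] qu by auto
        then have "a = 0" using a[of "{w}"] cf single by simp
        then show False using a[of s] s by simp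
      qed
    next
      case False
      have "lnk w c \<noteq> 0"
      proof -
        have "w \<in> {v. lnk v c \<noteq> 0}"
        proof (rule connected_closed_set[OF V K(2), where F=F])
          show "\<exists>b\<in>chains F K 2. e = D V b" if e: "e \<in> chains F K 1" "D V e = 0" for e
          proof (cases "acyc F K")
            case True
            show ?thesis using acycD[OF True V K(2) e] by (metis Suc_1)
          next
            case False
            then have "sph F (Suc m) K" using K_ok by blast
            then show ?thesis using sph_cycle[OF _ V K(2) _ e] \<open>m \<noteq> 0\<close> by (metis Suc_1 One_nat_def nat.inject)
          qed
          show "b \<in> {v. lnk v c \<noteq> 0}" if ab: "{a, b} \<in> K" "a \<in> {v. lnk v c \<noteq> 0}" for a b
          proof -
            obtain g where g: "g \<in> K" "{a, b} \<subseteq> g" "card g = Suc m"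
              using facet_extend[OF K(1) cards ok ab(1)] by blast
            then have "c g \<noteq> 0" using star[of g a] ab by simp
            then show ?thesis using nz[of g b] g by simp
          qed
          show "{u} \<in> K" "{w} \<in> K" "u \<in> {v. lnk v c \<noteq> 0}" using uw nz[OF s u] by auto
        qed
        then show ?thesis by simp
      qed
      then show False using wC by simp
    qed
  qed
qed

section \<open>Homology manifolds in terms of links\<close>

text \<open>The boundary without reference to the dimension. Where every link of a nonempty face is
  acyclic or a sphere of the expected dimension, the single Betti number tested by
  \<open>bdc\<close> vanishes exactly if the whole link is acyclic.\<close>

definition Bd :: "'k::field itself \<Rightarrow> 'a::linorder set set \<Rightarrow> 'a set set" where
  "Bd F K = insert {} {s \<in> K. s \<noteq> {} \<and> acyc F (lk K s)}"

text \<open>\<open>hmanifold\<close>, with the nested conditions on vertex links and their boundaries expressed by links in \<open>K\<close>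
  and in \<open>Bd F K\<close>.\<close>

definition link_manifold :: "'k::field itself \<Rightarrow> nat \<Rightarrow> 'a::linorder set set \<Rightarrow> bool" where
  "link_manifold F d K \<longleftrightarrow> scomplex K \<and> (\<forall>s\<in>K. card s \<le> Suc d) \<and> (\<forall>s\<in>K. s \<noteq> {} \<longrightarrow> lk_ok F (Suc d) K s) \<and>
     (\<forall>s\<in>Bd F K. \<forall>t\<subseteq>s. t \<in> Bd F K) \<and> (\<forall>s\<in>Bd F K. s \<noteq> {} \<longrightarrow> sph F (d - card s) (lk (Bd F K) s))"

lemma Bd_subset: "{} \<in> K \<Longrightarrow> Bd F K \<subseteq> K"
  by (auto simp: Bd_def)

lemma lk_max_face:
  assumes K: "scomplex K" and s: "s \<in> K" and max: "\<And>t. t \<in> K \<Longrightarrow> card t \<le> card s"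
  shows "lk K s = {{}}"
proof -
  have "t = {}" if "t \<in> lk K s" for t
  proof -
    have t: "t \<inter> s = {}" "t \<union> s \<in> K" using that by (auto simp: lk_iff)
    then have fin: "finite t" "finite s" using scomplex_face_finite[OF K t(2)] by simp_all
    have "card t = 0" using max[OF t(2)] fin t(1) by (simp add: card_Un_disjoint)
    then show ?thesis using fin by simp
  qed
  moreover have "{} \<in> lk K s" using s by (simp add: lk_iff)
  ultimately show ?thesis by blast
qed

lemma Bd_card:
  assumes K: "scomplex K" and s: "s \<in> Bd F K" "s \<noteq> {}" and c: "\<And>t. t \<in> K \<Longrightarrow> card t \<le> Suc d"
  shows "card s \<le> d"
proof (rule ccontr)
  assume d: "\<not> card s \<le> d"
  have sK: "s \<in> K" "acyc F (lk K s)" using s by (auto simp: Bd_def)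
  have "lk K s = {{}}"
    by (intro lk_max_face[OF K sK(1)] order_trans[OF c]) (use d in auto)
  then show False using sK not_acyc_empty by metis
qed

lemma cdim_le_iff: "scomplex K \<Longrightarrow> cdim K \<le> n \<longleftrightarrow> (\<forall>s\<in>K. int (card s) - 1 \<le> n)"
  unfolding cdim_def fdim_def by (subst Max_le_iff) (auto simp: scomplex_def)

lemma cdim_eqI:
  assumes "scomplex K" "\<And>s. s \<in> K \<Longrightarrow> int (card s) - 1 \<le> n" "s \<in> K" "int (card s) - 1 = n"
  shows "cdim K = n"
proof (rule antisym)
  show "cdim K \<le> n" using assms by (simp add: cdim_le_iff)
  have "fdim s \<le> cdim K" unfolding cdim_def using assms(1,3) by (intro Max_ge) (auto simp: scomplex_def)
  then show "n \<le> cdim K" using assms(4) by (simp add: fdim_def)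
qed

lemma cdim_card: "scomplex K \<Longrightarrow> cdim K = n \<Longrightarrow> s \<in> K \<Longrightarrow> int (card s) - 1 \<le> n"
  using cdim_le_iff[of K n] by auto

lemma scomplex_lk_vertex: "scomplex K \<Longrightarrow> s \<in> K \<Longrightarrow> v \<in> s \<Longrightarrow> scomplex (lk K {v})"
  by (rule scomplex_lk) (auto intro: scomplex_subset)

lemma rbetti_eq_0_iff:
  assumes K: "scomplex K" and ok: "lk_ok F (Suc d) K s" and s: "s \<in> K" "s \<noteq> {}" "card s \<le> d"
  shows "rbetti F (lk K s) (int d - fdim s - 1) = 0 \<longleftrightarrow> acyc F (lk K s)"
proof -
  have L: "scomplex (lk K s)" by (rule scomplex_lk[OF K s(1)])
  have n: "nat (int d - fdim s - 1 + 1) = Suc d - card s" "\<not> int d - fdim s - 1 < -1"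
    using s(3) by (auto simp: fdim_def)
  have "rbetti F (lk K s) (int d - fdim s - 1) = rbetti_card F (lk K s) (Suc d - card s)"
    unfolding rbetti_def n using n by simp
  moreover have "rbetti_card F (lk K s) (Suc d - card s) = 0 \<longleftrightarrow> acyc F (lk K s)"
    using ok unfolding lk_ok_def rbetti_card_eq_0_iff[OF L] by (auto simp: acyc_def sph_def)
  ultimately show ?thesis by simp
qed

lemma bdc_eq_Bd:
  assumes K: "scomplex K" and c: "\<And>s. s \<in> K \<Longrightarrow> card s \<le> Suc d"
    and ok: "\<And>s. s \<in> K \<Longrightarrow> s \<noteq> {} \<Longrightarrow> lk_ok F (Suc d) K s"
  shows "bdc F (int d) K = Bd F K"
proof (rule set_eqI)
  fix s
  show "s \<in> bdc F (int d) K \<longleftrightarrow> s \<in> Bd F K"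
  proof (cases "s \<in> K \<and> s \<noteq> {}")
    case True
    have card: "0 < card s" using True scomplex_face_finite[OF K] by (simp add: card_gt_0_iff)
    show ?thesis
    proof (cases "card s \<le> d")
      case le: True
      then show ?thesis
        using True card rbetti_eq_0_iff[OF K ok _ _ le] by (auto simp: bdc_def Bd_def fdim_def)
    next
      case False
      then have "s \<notin> bdc F (int d) K" using True by (auto simp: bdc_def fdim_def)
      moreover have "s \<notin> Bd F K" using Bd_card[OF K _ _ c] False True by blast
      ultimately show ?thesis by simp
    qed
  next
    case False
    then show ?thesis by (auto simp: bdc_def Bd_def fdim_def)
  qed
qed

text \<open>Acyclicity at \<open>v\<close> is needed for the empty face: it always belongs to the
  right-hand side, and on the left it stands for \<open>{v}\<close> being a boundary face.\<close>

lemma lk_Bd_vertex: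
  assumes K: "scomplex K" and a: "acyc F (lk K {v})" "{v} \<in> K"
  shows "lk (Bd F K) {v} = Bd F (lk K {v})"
proof (rule set_eqI)
  fix s
  have "lk (lk K {v}) s = lk K (insert v s)" if "v \<notin> s" using lk_lk[of "{v}" s] that by simp
  then show "s \<in> lk (Bd F K) {v} \<longleftrightarrow> s \<in> Bd F (lk K {v})"
    using a by (auto simp: Bd_def lk_iff)
qed

lemma bdc_lk_vertex:
  assumes K: "scomplex K" and a: "acyc F (lk K {v})" "{v} \<in> K" and d: "1 \<le> d"
    and c: "\<And>s. s \<in> lk K {v} \<Longrightarrow> card s \<le> d"
    and ok: "\<And>s. s \<in> K \<Longrightarrow> v \<in> s \<Longrightarrow> lk_ok F (Suc d) K s"
  shows "bdc F (int d - 1) (lk K {v}) = lk (Bd F K) {v}"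
proof -
  have "bdc F (int (d - 1)) (lk K {v}) = Bd F (lk K {v})"
  proof (rule bdc_eq_Bd)
    show "scomplex (lk K {v})" by (rule scomplex_lk[OF K a(2)])
    show "card s \<le> Suc (d - 1)" if "s \<in> lk K {v}" for s using c[OF that] d by simp
    show "lk_ok F (Suc (d - 1)) (lk K {v}) s" if "s \<in> lk K {v}" for s
    proof -
      have s: "v \<notin> s" "insert v s \<in> K" using that by (auto simp: lk_iff)
      then have "finite s" using scomplex_face_finite[OF K] by fastforce
      then show ?thesis using ok[OF s(2)] s d lk_lk[of "{v}" s K] by (simp add: lk_ok_def)
    qed
  qed
  then show ?thesis using lk_Bd_vertex[OF K a] d by (simp add: of_nat_diff)
qed

text \<open>The nested conditions unwind because the link of \<open>s\<close> is a link inside the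
  link of any vertex of \<open>s\<close>, both in \<open>K\<close> and in the boundary. Closure of
  \<open>Bd F K\<close> under subfaces comes from the requirement that the boundary of a vertex link
  be a complex.\<close>

lemma hmanifold_imp_link_manifold:
  assumes man: "hmanifold F (int d) K"
  shows "link_manifold F d K"
proof -
  have K: "scomplex K" using man by (simp add: hmanifold_def)
  have vK: "{v} \<in> K \<and> v \<in> vert K" if "s \<in> K" "v \<in> s" for v s
    using that scomplex_subset[OF K that(1), of "{v}"] by (auto simp: vert_def)
  have v: "hsphere F (int d - 1) (lk K {v}) \<or> hball F (int d - 1) (lk K {v})" if "s \<in> K" "v \<in> s" for v s
    using man vK[OF that] by (auto simp: hmanifold_def)
  have cd: "cdim (lk K {v}) = int d - 1" if "s \<in> K" "v \<in> s" for v s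
    using v[OF that] by (auto simp: hsphere_def hball_def)
  have lkv: "s - {v} \<in> lk K {v}" "card (s - {v}) = card s - 1" "1 \<le> card s" "lk (lk K {v}) (s - {v}) = lk K s"
    if "s \<in> K" "v \<in> s" for s v
    using that scomplex_face_finite[OF K that(1)] lk_lk_diff[of "{v}" s K]
    by (auto simp: lk_iff insert_absorb card_gt_0_iff Suc_le_eq)
  have card: "card s \<le> Suc d" if s: "s \<in> K" for s
  proof (cases "s = {}")
    case False
    then obtain v where v: "v \<in> s" by blast
    show ?thesis
      using cdim_card[OF scomplex_lk_vertex[OF K s v] cd[OF s v] lkv(1)[OF s v]] lkv[OF s v] by simp
  qed simp
  have sph_case: "sph F (Suc d - card s) (lk K s)"
    if s: "s \<in> K" "v \<in> s" and h: "hsphere F (int d - 1) (lk K {v})" for s v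
  proof -
    have "sphere_homology F (int d - 1 - fdim (s - {v}) - 1) (lk (lk K {v}) (s - {v}))"
      using h lkv(1)[OF s] by (simp add: hsphere_def)
    then have "sphere_homology F (int d - int (card s)) (lk K s)"
      using lkv[OF s] by (simp add: fdim_def of_nat_diff algebra_simps)
    then have "sph F (nat (int d - int (card s) + 1)) (lk K s)"
      using sphere_homology_iff[OF scomplex_lk[OF K s(1)]] by blast
    moreover have "nat (int d - int (card s) + 1) = Suc d - card s" using card[OF s(1)] by linarith
    ultimately show ?thesis by simp
  qed
  have ball_case: "lk_ok F (Suc d) K s" and ball_acyc: "s = {v} \<Longrightarrow> acyc F (lk K s)"
    if s: "s \<in> K" "v \<in> s" and h: "hball F (int d - 1) (lk K {v})" for s v
  proof -
    show "acyc F (lk K s)" if "s = {v}"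
      using h that acyclic_red_iff[OF scomplex_lk[OF K s(1)], of F] by (simp add: hball_def)
    show "lk_ok F (Suc d) K s"
    proof (cases "card s = Suc d")
      \<comment> \<open>A ball constrains links only for faces of codimension at least one, so the
        link of a top face is computed directly.\<close>
      case True
      then have "lk K s = {{}}" using card by (intro lk_max_face[OF K s(1)]) simp
      then show ?thesis using True sph_0_empty by (metis lk_ok_def diff_self_eq_0)
    next
      case False
      then have "fdim (s - {v}) \<le> int d - 1 - 1" using card[OF s(1)] lkv[OF s] by (simp add: fdim_def of_nat_diff)
      then have "acyclic_red F (lk K s) \<or> sphere_homology F (int d - 1 - fdim (s - {v}) - 1) (lk K s)"
        using h lkv[OF s] unfolding hball_def by metis
      moreover have "int d - 1 - fdim (s - {v}) - 1 = int d - int (card s)"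
        using lkv[OF s] by (simp add: fdim_def of_nat_diff)
      moreover have "nat (int d - int (card s) + 1) = Suc d - card s" using card[OF s(1)] by linarith
      ultimately show ?thesis
        using sphere_homology_iff[OF scomplex_lk[OF K s(1)], of F] acyclic_red_iff[OF scomplex_lk[OF K s(1)], of F]
        by (auto simp: lk_ok_def)
    qed
  qed
  have ok: "lk_ok F (Suc d) K s" if s: "s \<in> K" "v \<in> s" for s v
    using v[OF s] sph_case[OF s] ball_case[OF s] by (auto simp: lk_ok_def)
  have bd: "acyc F (lk K {v}) \<and> hsphere F (int d - 2) (lk (Bd F K) {v}) \<and> 1 \<le> d"
    if s: "s \<in> Bd F K" "v \<in> s" for s v
  proof -
    have sK: "s \<in> K" "s \<noteq> {}" "acyc F (lk K s)" using s by (auto simp: Bd_def)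
    \<comment> \<open>If the link of \<open>v\<close> were a sphere, the link of \<open>s\<close>
      would be one too, and it is acyclic.\<close>
    have h: "hball F (int d - 1) (lk K {v})"
      using v[OF sK(1) s(2)] sph_case[OF sK(1) s(2)] not_acyc_sph sK(3) by blast
    have a: "acyc F (lk K {v})" "{v} \<in> K" using ball_acyc[of "{v}" v] h vK[OF sK(1) s(2)] by auto
    have "1 \<le> card s" using lkv[OF sK(1) s(2)] by simp
    then have d: "1 \<le> d" using Bd_card[OF K s(1) sK(2) card] by simp
    have "bdc F (int d - 1) (lk K {v}) = lk (Bd F K) {v}"
    proof (rule bdc_lk_vertex[OF K a d])
      show "card t \<le> d" if "t \<in> lk K {v}" for t
        using cdim_card[OF scomplex_lk[OF K a(2)] cd[OF a(2)] that] by simp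
    qed (use ok in blast)
    then show ?thesis using h a d by (simp add: hball_def)
  qed
  have down: "t \<in> Bd F K" if s: "s \<in> Bd F K" "t \<subseteq> s" for s t
  proof (cases "t = {}")
    case False
    then obtain v where v: "v \<in> t" by blast
    have "s - {v} \<in> lk (Bd F K) {v}" using s v by (simp add: lk_iff insert_absorb subset_iff)
    moreover have "scomplex (lk (Bd F K) {v})" using bd[OF s(1), of v] v s(2) by (auto simp: hsphere_def)
    ultimately have "t - {v} \<in> lk (Bd F K) {v}" using scomplex_subset s(2) by (metis Diff_mono order_refl)
    then show ?thesis using v by (simp add: lk_iff insert_absorb)
  qed (simp add: Bd_def)
  have sphBd: "sph F (d - card s) (lk (Bd F K) s)" if s: "s \<in> Bd F K" "s \<noteq> {}" for s
  proof -
    obtain v where v: "v \<in> s" using s by blast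
    have sK: "s \<in> K" using s by (auto simp: Bd_def)
    have h: "hsphere F (int d - 2) (lk (Bd F K) {v})" using bd[OF s(1) v] by simp
    have sv: "s - {v} \<in> lk (Bd F K) {v}" using s v by (simp add: lk_iff insert_absorb)
    have l: "lk (lk (Bd F K) {v}) (s - {v}) = lk (Bd F K) s" using lk_lk_diff[of "{v}" s] v by simp
    have "sphere_homology F (int d - 2 - fdim (s - {v}) - 1) (lk (Bd F K) s)"
      using h sv l by (simp add: hsphere_def) metis
    moreover have "int d - 2 - fdim (s - {v}) - 1 = int d - int (card s) - 1"
      using lkv[OF sK v] by (simp add: fdim_def of_nat_diff)
    moreover have "scomplex (lk (Bd F K) s)"
      using scomplex_lk[of "lk (Bd F K) {v}" "s - {v}"] sv l h by (simp add: hsphere_def)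
    moreover have "nat (int d - int (card s) - 1 + 1) = d - card s" by linarith
    ultimately show ?thesis using sphere_homology_iff by metis
  qed
  show ?thesis unfolding link_manifold_def
    using K card ok down sphBd by (metis all_not_in_conv)
qed

lemma link_manifold_bdc: "link_manifold F d K \<Longrightarrow> bdc F (int d) K = Bd F K"
  by (rule bdc_eq_Bd) (auto simp: link_manifold_def)

lemma link_manifold_imp_hmanifold:
  assumes hm: "link_manifold F d K"
  shows "hmanifold F (int d) K"
  unfolding hmanifold_def
proof (intro conjI ballI)
  show K: "scomplex K" using hm by (simp add: link_manifold_def)
  fix v assume "v \<in> vert K"
  then have vK: "{v} \<in> K" using scomplex_subset[OF K] by (auto simp: vert_def)
  have card: "\<And>s. s \<in> K \<Longrightarrow> card s \<le> Suc d" and ok: "\<And>s. s \<in> K \<Longrightarrow> s \<noteq> {} \<Longrightarrow> lk_ok F (Suc d) K s"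
    and down: "\<And>s t. s \<in> Bd F K \<Longrightarrow> t \<subseteq> s \<Longrightarrow> t \<in> Bd F K"
    and sphBd: "\<And>s. s \<in> Bd F K \<Longrightarrow> s \<noteq> {} \<Longrightarrow> sph F (d - card s) (lk (Bd F K) s)"
    using hm by (auto simp: link_manifold_def)
  have L: "scomplex (lk K {v})" by (rule scomplex_lk[OF K vK])
  have ins: "v \<notin> s" "insert v s \<in> K" "finite s" "lk (lk K {v}) s = lk K (insert v s)" if "s \<in> lk K {v}" for s
    using that scomplex_face_finite[OF K, of "insert v s"] lk_lk[of "{v}" s K] by (auto simp: lk_iff)
  have cardL: "card s \<le> d" if "s \<in> lk K {v}" for s using ins[OF that] card[of "insert v s"] by simp
  have sph_hom: "sphere_homology F (int d - 1 - fdim s - 1) (lk (lk K {v}) s)"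
    if s: "s \<in> lk K {v}" and "sph F (Suc d - card (insert v s)) (lk K (insert v s))" for s
  proof -
    have "nat (int d - 1 - fdim s - 1 + 1) = Suc d - card (insert v s)" "-1 \<le> int d - 1 - fdim s - 1"
      using ins[OF s] cardL[OF s] by (auto simp: fdim_def)
    then show ?thesis
      using sphere_homology_iff[OF scomplex_lk[OF K ins(2)[OF s]]] that ins(4)[OF s] by metis
  qed
  have cdim: "cdim (lk K {v}) = int d - 1"
  proof -
    obtain f where f: "f \<in> K" "{v} \<subseteq> f" "card f = Suc d"
      using facet_extend[OF K card ok vK] by blast
    show ?thesis
    proof (rule cdim_eqI[OF L])
      show "int (card s) - 1 \<le> int d - 1" if "s \<in> lk K {v}" for s using cardL[OF that] by simp
      show "f - {v} \<in> lk K {v}" using f by (simp add: lk_iff insert_absorb)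
      show "int (card (f - {v})) - 1 = int d - 1" using f by simp
    qed
  qed
  show "hsphere F (int d - 1) (lk K {v}) \<or> hball F (int d - 1) (lk K {v})"
  proof (cases "acyc F (lk K {v})")
    case True
    then have vB: "{v} \<in> Bd F K" using vK by (simp add: Bd_def)
    have d: "1 \<le> d" using Bd_card[OF K vB _ card] by simp
    have eq: "bdc F (int d - 1) (lk K {v}) = lk (Bd F K) {v}"
      by (rule bdc_lk_vertex[OF K True vK d cardL]) (use ok in auto)
    have BK: "Bd F K \<subseteq> K" using Bd_subset K scomplex_empty by blast
    have B: "scomplex (Bd F K)"
      using BK K down finite_subset[OF BK] by (auto simp: scomplex_def Bd_def)
    have insB: "v \<notin> s" "insert v s \<in> Bd F K" "finite s" "card s \<le> d - 1"
      "lk (lk (Bd F K) {v}) s = lk (Bd F K) (insert v s)" if "s \<in> lk (Bd F K) {v}" for s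
    proof -
      show *: "v \<notin> s" "insert v s \<in> Bd F K" using that by (auto simp: lk_iff)
      then show fin: "finite s" using scomplex_face_finite[OF B, of "insert v s"] by simp
      have "card (insert v s) \<le> d" using Bd_card[OF K *(2) _ card] by simp
      then show "card s \<le> d - 1" using * fin by simp
      show "lk (lk (Bd F K) {v}) s = lk (Bd F K) (insert v s)" using lk_lk[of "{v}" s] * by simp
    qed
    have sB: "scomplex (lk (Bd F K) {v})" by (rule scomplex_lk[OF B vB])
    have "hsphere F (int d - 1 - 1) (lk (Bd F K) {v})"
      unfolding hsphere_def
    proof (intro conjI ballI)
      show "scomplex (lk (Bd F K) {v})" by (rule sB)
      have "sph F (d - 1) (lk (Bd F K) {v})" using sphBd[OF vB] by simp
      then obtain f where "f \<in> lk (Bd F K) {v}" "card f = d - 1" by (rule sph_dim[OF sB])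
      then show "cdim (lk (Bd F K) {v}) = int d - 1 - 1"
        using insB(4) d by (intro cdim_eqI[OF sB, of _ f]) (fastforce simp: of_nat_diff)+
      fix s assume s: "s \<in> lk (Bd F K) {v}"
      have "sph F (d - card (insert v s)) (lk (Bd F K) (insert v s))" by (rule sphBd[OF insB(2)[OF s]]) simp
      moreover have "scomplex (lk (Bd F K) (insert v s))" using scomplex_lk[OF B] insB[OF s] by simp
      moreover have "int d - 1 - 1 - fdim s - 1 = int d - 2 - int (card s)" "-1 \<le> int d - 2 - int (card s)"
        "nat (int d - 2 - int (card s) + 1) = d - card (insert v s)"
        using insB[OF s] d by (auto simp: fdim_def)
      ultimately show "sphere_homology F (int d - 1 - 1 - fdim s - 1) (lk (lk (Bd F K) {v}) s)"
        using sphere_homology_iff insB(5)[OF s] by metis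
    qed
    moreover have "acyclic_red F (lk (lk K {v}) s) \<or> sphere_homology F (int d - 1 - fdim s - 1) (lk (lk K {v}) s)"
      if s: "s \<in> lk K {v}" for s
      using ok[of "insert v s"] ins[OF s] sph_hom[OF s] acyclic_red_iff[OF scomplex_lk[OF L s]]
      by (auto simp: lk_ok_def)
    ultimately have "hball F (int d - 1) (lk K {v})"
      unfolding hball_def eq using L cdim True acyclic_red_iff[OF L] by blast
    then show ?thesis by blast
  next
    case False
    \<comment> \<open>An interior vertex lies in no boundary face, as \<open>Bd F K\<close> is
      closed under subfaces. So no link of a face through \<open>v\<close> is acyclic.\<close>
    have "sph F (Suc d - card (insert v s)) (lk K (insert v s))" if s: "s \<in> lk K {v}" for s
    proof -
      have "\<not> acyc F (lk K (insert v s))"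
      proof
        assume "acyc F (lk K (insert v s))"
        then have "insert v s \<in> Bd F K" using ins[OF s] by (simp add: Bd_def)
        then have "{v} \<in> Bd F K" by (rule down) simp
        then show False using False by (simp add: Bd_def)
      qed
      then show ?thesis using ok[of "insert v s"] ins[OF s] by (simp add: lk_ok_def)
    qed
    then have "hsphere F (int d - 1) (lk K {v})"
      unfolding hsphere_def using L cdim sph_hom by blast
    then show ?thesis by blast
  qed
qed

section \<open>The two sides of a chord\<close>

context
  fixes F :: "'k::field itself" and V :: "'a::linorder set" and K :: "'a set set" and w :: 'a
  assumes V: "finite V" and w: "w \<in> V" and KV: "K \<subseteq> Pow V" and K: "acyc F K"
begin

text \<open>Surjectivity of the map from the homology of the link of \<open>w\<close> to that of the
  deletion of \<open>w\<close>. Fill \<open>h\<close> in the acyclic \<open>K\<close> and split the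
  filling into the faces avoiding \<open>w\<close> and those through \<open>w\<close>; the latter
  contribute a cycle of the link.\<close>

lemma cycle_off_vertex:
  assumes h: "h \<in> chains F {t \<in> K. w \<notin> t} k" "D V h = 0"
  obtains b0 b1 where "b0 \<in> chains F {t \<in> K. w \<notin> t} (Suc k)" "b1 \<in> chains F (lk K {w}) k"
    "D V b1 = 0" "h = D V b0 + b1"
proof -
  have hK: "h \<in> chains F K k" using h(1) by (rule chains_mono) auto
  obtain b where b: "b \<in> chains F K (Suc k)" "h = D V b" using acycD[OF K V KV hK h(2)] .
  note on = chains_onD[OF b(1) KV]
  have h0: "h t = 0" if "w \<in> t" for t using h(1) that by (auto simp: chains_iff)
  show ?thesis
  proof
    show "restr (\<lambda>s. w \<notin> s) b \<in> chains F {t \<in> K. w \<notin> t} (Suc k)" by (rule restr_chains[OF b(1)])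
    show "lnk w b \<in> chains F (lk K {w}) k" by (rule lnk_chains[OF b(1)])
    have "lnk w h = 0" by (auto simp: lnk_def h0 fun_eq_iff)
    then show "D V (lnk w b) = 0" using D_lnk[OF V w on] b(2) by simp
    show "h = D V (restr (\<lambda>s. w \<notin> s) b) + lnk w b"
    proof
      fix t
      show "h t = (D V (restr (\<lambda>s. w \<notin> s) b) + lnk w b) t"
      proof (cases "w \<in> t")
        case True
        then show ?thesis by (simp add: h0 D_def restr_def lnk_def)
      next
        case False
        then show ?thesis using D_split[OF V w False, of b] b(2) by simp
      qed
    qed
  qed
qed

text \<open>Injectivity of the same map. The chain \<open>b'\<close> joins \<open>b\<close> to a
  cone with apex \<open>w\<close> over \<open>q\<close>, so that it is a cycle; a filling of it in
  \<open>K\<close> has, through \<open>lnk w\<close>, a trace in the link that fills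
  \<open>q\<close>.\<close>

lemma boundary_into_link:
  assumes q: "q \<in> chains F (lk K {w}) k" "D V q = 0" and b: "b \<in> chains F {t \<in> K. w \<notin> t} (Suc k)" "q = D V b"
  obtains e where "e \<in> chains F (lk K {w}) (Suc k)" "q = D V e"
proof -
  define b' where "b' = (\<lambda>t. if w \<in> t then - osign w (t - {w}) * q (t - {w}) else b t)"
  have b': "b' \<in> chains F K (Suc k)"
    unfolding chains_iff
  proof (intro allI impI)
    fix t assume nz: "b' t \<noteq> 0"
    show "t \<in> K \<and> card t = Suc k"
    proof (cases "w \<in> t")
      case True
      then have "q (t - {w}) \<noteq> 0" using nz by (simp add: b'_def)
      then have t: "t - {w} \<in> lk K {w}" "card (t - {w}) = k" using q(1) by (auto simp: chains_iff)
      have tK: "t \<in> K" using t(1) True by (simp add: lk_iff insert_absorb)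
      then have "finite t" using KV V finite_subset by blast
      then show ?thesis using tK t(2) True by (metis card.remove)
    next
      case False
      then show ?thesis using nz b(1) by (auto simp: b'_def chains_iff)
    qed
  qed
  note on = chains_onD[OF b' KV]
  have lnkb: "lnk w b' = - q"
    using q(1) by (auto simp: lnk_def b'_def fun_eq_iff chains_iff lk_iff)
  have rb: "restr (\<lambda>s. w \<notin> s) b' = b"
    using b(1) by (fastforce simp: restr_def b'_def fun_eq_iff chains_iff)
  have Dm: "D V (- q) = 0" using q(2) D_diff[of V 0 q] by simp
  have "D V b' = 0"
  proof
    fix t
    show "D V b' t = 0 t"
    proof (cases "w \<in> t")
      case True
      then obtain u where u: "t = insert w u" "w \<notin> u" by (meson mk_disjoint_insert)
      have "lnk w (D V b') u = 0" using D_lnk[OF V w on] Dm lnkb by simp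
      then show ?thesis using u by (simp add: lnk_def)
    next
      case False
      then show ?thesis using D_split[OF V w False, of b'] rb lnkb b(2) by simp
    qed
  qed
  then obtain e where e: "e \<in> chains F K (Suc (Suc k))" "b' = D V e"
    using acycD[OF K V KV b'] by blast
  show ?thesis
  proof
    show "lnk w e \<in> chains F (lk K {w}) (Suc k)" by (rule lnk_chains[OF e(1)])
    show "q = D V (lnk w e)"
      using D_lnk[OF V w chains_onD[OF e(1) KV]] e(2) lnkb by simp
  qed
qed

end

definition edge_chain :: "'a::linorder \<Rightarrow> 'a \<Rightarrow> 'a set \<Rightarrow> 'k::field" where
  "edge_chain v w t = (if t = {v, w} then osign w {v} else 0)"

lemma D_edge_chain:
  assumes V: "finite V" "v \<in> V" "w \<in> V" and ne: "v \<noteq> w"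
  shows "D V (edge_chain v w) = (point v - point w :: 'a::linorder set \<Rightarrow> 'k::field)"
proof
  fix t
  have os: "osign v {w} = (- osign w {v} :: 'k)"
    using ne osign_insert[of "{}" v w, where 'k='k] osign_insert[of "{}" w v, where 'k='k] by auto
  consider "t = {v}" | "t = {w}" | "t \<noteq> {v}" "t \<noteq> {w}" by blast
  then show "D V (edge_chain v w) t = (point v - point w :: _ \<Rightarrow> 'k) t"
  proof cases
    case 1
    have "D V (edge_chain v w) {v} = (\<Sum>u\<in>V - {v}. if u = w then 1 else 0 :: 'k)"
      unfolding D_def using ne by (intro sum.cong) (auto simp: edge_chain_def doubleton_eq_iff)
    then show ?thesis using 1 V ne by (simp add: point_def)
  next
    case 2
    have "D V (edge_chain v w) {w} = (\<Sum>u\<in>V - {w}. if u = v then - 1 else 0 :: 'k)"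
      unfolding D_def using ne os by (intro sum.cong) (auto simp: edge_chain_def doubleton_eq_iff)
    then show ?thesis using 2 V ne by (simp add: point_def)
  next
    case 3
    have "edge_chain v w (insert u t) = (0::'k)" if "u \<in> V - t" for u
    proof -
      have "insert u t \<noteq> {v, w}"
      proof
        assume eq: "insert u t = {v, w}"
        then have "t = {v, w} - {u}" "u = v \<or> u = w" using that by blast+
        then show False using 3 ne by auto
      qed
      then show ?thesis by (simp add: edge_chain_def)
    qed
    then show ?thesis using 3 by (simp add: D_def point_def)
  qed
qed

section \<open>Components of the edge graph\<close>

lemma sym_edges: "sym (edges K)"
  by (auto simp: sym_def edges_def insert_commute)

lemma comp_verts_sym: "u \<in> comp_verts K w \<Longrightarrow> w \<in> comp_verts K u"
  using symD[OF sym_rtrancl[OF sym_edges]] by (simp add: comp_verts_def)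

lemma comp_verts_trans: "u \<in> comp_verts K v \<Longrightarrow> v \<in> comp_verts K w \<Longrightarrow> u \<in> comp_verts K w"
  by (auto simp: comp_verts_def)

lemma comp_verts_edge: "{u, v} \<in> K \<Longrightarrow> u \<in> comp_verts K w \<Longrightarrow> v \<in> comp_verts K w"
  by (auto simp: comp_verts_def edges_def intro: rtrancl_into_rtrancl)

lemma comp_verts_mono: "K \<subseteq> L \<Longrightarrow> comp_verts K w \<subseteq> comp_verts L w"
  unfolding comp_verts_def using rtrancl_mono[of "edges K" "edges L"] by (auto simp: edges_def)

lemma comp_verts_refl: "w \<in> comp_verts K w"
  by (simp add: comp_verts_def)

lemma connected_boundary:
  fixes F :: "'k::field itself" and K :: "'a::linorder set set"
  assumes V: "finite V" "K \<subseteq> Pow V" and w: "w \<in> comp_verts K x"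
  shows "\<exists>b\<in>chains F K 2. point x - point w = D V b"
proof -
  have "(x, w) \<in> (edges K)\<^sup>*" using w by (simp add: comp_verts_def)
  then show ?thesis
  proof (induction rule: rtrancl_induct)
    case base
    show ?case by (intro bexI[of _ 0] chains_zero) (simp only: diff_self D_zero)
  next
    case (step v w)
    obtain b where b: "b \<in> chains F K 2" "point x - point v = D V b" using step.IH by blast
    show ?case
    proof (cases "v = w")
      case False
      have vw: "{v, w} \<in> K" using step.hyps(2) by (simp add: edges_def)
      then have vwV: "v \<in> V" "w \<in> V" using V by auto
      have "edge_chain v w \<in> chains F K 2" using vw False by (auto simp: chains_iff edge_chain_def)
      then have "b + edge_chain v w \<in> chains F K 2" using b(1) by (intro chains_add)
      moreover have "point x - point w = D V (b + edge_chain v w)"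
        using D_edge_chain[OF V(1) vwV False, where 'k='k] by (simp add: D_add flip: b(2))
      ultimately show ?thesis by blast
    qed (use b in auto)
  qed
qed

text \<open>That \<open>\<sigma>\<close> is interior has become \<open>lk_\<sigma>\<close>, and that
  its proper faces lie in the boundary has become \<open>proper\<close>.\<close>

locale chord =
  fixes F :: "'k::field itself" and d :: nat and \<Delta> :: "'a::linorder set set" and \<sigma> :: "'a set" and x y :: 'a
  assumes hm: "link_manifold F d \<Delta>" and \<sigma>: "\<sigma> \<in> \<Delta>" "card \<sigma> = d" "\<sigma> \<noteq> {}"
    and lk_\<sigma>: "lk \<Delta> \<sigma> = {{}, {x}, {y}}" and xy: "x \<noteq> y"
    and proper: "\<And>s. s \<subset> \<sigma> \<Longrightarrow> s \<noteq> {} \<Longrightarrow> acyc F (lk \<Delta> s)"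
begin

lemma \<Delta>: "scomplex \<Delta>" using hm by (simp add: link_manifold_def)

abbreviation V :: "'a set" where "V \<equiv> vert \<Delta>"

lemmas V = scomplex_finite_vert[OF \<Delta>] and \<Delta>V = scomplex_Pow[OF \<Delta>]

lemma fin\<sigma>: "finite \<sigma>" using \<sigma> scomplex_face_finite[OF \<Delta>] by blast

lemma \<sigma>V: "\<sigma> \<subseteq> V" using \<sigma> by (auto simp: vert_def)

lemma xyV: "x \<notin> \<sigma>" "y \<notin> \<sigma>" "insert x \<sigma> \<in> \<Delta>" "insert y \<sigma> \<in> \<Delta>" "x \<in> V" "y \<in> V"
proof -
  have "{x} \<in> lk \<Delta> \<sigma>" "{y} \<in> lk \<Delta> \<sigma>" using lk_\<sigma> by auto
  then show *: "x \<notin> \<sigma>" "y \<notin> \<sigma>" "insert x \<sigma> \<in> \<Delta>" "insert y \<sigma> \<in> \<Delta>" by (auto simp: lk_iff)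
  then show "x \<in> V" "y \<in> V" by (auto simp: vert_def)
qed

text \<open>The link of \<open>s\<close> in which, of the vertices of \<open>\<sigma> - s\<close>,
  only those in \<open>r\<close> are kept. With \<open>r = \<sigma> - s\<close> it is
  \<open>lk \<Delta> s\<close>; with \<open>r = {}\<close> all of \<open>\<sigma>\<close> is gone
  and the two sides become visible.\<close>

definition lkr :: "'a set \<Rightarrow> 'a set \<Rightarrow> 'a set set" where
  "lkr s r = {t \<in> lk \<Delta> s. t \<inter> \<sigma> \<subseteq> r}"

lemma lkr_iff: "t \<in> lkr s r \<longleftrightarrow> t \<inter> s = {} \<and> t \<union> s \<in> \<Delta> \<and> t \<inter> \<sigma> \<subseteq> r"
  by (auto simp: lkr_def lk_iff)

lemma lkr_V: "lkr s r \<subseteq> Pow V"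
  using \<Delta>V by (auto simp: lkr_iff)

lemma lkr_antimono: "s' \<subseteq> s \<Longrightarrow> lkr s r \<subseteq> lkr s' r"
proof
  fix t assume s: "s' \<subseteq> s" and "t \<in> lkr s r"
  then have t: "t \<inter> s = {}" "t \<union> s \<in> \<Delta>" "t \<inter> \<sigma> \<subseteq> r" by (auto simp: lkr_iff)
  have "t \<union> s' \<in> \<Delta>" using s by (intro scomplex_subset[OF \<Delta> t(2)]) blast
  then show "t \<in> lkr s' r" using t s by (auto simp: lkr_iff)
qed

lemma lkr_off: "w \<notin> r \<Longrightarrow> w \<in> \<sigma> \<Longrightarrow> {t \<in> lkr s (insert w r). w \<notin> t} = lkr s r"
  by (auto simp: lkr_iff)

lemma lkr_lk: "w \<in> \<sigma> \<Longrightarrow> w \<notin> s \<Longrightarrow> w \<notin> r \<Longrightarrow> lk (lkr s (insert w r)) {w} = lkr (insert w s) r"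
  by (auto simp: lkr_iff lk_iff)

text \<open>Deleting \<open>w\<close> from \<open>lkr s (insert w r)\<close> leaves the homology of
  the link of \<open>w\<close> there, which is \<open>lkr (insert w s) r\<close>. Both are covered
  by the induction. As \<open>r\<close> is nonempty, \<open>s\<close> never exhausts
  \<open>\<sigma>\<close>, so the induction starts from links that are acyclic by
  \<open>proper\<close>.\<close>

lemma acyc_lkr:
  assumes "s \<subseteq> \<sigma>" "s \<noteq> {}" "r \<subseteq> \<sigma> - s" "r \<noteq> {}"
  shows "acyc F (lkr s r)"
  using assms
proof (induction "card (\<sigma> - s - r)" arbitrary: s r)
  case 0
  then have "\<sigma> - s - r = {}" using fin\<sigma> by simp
  then have "lkr s r = lk \<Delta> s" by (intro set_eqI) (simp add: lkr_iff lk_iff, blast)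
  moreover have "s \<subset> \<sigma>" using 0 by blast
  ultimately show ?case using proper[of s] 0 by simp
next
  case (Suc n)
  then obtain w where w: "w \<in> \<sigma> - s - r" by (metis all_not_in_conv card.empty nat.distinct(1))
  have card: "n = card (\<sigma> - s - insert w r)" "n = card (\<sigma> - insert w s - r)"
  proof -
    have "\<sigma> - s - insert w r = (\<sigma> - s - r) - {w}" "\<sigma> - insert w s - r = (\<sigma> - s - r) - {w}" by auto
    then show "n = card (\<sigma> - s - insert w r)" "n = card (\<sigma> - insert w s - r)"
      using Suc.hyps(2) w fin\<sigma> by (simp_all add: card_Diff_singleton)
  qed
  have K: "acyc F (lkr s (insert w r))" using Suc.prems w by (intro Suc.hyps(1)[OF card(1)]) auto
  have L: "acyc F (lkr (insert w s) r)" using Suc.prems w by (intro Suc.hyps(1)[OF card(2)]) auto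
  have wV: "w \<in> V" using w \<sigma>V by blast
  show ?case
  proof (rule acycI[OF V lkr_V])
    fix k h assume h: "h \<in> chains F (lkr s r) k" "D V h = 0"
    obtain b0 b1 where b: "b0 \<in> chains F (lkr s r) (Suc k)" "b1 \<in> chains F (lkr (insert w s) r) k"
      "D V b1 = 0" "h = D V b0 + b1"
      using cycle_off_vertex[OF V wV lkr_V K, of h k] h w by (auto simp: lkr_off lkr_lk)
    obtain e where e: "e \<in> chains F (lkr (insert w s) r) (Suc k)" "b1 = D V e"
      using acycD[OF L V lkr_V b(2,3)] .
    have "b0 + e \<in> chains F (lkr s r) (Suc k)"
      by (intro chains_add b(1) chains_mono[OF e(1)] lkr_antimono) auto
    then show "\<exists>b\<in>chains F (lkr s r) (Suc k). h = D V b" 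
      using b(4) e(2) by (intro bexI[of _ "b0 + e"]) (simp_all add: D_add)
  qed
qed

abbreviation q :: "'a set \<Rightarrow> 'k" where "q \<equiv> point x - point y"

lemma lkr_top: "t \<in> lkr \<sigma> {} \<longleftrightarrow> t = {} \<or> t = {x} \<or> t = {y}"
  using lk_\<sigma> xyV(1,2) by (auto simp: lkr_def)

lemma q_chain: "s \<subseteq> \<sigma> \<Longrightarrow> q \<in> chains F (lkr s {}) 1"
  using lkr_antimono[of s \<sigma> "{}"] by (intro chains_diff point_chains) (auto simp: lkr_top)

lemma Dq: "D V q = 0"
  by (rule D_point_diff[OF V xyV(5,6)])

text \<open>The last deletion: \<open>lkr s {w}\<close> is still acyclic, and removing
  \<open>w\<close> identifies the degree zero homology of \<open>lkr s {}\<close> with that of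
  \<open>lkr (insert w s) {}\<close>. Growing \<open>s\<close> up to \<open>\<sigma>\<close> reaches
  the two points \<open>x\<close> and \<open>y\<close>. The chain \<open>q\<close> lives on all
  these complexes, so it remains the generator.\<close>

lemma
  assumes "s \<subseteq> \<sigma>" "s \<noteq> {}"
  shows cycle_lkr: "c \<in> chains F (lkr s {}) 1 \<Longrightarrow> D V c = 0 \<Longrightarrow> \<exists>a. \<exists>b\<in>chains F (lkr s {}) 2. c = cscale a q + D V b"
    and q_not_boundary: "b \<in> chains F (lkr s {}) 2 \<Longrightarrow> q \<noteq> D V b"
proof -
  have "(\<forall>c\<in>chains F (lkr s {}) 1. D V c = 0 \<longrightarrow> (\<exists>a. \<exists>b\<in>chains F (lkr s {}) 2. c = cscale a q + D V b)) \<and>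
    (\<forall>b\<in>chains F (lkr s {}) 2. q \<noteq> D V b)"
    using assms
  proof (induction "card (\<sigma> - s)" arbitrary: s)
    case 0
    then have s: "s = \<sigma>" using fin\<sigma> by auto
    have "\<exists>a. \<exists>b\<in>chains F (lkr s {}) 2. c = cscale a q + D V b"
      if c: "c \<in> chains F (lkr s {}) 1" "D V c = 0" for c
    proof -
      have c0: "c t = 0" if "t \<noteq> {x}" "t \<noteq> {y}" for t
        using c(1) that by (auto simp: chains_iff s lkr_top)
      have "0 = (\<Sum>v\<in>V. c {v})" using c(2) D_empty_eq[of V c] by simp
      also have "\<dots> = (\<Sum>v\<in>{x, y}. c {v})"
        using xyV c0 V by (intro sum.mono_neutral_right) auto
      finally have "c {y} = - c {x}" using xy by (simp add: eq_neg_iff_add_eq_0 add.commute)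
      then have "c = cscale (c {x}) q + D V 0"
        using c0 xy by (auto simp: cscale_def point_def fun_eq_iff)
      then show ?thesis using chains_zero by blast
    qed
    moreover have "q \<noteq> D V b" if "b \<in> chains F (lkr s {}) 2" for b
    proof -
      have "b t = 0" for t using that by (auto simp: chains_iff s lkr_top)
      then have "D V b {x} = 0" by (simp add: D_def)
      moreover have "q {x} = 1" using xy by (simp add: point_def)
      ultimately show ?thesis by force
    qed
    ultimately show ?case by blast
  next
    case (Suc n)
    then obtain w where w: "w \<in> \<sigma> - s" by (metis all_not_in_conv card.empty nat.distinct(1))
    have wV: "w \<in> V" using w \<sigma>V by blast
    have "\<sigma> - insert w s = (\<sigma> - s) - {w}" by auto
    then have card: "n = card (\<sigma> - insert w s)" using Suc.hyps(2) w fin\<sigma> by (simp add: card_Diff_singleton)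
    have IH: "\<And>c. c \<in> chains F (lkr (insert w s) {}) 1 \<Longrightarrow> D V c = 0 \<Longrightarrow>
        \<exists>a. \<exists>b\<in>chains F (lkr (insert w s) {}) 2. c = cscale a q + D V b"
      "\<And>b. b \<in> chains F (lkr (insert w s) {}) 2 \<Longrightarrow> q \<noteq> D V b"
      using Suc.hyps(1)[OF card] Suc.prems w by auto
    have K: "acyc F (lkr s {w})" using Suc.prems w by (intro acyc_lkr) auto
    have sub: "lkr (insert w s) {} \<subseteq> lkr s {}" by (intro lkr_antimono) auto
    have eqs: "{t \<in> lkr s {w}. w \<notin> t} = lkr s {}" "lk (lkr s {w}) {w} = lkr (insert w s) {}"
      using w lkr_off[of w "{}" s] lkr_lk[of w s "{}"] by auto
    have "\<exists>a. \<exists>b\<in>chains F (lkr s {}) 2. c = cscale a q + D V b"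
      if c: "c \<in> chains F (lkr s {}) 1" "D V c = 0" for c
    proof -
      obtain b0 b1 where b: "b0 \<in> chains F (lkr s {}) (Suc 1)" "b1 \<in> chains F (lkr (insert w s) {}) 1"
        "D V b1 = 0" "c = D V b0 + b1"
        using cycle_off_vertex[OF V wV lkr_V K, unfolded eqs, OF c] .
      obtain a e where e: "e \<in> chains F (lkr (insert w s) {}) 2" "b1 = cscale a q + D V e"
        using IH(1)[OF b(2,3)] by blast
      have "b0 + e \<in> chains F (lkr s {}) 2"
        using b(1) by (intro chains_add chains_mono[OF e(1) sub]) (simp add: numeral_2_eq_2)
      moreover have "c = cscale a q + D V (b0 + e)" using b(4) e(2) by (simp add: D_add)
      ultimately show ?thesis by blast
    qed
    moreover have "q \<noteq> D V b" if b: "b \<in> chains F (lkr s {}) 2" for b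
    proof
      assume eq: "q = D V b"
      have "q \<in> chains F (lkr (insert w s) {}) 1" using Suc.prems w by (intro q_chain) auto
      moreover have "b \<in> chains F (lkr s {}) (Suc 1)" using b by (simp add: numeral_2_eq_2)
      ultimately obtain e where "e \<in> chains F (lkr (insert w s) {}) (Suc 1)" "q = D V e"
        using boundary_into_link[OF V wV lkr_V K, unfolded eqs, OF _ Dq _ eq] by blast
      then show False using IH(2)[of e] by (simp add: numeral_2_eq_2)
    qed
    ultimately show ?case by blast
  qed
  then show "c \<in> chains F (lkr s {}) 1 \<Longrightarrow> D V c = 0 \<Longrightarrow> \<exists>a. \<exists>b\<in>chains F (lkr s {}) 2. c = cscale a q + D V b"
    "b \<in> chains F (lkr s {}) 2 \<Longrightarrow> q \<noteq> D V b" by blast+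
qed

lemma x_y_separated: "s \<subseteq> \<sigma> \<Longrightarrow> s \<noteq> {} \<Longrightarrow> y \<notin> comp_verts (lkr s {}) x"
  using connected_boundary[OF V lkr_V, where F=F] q_not_boundary by blast

text \<open>For \<open>u\<close> in a third component, \<open>point u - point x\<close> would be a
  multiple of \<open>q\<close> plus a boundary. Over the union \<open>C\<close> of the components of
  \<open>x\<close> and \<open>y\<close> its coefficients add up to -1, whereas those of
  \<open>q\<close> and of a boundary add up to 0.\<close>

lemma x_or_y_component:
  assumes s: "s \<subseteq> \<sigma>" "s \<noteq> {}" and u: "{u} \<in> lkr s {}"
  shows "u \<in> comp_verts (lkr s {}) x \<or> u \<in> comp_verts (lkr s {}) y"
proof (rule ccontr)
  define C where "C = comp_verts (lkr s {}) x \<union> comp_verts (lkr s {}) y"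
  assume "\<not> ?thesis"
  then have uC: "u \<notin> C" by (simp add: C_def)
  have xyC: "x \<in> C" "y \<in> C" by (auto simp: C_def comp_verts_refl)
  have x: "{x} \<in> lkr s {}" using lkr_antimono[OF s(1)] lkr_top by blast
  have uV: "u \<in> V" using u lkr_V by blast
  have "(point u - point x :: _ \<Rightarrow> 'k) \<in> chains F (lkr s {}) 1"
    by (intro chains_diff point_chains u x)
  moreover have "D V (point u - point x) = (0 :: _ \<Rightarrow> 'k)" by (rule D_point_diff[OF V uV xyV(5)])
  ultimately obtain a b where b: "b \<in> chains F (lkr s {}) 2" "point u - point x = cscale a q + D V b"
    using cycle_lkr[OF s] by blast
  have "(\<Sum>v\<in>V \<inter> C. D V b {v}) = 0"
    by (rule sum_component[OF V lkr_V b(1)]) (auto simp: C_def dest: comp_verts_edge)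
  moreover have "(\<Sum>v\<in>V \<inter> C. q {v}) = 0"
    using V xyV xyC by (simp add: sum_subtractf sum_point)
  moreover have "(\<Sum>v\<in>V \<inter> C. (cscale a q + D V b) {v}) = a * (\<Sum>v\<in>V \<inter> C. q {v}) + (\<Sum>v\<in>V \<inter> C. D V b {v})"
    by (simp add: cscale_def sum.distrib sum_distrib_left)
  ultimately have "(\<Sum>v\<in>V \<inter> C. (point u - point x :: _ \<Rightarrow> 'k) {v}) = 0" by (simp only: b(2)) simp
  then show False using V xyV xyC uC by (simp add: sum_subtractf sum_point)
qed

definition side :: "'a \<Rightarrow> 'a \<Rightarrow> bool" where
  "side z u \<longleftrightarrow> u \<in> comp_verts (lkr {z} {}) x"

text \<open>With \<open>s\<close> the intersection of \<open>\<alpha>\<close> and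
  \<open>\<sigma>\<close>, the vertices of \<open>\<alpha> - \<sigma>\<close> lie in one component
  of \<open>lkr s {}\<close>. Its components of \<open>x\<close> and \<open>y\<close> map into those
  of \<open>lkr {z} {}\<close> for every \<open>z\<close> in \<open>s\<close>, and these are still
  distinct.\<close>

lemma side_consistent:
  assumes \<alpha>: "\<alpha> \<in> \<Delta>" and z: "z \<in> \<alpha> \<inter> \<sigma>" "w \<in> \<alpha> \<inter> \<sigma>" and u: "u \<in> \<alpha> - \<sigma>" "v \<in> \<alpha> - \<sigma>"
  shows "side z u \<longleftrightarrow> side w v"
proof -
  define s where "s = \<alpha> \<inter> \<sigma>"
  have s: "s \<subseteq> \<sigma>" "s \<noteq> {}" using z by (auto simp: s_def)
  have f: "t \<in> lkr s {}" if "t \<subseteq> \<alpha> - \<sigma>" for t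
    using that scomplex_subset[OF \<Delta> \<alpha>, of "t \<union> s"] by (auto simp: lkr_iff s_def)
  have uv: "{u} \<in> lkr s {}" "{u, v} \<in> lkr s {}" using u by (auto intro!: f)
  have mono: "comp_verts (lkr s {}) a \<subseteq> comp_verts (lkr {b} {}) a" if "b \<in> s" for a b
    using that by (intro comp_verts_mono lkr_antimono) auto
  have no: "\<not> side b e" if "b \<in> s" "e \<in> comp_verts (lkr s {}) y" for b e
  proof
    assume "side b e"
    moreover have "e \<in> comp_verts (lkr {b} {}) y" using mono that by blast
    ultimately have "y \<in> comp_verts (lkr {b} {}) x"
      unfolding side_def by (metis comp_verts_sym comp_verts_trans)
    then show False using x_y_separated[of "{b}"] that s by auto
  qed
  have zs: "z \<in> s" "w \<in> s" using z by (auto simp: s_def)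
  show ?thesis
    using x_or_y_component[OF s uv(1)]
  proof
    assume *: "u \<in> comp_verts (lkr s {}) x"
    then have "v \<in> comp_verts (lkr s {}) x" by (rule comp_verts_edge[OF uv(2)])
    then show ?thesis using * mono zs unfolding side_def by blast
  next
    assume *: "u \<in> comp_verts (lkr s {}) y"
    then have "v \<in> comp_verts (lkr s {}) y" by (rule comp_verts_edge[OF uv(2)])
    then show ?thesis using * no zs by blast
  qed
qed

lemma side_x: "side z x" by (simp add: side_def comp_verts_refl)

lemma side_y: "z \<in> \<sigma> \<Longrightarrow> \<not> side z y" using x_y_separated[of "{z}"] by (simp add: side_def)

end

section \<open>Cutting along a chord\<close>

text \<open>Faces containing \<open>\<tau>\<close> belong to the star of \<open>u\<close>, so it is
  enough to know how \<open>f\<close> acts on this one star. This is what admits a relabelling that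
  varies with \<open>u\<close>.\<close>

lemma lk_image:
  assumes f: "inj_on f V" and K: "K \<subseteq> Pow V" and star: "{\<gamma> \<in> K'. f u \<in> \<gamma>} = (`) f ` {\<alpha> \<in> K. u \<in> \<alpha>}"
    and u: "u \<in> \<tau>" "\<tau> \<subseteq> V"
  shows "lk K' (f ` \<tau>) = (`) f ` lk K \<tau>"
proof (intro equalityI subsetI)
  fix t assume "t \<in> lk K' (f ` \<tau>)"
  then have t: "t \<inter> f ` \<tau> = {}" "t \<union> f ` \<tau> \<in> K'" by (auto simp: lk_iff)
  then have "t \<union> f ` \<tau> \<in> {\<gamma> \<in> K'. f u \<in> \<gamma>}" using u by auto
  then obtain \<alpha> where \<alpha>: "\<alpha> \<in> K" "t \<union> f ` \<tau> = f ` \<alpha>" unfolding star by auto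
  have \<alpha>V: "\<alpha> \<subseteq> V" using \<alpha> K by auto
  have "\<tau> \<subseteq> \<alpha>"
  proof
    fix v assume v: "v \<in> \<tau>"
    then have "f v \<in> f ` \<alpha>" using \<alpha>(2) by blast
    then show "v \<in> \<alpha>" using inj_on_image_mem_iff[OF f _ \<alpha>V] v u(2) by blast
  qed
  then have "\<alpha> - \<tau> \<in> lk K \<tau>" using \<alpha>(1) by (simp add: lk_iff Un_absorb2 Diff_Int_distrib2 Diff_disjoint Int_commute)
  moreover have "t = f ` (\<alpha> - \<tau>)"
  proof -
    have "f ` (\<alpha> - \<tau>) = f ` \<alpha> - f ` \<tau>"
      using \<alpha>V u(2) by (intro inj_on_image_set_diff[OF f]) auto
    also have "\<dots> = (t \<union> f ` \<tau>) - f ` \<tau>" by (simp only: \<alpha>(2))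
    also have "\<dots> = t" using t(1) by blast
    finally show ?thesis by (rule sym)
  qed
  ultimately show "t \<in> (`) f ` lk K \<tau>" by blast
next
  fix t assume "t \<in> (`) f ` lk K \<tau>"
  then obtain a where a: "t = f ` a" "a \<inter> \<tau> = {}" "a \<union> \<tau> \<in> K" by (auto simp: lk_iff)
  then have "f ` (a \<union> \<tau>) \<in> {\<gamma> \<in> K'. f u \<in> \<gamma>}" unfolding star using u by blast
  then have "f ` a \<union> f ` \<tau> \<in> K'" by (simp add: image_Un)
  moreover have "f ` a \<inter> f ` \<tau> = {}"
    using inj_on_image_Int[OF f, of a \<tau>] a K u(2) by auto
  ultimately show "t \<in> lk K' (f ` \<tau>)" using a(1) by (simp add: lk_iff)
qed

context chord
begin

text \<open>Vacuous for faces inside \<open>\<sigma>\<close> and for faces disjoint from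
  \<open>\<sigma>\<close>: these belong to both halves.\<close>

definition one_sided :: "bool \<Rightarrow> 'a set \<Rightarrow> bool" where
  "one_sided b \<alpha> \<longleftrightarrow> (\<forall>z\<in>\<alpha> \<inter> \<sigma>. \<forall>u\<in>\<alpha> - \<sigma>. side z u = b)"

definition half :: "bool \<Rightarrow> 'a set set" where
  "half b = {\<alpha> \<in> \<Delta>. one_sided b \<alpha>}"

text \<open>Proper faces of \<open>\<sigma>\<close> are boundary faces already, so the first
  alternative serves to add \<open>\<sigma>\<close> itself: it is the cap.\<close>

definition half_bd :: "bool \<Rightarrow> 'a set set" where
  "half_bd b = {\<alpha> \<in> half b. \<alpha> \<subseteq> \<sigma> \<or> \<alpha> \<in> Bd F \<Delta>}"

lemma half_cover: "\<alpha> \<in> \<Delta> \<Longrightarrow> \<alpha> \<in> half b \<or> \<alpha> \<in> half (\<not> b)"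
  using side_consistent unfolding half_def one_sided_def by (cases b) blast+

lemma half_iff: "\<alpha> \<in> \<Delta> \<Longrightarrow> z \<in> \<alpha> \<inter> \<sigma> \<Longrightarrow> u \<in> \<alpha> - \<sigma> \<Longrightarrow> \<alpha> \<in> half b \<longleftrightarrow> side z u = b"
  using side_consistent[of \<alpha>] unfolding half_def one_sided_def by blast

lemma half_subset: "half b \<subseteq> \<Delta>"
  by (auto simp: half_def)

lemma half_down: "\<alpha> \<in> half b \<Longrightarrow> \<beta> \<subseteq> \<alpha> \<Longrightarrow> \<beta> \<in> half b"
proof -
  assume \<alpha>: "\<alpha> \<in> half b" and \<beta>: "\<beta> \<subseteq> \<alpha>"
  have "\<alpha> \<in> \<Delta>" using \<alpha> by (simp add: half_def)
  then have "\<beta> \<in> \<Delta>" using \<beta> by (rule scomplex_subset[OF \<Delta>])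
  moreover have "side z u = b" if "z \<in> \<beta> \<inter> \<sigma>" "u \<in> \<beta> - \<sigma>" for z u
  proof -
    have "z \<in> \<alpha> \<inter> \<sigma>" "u \<in> \<alpha> - \<sigma>" using that \<beta> by blast+
    then show ?thesis using \<alpha> by (simp add: half_def one_sided_def)
  qed
  ultimately show ?thesis by (simp add: half_def one_sided_def)
qed

lemma half_pure: "\<alpha> \<subseteq> \<sigma> \<Longrightarrow> \<alpha> \<in> half b"
  using scomplex_subset[OF \<Delta> \<sigma>(1)] by (auto simp: half_def one_sided_def)

lemma lk_V: "K \<subseteq> \<Delta> \<Longrightarrow> lk K s \<subseteq> Pow V"
proof
  fix t assume "K \<subseteq> \<Delta>" "t \<in> lk K s"
  then have "t \<union> s \<in> Pow V" using \<Delta>V unfolding lk_iff by blast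
  then show "t \<in> Pow V" by blast
qed

lemma lk_half_V: "lk (half b) s \<subseteq> Pow V"
  by (rule lk_V[OF half_subset])

definition tip :: "bool \<Rightarrow> 'a" where "tip b = (if b then x else y)"

lemma tip: "tip b \<notin> \<sigma>" "insert (tip b) \<sigma> \<in> \<Delta>" "tip b \<in> V" "z \<in> \<sigma> \<Longrightarrow> side z (tip b) = b"
  using xyV side_x side_y by (auto simp: tip_def)

lemma insert_half_iff: "insert v \<sigma> \<in> half b \<and> v \<notin> \<sigma> \<longleftrightarrow> v = tip b"
proof
  assume v: "insert v \<sigma> \<in> half b \<and> v \<notin> \<sigma>"
  then have "insert v \<sigma> \<in> \<Delta>" using half_subset by blast
  then have "{v} \<in> lk \<Delta> \<sigma>" using v by (simp add: lk_iff)
  then have "v = tip True \<or> v = tip False" using lk_\<sigma> by (auto simp: tip_def)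
  then obtain c where c: "v = tip c" by blast
  obtain z where z: "z \<in> \<sigma>" using \<sigma>(3) by blast
  have "side z v = b" using half_iff[of "insert v \<sigma>" z v b] v z tip(2)[of c] c by simp
  then show "v = tip b" using c tip(4)[OF z, of c] by simp
next
  assume v: "v = tip b"
  obtain z where z: "z \<in> \<sigma>" using \<sigma>(3) by blast
  show "insert v \<sigma> \<in> half b \<and> v \<notin> \<sigma>"
    using half_iff[of "insert v \<sigma>" z v b] z v tip by simp
qed

lemma acyc_half:
  assumes s: "s \<subseteq> \<sigma>" "s \<noteq> {}"
  shows "acyc F (lk (half b) s)"
proof (cases "s = \<sigma>")
  \<comment> \<open>For \<open>s = \<sigma>\<close> the two halves of the link meet only in the
    empty face, which is no acyclic overlap to push across. Each half is a single point.\<close>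
  case True
  have "lk (half b) \<sigma> = Pow {tip b}"
  proof (intro equalityI subsetI)
    fix t assume t: "t \<in> lk (half b) \<sigma>"
    have "v = tip b" if "v \<in> t" for v
    proof -
      have "t \<union> \<sigma> \<in> half b" using t by (simp add: lk_iff)
      moreover have "insert v \<sigma> \<subseteq> t \<union> \<sigma>" using that by blast
      ultimately have "insert v \<sigma> \<in> half b" by (rule half_down)
      moreover have "v \<notin> \<sigma>" using t that by (auto simp: lk_iff)
      ultimately show ?thesis using insert_half_iff by blast
    qed
    then show "t \<in> Pow {tip b}" by blast
  next
    fix t assume "t \<in> Pow {tip b}"
    then consider "t = {}" | "t = {tip b}" by blast
    then show "t \<in> lk (half b) \<sigma>"
      using insert_half_iff[of "tip b" b] half_pure[of \<sigma>] by cases (auto simp: lk_iff)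
  qed
  then show ?thesis using acyc_Pow[of "{tip b}"] True by simp
next
  case False
  define Ky Kx where "Ky = lk (half b) s" and "Kx = lk (half (\<not> b)) s"
  have K: "lk \<Delta> s = Kx \<union> Ky"
  proof (rule set_eqI)
    fix t
    show "t \<in> lk \<Delta> s \<longleftrightarrow> t \<in> Kx \<union> Ky"
      using half_cover[of "t \<union> s" b] subsetD[OF half_subset, of "t \<union> s"] unfolding Kx_def Ky_def Un_iff lk_iff by blast
  qed
  have P: "Pow (\<sigma> - s) \<subseteq> Ky"
  proof
    fix t assume "t \<in> Pow (\<sigma> - s)"
    then have "t \<inter> s = {}" "t \<union> s \<subseteq> \<sigma>" using s by blast+
    then show "t \<in> Ky" using half_pure unfolding Ky_def lk_iff by blast
  qed
  have int: "Kx \<inter> Ky \<subseteq> Pow (\<sigma> - s)"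
  proof
    fix t assume t: "t \<in> Kx \<inter> Ky"
    then have h: "t \<union> s \<in> half b" "t \<union> s \<in> half (\<not> b)" "t \<inter> s = {}" by (auto simp: Kx_def Ky_def lk_iff)
    obtain z where z: "z \<in> s" using s by blast
    have "u \<in> \<sigma>" if u: "u \<in> t" for u
    proof (rule ccontr)
      assume "u \<notin> \<sigma>"
      then have "side z u = b" "side z u = (\<not> b)"
        using h u z s(1) unfolding half_def one_sided_def by blast+
      then show False by simp
    qed
    then show "t \<in> Pow (\<sigma> - s)" using h(3) by blast
  qed
  have KV: "lk \<Delta> s \<subseteq> Pow V" using \<Delta>V by (auto simp: lk_iff)
  have a: "acyc F (lk \<Delta> s)" using proper s False by blast
  have a': "acyc F (Pow (\<sigma> - s))" using s False fin\<sigma> by (intro acyc_Pow) auto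
  have down: "t' \<in> lk (half c) s" if "t \<in> lk (half c) s" "t' \<subseteq> t" for t t' c
    using that half_down[of "t \<union> s" c "t' \<union> s"] by (auto simp: lk_iff)
  have "acyc F Ky"
  proof (rule acycI[OF V])
    show "Ky \<subseteq> Pow V" unfolding Ky_def by (rule lk_half_V)
    fix k h assume h: "h \<in> chains F Ky k" "D V h = 0"
    have "h \<in> chains F (lk \<Delta> s) k" using K by (intro chains_mono[OF h(1)]) auto
    then obtain c where c: "c \<in> chains F (lk \<Delta> s) (Suc k)" "h = D V c" using acycD[OF a V KV _ h(2)] by blast
    \<comment> \<open>A filling of \<open>h\<close> in the whole link may use the other half; it is
      pushed into the simplex on \<open>\<sigma> - s\<close> in which the halves meet.\<close>
    obtain c' where c': "c' \<in> chains F (Ky \<union> Pow (\<sigma> - s)) (Suc k)" "D V c' = D V c"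
    proof (rule boundary_push[OF V _ _ a' int, of c k])
      show "Pow (\<sigma> - s) \<subseteq> Pow V" using \<sigma>V by auto
      show "Kx \<union> Ky \<subseteq> Pow V" using K KV by simp
      show "c \<in> chains F (Kx \<union> Ky) (Suc k)" using c K by simp
      show "D V c \<in> chains F Ky k" using h c by simp
      show "t \<in> Kx" if "s' \<in> Kx" "t \<subseteq> s'" for s' t using down that unfolding Kx_def .
      show "t \<in> Ky" if "s' \<in> Ky" "t \<subseteq> s'" for s' t using down that unfolding Ky_def .
    qed (rule that)
    have "Ky \<union> Pow (\<sigma> - s) = Ky" using P by blast
    then show "\<exists>b\<in>chains F Ky (Suc k). h = D V b" using c' c(2) by metis
  qed
  then show ?thesis by (simp add: Ky_def)
qed

lemma Bd_down: "s \<in> Bd F \<Delta> \<Longrightarrow> t \<subseteq> s \<Longrightarrow> t \<in> Bd F \<Delta>"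
  and Bd_sph: "s \<in> Bd F \<Delta> \<Longrightarrow> s \<noteq> {} \<Longrightarrow> sph F (d - card s) (lk (Bd F \<Delta>) s)"
  and \<Delta>_card: "s \<in> \<Delta> \<Longrightarrow> card s \<le> Suc d"
  and \<Delta>_ok: "s \<in> \<Delta> \<Longrightarrow> s \<noteq> {} \<Longrightarrow> lk_ok F (Suc d) \<Delta> s"
  using hm by (auto simp: link_manifold_def)

lemma Bd_card_le: "s \<in> Bd F \<Delta> \<Longrightarrow> card s \<le> d"
  using Bd_card[OF \<Delta> _ _ \<Delta>_card] by (cases "s = {}") auto

lemma Bd_sub: "Bd F \<Delta> \<subseteq> \<Delta>"
  using Bd_subset \<Delta> scomplex_empty by blast

lemma proper_Bd: "s \<subset> \<sigma> \<Longrightarrow> s \<in> Bd F \<Delta>"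
  using proper[of s] scomplex_subset[OF \<Delta> \<sigma>(1), of s] by (auto simp: Bd_def)

lemma half_bd_top: "lk (half_bd b) \<sigma> = {{}}"
proof -
  have "t = {}" if "t \<in> lk (half_bd b) \<sigma>" for t
  proof (rule ccontr)
    assume t: "t \<noteq> {}"
    have t': "t \<inter> \<sigma> = {}" "t \<union> \<sigma> \<in> half_bd b" using that by (auto simp: lk_iff)
    then have "t \<union> \<sigma> \<in> Bd F \<Delta>" using t by (auto simp: half_bd_def)
    then have "card (t \<union> \<sigma>) \<le> d" "finite (t \<union> \<sigma>)"
      using Bd_card_le Bd_sub scomplex_face_finite[OF \<Delta>] by auto
    then have "card t = 0" using t' \<sigma>(2) by (auto simp: card_Un_disjoint)
    then show False using t \<open>finite (t \<union> \<sigma>)\<close> by simp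
  qed
  moreover have "{} \<in> lk (half_bd b) \<sigma>" using half_pure[of \<sigma>] by (simp add: lk_iff half_bd_def)
  ultimately show ?thesis by blast
qed

end

section \<open>One half of the boundary sphere over a proper face of the chord, capped off\<close>

locale chord_face = chord F d \<Delta> \<sigma> x y
  for F :: "'k::field itself" and d :: nat and \<Delta> :: "'a::linorder set set" and \<sigma> :: "'a set" and x y :: 'a +
  fixes s :: "'a set"
  assumes s: "s \<subset> \<sigma>" "s \<noteq> {}"
begin

definition \<rho> :: "'a set" where "\<rho> = \<sigma> - s"
definition m :: nat where "m = d - card s"

abbreviation L :: "'a set set" where "L \<equiv> lk \<Delta> s"
abbreviation S :: "'a set set" where "S \<equiv> lk (Bd F \<Delta>) s"
abbreviation T :: "bool \<Rightarrow> 'a set set" where "T b \<equiv> lk (half_bd b) s"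

lemma fins: "finite s" using s fin\<sigma> finite_subset by blast

lemma \<rho>: "\<rho> \<union> s = \<sigma>" "\<rho> \<inter> s = {}" "\<rho> \<noteq> {}" "finite \<rho>" "card \<rho> = m" "m + card s = d"
  using s fin\<sigma> \<sigma>(2) card_Diff_subset[OF fins, of \<sigma>] card_mono[OF fin\<sigma>, of s]
  by (auto simp: \<rho>_def m_def)

lemma LV: "L \<subseteq> Pow V"
  by (rule lk_V) simp

lemma SV: "S \<subseteq> Pow V"
  by (rule lk_V[OF Bd_sub])

lemma TV: "T b \<subseteq> Pow V"
  by (rule lk_V) (auto simp: half_bd_def intro: subsetD[OF half_subset])

lemma L_fin: "t \<in> L \<Longrightarrow> finite t"
  using LV V finite_subset by blast

lemma card_L: "t \<in> L \<Longrightarrow> card (t \<union> s) = card t + card s"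
  using L_fin fins by (subst card_Un_disjoint) (auto simp: lk_iff)

lemma S_L: "S \<subseteq> L" and T_L: "T b \<subseteq> L"
  by (auto simp: lk_iff half_bd_def intro: subsetD[OF Bd_sub] subsetD[OF half_subset])

lemma S_card: "t \<in> S \<Longrightarrow> card t \<le> m"
  using Bd_card_le[of "t \<union> s"] card_L[OF subsetD[OF S_L], of t] \<rho>(6) by (simp add: lk_iff)

lemma T_S: "t \<in> T b \<Longrightarrow> t \<noteq> \<rho> \<Longrightarrow> t \<in> S"
proof -
  assume t: "t \<in> T b" "t \<noteq> \<rho>"
  show "t \<in> S"
  proof (cases "t \<union> s \<subseteq> \<sigma>")
    case True
    have "t \<inter> s = {}" using t by (simp add: lk_iff)
    moreover have "t \<union> s \<noteq> \<sigma>" using t(2) calculation by (auto simp: \<rho>_def)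
    ultimately show ?thesis using proper_Bd[of "t \<union> s"] True by (auto simp: lk_iff)
  qed (use t in \<open>auto simp: lk_iff half_bd_def\<close>)
qed

lemma T_card: "t \<in> T b \<Longrightarrow> card t \<le> m"
  using T_S[of t b] S_card \<rho>(5) by (cases "t = \<rho>") auto

lemma S_T: "t \<in> S \<Longrightarrow> t \<union> s \<in> half b \<Longrightarrow> t \<in> T b"
  by (auto simp: lk_iff half_bd_def)

lemma pure_T: "t \<subseteq> \<rho> \<Longrightarrow> t \<in> T b"
  using half_pure[of "t \<union> s" b] \<rho> by (auto simp: lk_iff half_bd_def)

lemma sph_S: "sph F m S"
  unfolding m_def using Bd_sph[OF proper_Bd[OF s(1)] s(2)] .

lemma S_top: "c \<in> chains F S (Suc m) \<Longrightarrow> c = 0"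
  by (rule chains_top[of S "Suc m"]) (simp_all add: S_card less_Suc_eq_le)

lemma T_top: "c \<in> chains F (T b) (Suc m) \<Longrightarrow> c = 0"
  by (rule chains_top[of "T b" "Suc m"]) (simp_all add: T_card less_Suc_eq_le)

text \<open>The fundamental cycle of the boundary sphere bounds a chain with full support; cutting that chain
  along \<open>\<rho>\<close> leaves on each side a cycle through \<open>\<rho>\<close>.\<close>

lemma fundamental_chain:
  obtains g c where "g \<in> chains F S m"
    "\<And>h. h \<in> chains F S m \<Longrightarrow> D V h = 0 \<Longrightarrow> \<exists>a. h = cscale a g"
    "c \<in> chains F L (Suc m)" "D V c = g" "\<And>b. c (insert (tip b) \<rho>) \<noteq> 0"
proof -
  obtain g where g: "g \<in> chains F S m" "D V g = 0"
    and nb: "\<And>b. b \<in> chains F S (Suc m) \<Longrightarrow> g \<noteq> D V b"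
    and gen: "\<And>h. h \<in> chains F S m \<Longrightarrow> D V h = 0 \<Longrightarrow> \<exists>a. \<exists>b\<in>chains F S (Suc m). h - cscale a g = D V b"
    by (rule sph_gen[OF sph_S V SV], rule that)
  have g0: "g \<noteq> 0" using nb[OF chains_zero] by simp
  have gen': "\<exists>a. h = cscale a g" if h: "h \<in> chains F S m" "D V h = 0" for h
  proof -
    obtain a b where b: "b \<in> chains F S (Suc m)" "h - cscale a g = D V b" using gen[OF h] by blast
    have "b = 0" using b(1) by (rule S_top)
    then have "h = cscale a g" using b(2) by simp
    then show ?thesis ..
  qed
  have aL: "acyc F L" by (rule proper[OF s])
  obtain c where c: "c \<in> chains F L (Suc m)" "g = D V c"
    using acycD[OF aL V LV chains_mono[OF g(1) S_L] g(2)] .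
  have c0: "c \<noteq> 0" using c(2) g0 by auto
  have lkL: "lk L t = lk \<Delta> (t \<union> s)" if "t \<in> L" for t
    using lk_lk[of s t] that by (simp add: lk_iff Int_commute Un_commute)
  have sL: "scomplex L" using s scomplex_lk[OF \<Delta>] scomplex_subset[OF \<Delta> \<sigma>(1)] by auto
  \<comment> \<open>The boundary of \<open>c\<close> is \<open>g\<close>, carried by faces of
    \<open>S\<close>, and these have acyclic links in \<open>L\<close>. So \<open>c\<close> is a
    relative cycle as required by \<open>full_support\<close>.\<close>
  have "c (insert (tip b) \<rho>) \<noteq> 0" for b
  proof (rule full_support[OF V sL LV _ _ c(1) _ c0])
    show "card t \<le> Suc m" if "t \<in> L" for t
      using \<Delta>_card[of "t \<union> s"] card_L[OF that] that \<rho>(6) by (simp add: lk_iff)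
    show "lk_ok F (Suc m) L t" if t: "t \<in> L" for t
    proof -
      have "Suc d - card (t \<union> s) = Suc m - card t" using card_L[OF t] \<rho>(6) by simp
      then show ?thesis using \<Delta>_ok[of "t \<union> s"] t s(2) lkL[OF t] by (simp add: lk_ok_def lk_iff)
    qed
    show "acyc F (lk L t)" if "D V c t \<noteq> 0" for t
    proof -
      have "t \<in> S" using that g(1) c(2) by (auto simp: chains_iff)
      then have "t \<union> s \<in> Bd F \<Delta>" "t \<in> L" using subsetD[OF S_L] by (simp_all only: lk_iff)
      then show ?thesis using s(2) lkL by (auto simp: Bd_def)
    qed
    have tn: "tip b \<notin> \<rho>" "tip b \<notin> s" using tip(1)[of b] s(1) by (auto simp: \<rho>_def)
    show "insert (tip b) \<rho> \<in> L" using tn tip(2)[of b] \<rho> by (simp add: lk_iff)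
    show "card (insert (tip b) \<rho>) = Suc m" using tn \<rho> by simp
  qed
  then show ?thesis using that[of g c] g(1) gen' c by metis
qed

text \<open>As \<open>s\<close> meets \<open>\<sigma>\<close>, one vertex of \<open>t\<close> off
  \<open>\<sigma>\<close> already decides the side, and a larger face keeps it. Hence cutting a
  chain by sides does not alter its boundary on faces that leave \<open>\<sigma>\<close>.\<close>

lemma half_insert:
  assumes t: "\<not> t \<subseteq> \<sigma>" and L: "insert v t \<in> L"
  shows "insert v t \<union> s \<in> half b \<longleftrightarrow> t \<union> s \<in> half b"
proof -
  obtain u where u: "u \<in> t" "u \<notin> \<sigma>" using t by blast
  obtain z where z: "z \<in> s" using s by blast
  have L': "insert v t \<union> s \<in> \<Delta>" using L by (simp add: lk_iff)
  have "t \<union> s \<in> \<Delta>" using scomplex_subset[OF \<Delta> L', of "t \<union> s"] by blast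
  then show ?thesis using half_iff[OF L', of z u b] half_iff[of "t \<union> s" z u b] u z s(1) by blast
qed

text \<open>In top degree a cycle of the capped half is determined by its coefficient at
  \<open>\<rho>\<close>, and the boundary \<open>G b\<close> of the part of \<open>c\<close> on side
  \<open>b\<close> has a nonzero one. In lower degrees a filling in the sphere \<open>S\<close> is
  pushed into the half through the simplex on \<open>\<rho>\<close>.\<close>

lemma half_bd_sphere: "sph F m (T b)"
proof -
  obtain g c where g: "g \<in> chains F S m"
    and gen: "\<And>h. h \<in> chains F S m \<Longrightarrow> D V h = 0 \<Longrightarrow> \<exists>a. h = cscale a g"
    and c: "c \<in> chains F L (Suc m)" "D V c = g" and tipc: "\<And>b. c (insert (tip b) \<rho>) \<noteq> 0"
    by (rule fundamental_chain, rule that)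
  define cut where "cut b = restr (\<lambda>t. t \<union> s \<in> half b) c" for b
  define G where "G b = D V (cut b)" for b
  have cut: "cut b \<in> chains F (lk (half b) s) (Suc m)" for b
    using restr_chains[OF c(1)] unfolding cut_def by (rule chains_mono) (auto simp: lk_iff)
  have lk_down: "t' \<in> lk (half b) s" if "t \<in> lk (half b) s" "t' \<subseteq> t" for t t' b
    using that half_down[of "t \<union> s" b "t' \<union> s"] by (auto simp: lk_iff)
  have G: "G b \<in> chains F (lk (half b) s) m" for b
    unfolding G_def using D_chains[OF cut] lk_down by blast
  have DG: "D V (G b) = 0" for b
    unfolding G_def by (rule D_D[OF V chains_onD[OF cut lk_half_V]])
  have G_off: "G b t = g t" if t: "\<not> t \<subseteq> \<sigma>" "G b t \<noteq> 0" for b t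
  proof -
    have tb: "t \<union> s \<in> half b" using G[of b] t(2) by (auto simp: chains_iff lk_iff)
    have "cut b (insert v t) = c (insert v t)" for v
    proof (cases "insert v t \<in> L")
      case True
      then show ?thesis using half_insert[OF t(1) True] tb by (simp add: cut_def restr_def)
    next
      case False
      then have "c (insert v t) = 0" using c(1) by (auto simp: chains_iff)
      then show ?thesis by (simp add: cut_def restr_def)
    qed
    then show ?thesis unfolding G_def c(2)[symmetric] by (simp add: D_def)
  qed
  \<comment> \<open>On side \<open>b\<close>, only \<open>insert (tip b) \<rho>\<close> contributes
    to the boundary at \<open>\<rho>\<close>, so nothing can cancel.\<close>
  have G_\<rho>: "G b \<rho> \<noteq> 0" for b
  proof -
    have "cut b (insert v \<rho>) = (if v = tip b then c (insert v \<rho>) else 0)" if "v \<notin> \<rho>" for v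
    proof -
      have "insert v \<rho> \<union> s = insert v \<sigma>" using \<rho>(1) by blast
      moreover have "v \<notin> s" if "c (insert v \<rho>) \<noteq> 0" using c(1) that by (auto simp: chains_iff lk_iff)
      ultimately show ?thesis
        using insert_half_iff[of v b] that \<rho>(1) by (auto simp: cut_def restr_def)
    qed
    then have "G b \<rho> = (\<Sum>v\<in>V - \<rho>. if v = tip b then osign v \<rho> * c (insert v \<rho>) else 0)"
      unfolding G_def D_def by (intro sum.cong) auto
    moreover have "tip b \<in> V - \<rho>" using tip(1-3)[of b] by (auto simp: \<rho>_def)
    ultimately show ?thesis using V tipc[of b] by simp
  qed
  have G_cases: "t = \<rho> \<or> \<not> t \<subseteq> \<sigma> \<and> t \<in> S \<and> t \<union> s \<in> half b" if "G b t \<noteq> 0" for b t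
  proof -
    have t: "t \<inter> s = {}" "t \<union> s \<in> half b" "card t = m" using G[of b] that by (auto simp: chains_iff lk_iff)
    show ?thesis
    proof (cases "t \<subseteq> \<sigma>")
      case True
      then have "t \<subseteq> \<rho>" using t(1) by (auto simp: \<rho>_def)
      then show ?thesis using card_subset_eq[OF \<rho>(4)] t(3) \<rho>(5) by simp
    next
      case False
      then have "g t \<noteq> 0" using G_off[OF False that] that by simp
      then show ?thesis using False t g by (auto simp: chains_iff)
    qed
  qed
  have GT: "G b \<in> chains F (T b) m" for b
    unfolding chains_iff
  proof (intro allI impI conjI)
    fix t assume "G b t \<noteq> 0"
    then show "t \<in> T b" using G_cases[of b t] S_T pure_T[of \<rho> b] by auto
    show "card t = m" using G[of b] \<open>G b t \<noteq> 0\<close> by (auto simp: chains_iff)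
  qed
  \<comment> \<open>Off the cap, \<open>h\<close> is a cycle of \<open>S\<close> and hence a
    multiple of \<open>g\<close>. If the multiple were nonzero, \<open>g\<close> would live on side
    \<open>b\<close>, leaving \<open>G (\<not> b)\<close> supported on \<open>\<rho>\<close> alone;
    but a single nonempty simplex is not a cycle.\<close>
  have off_\<rho>: "h = 0" if h: "h \<in> chains F (T b) m" "D V h = 0" "h \<rho> = 0" for h b
  proof -
    have "h \<in> chains F S m"
      unfolding chains_iff
    proof (intro allI impI conjI)
      fix t assume nz: "h t \<noteq> 0"
      then show "t \<in> S" using h T_S[of t b] by (auto simp: chains_iff)
      show "card t = m" using h(1) nz by (auto simp: chains_iff)
    qed
    then obtain a where a: "h = cscale a g" using gen h(2) by blast
    show ?thesis
    proof (cases "a = 0")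
      case True
      then show ?thesis using a by (simp add: cscale_def fun_eq_iff)
    next
      case False
      have only: "G (\<not> b) t = 0" if "t \<noteq> \<rho>" for t
      proof (rule ccontr)
        assume nz: "G (\<not> b) t \<noteq> 0"
        then have t: "\<not> t \<subseteq> \<sigma>" "t \<in> S" "t \<union> s \<in> half (\<not> b)" using G_cases that by blast+
        then have "g t \<noteq> 0" using G_off nz by metis
        then have "h t \<noteq> 0" using a False by (simp add: cscale_def)
        then have "t \<in> T b" using h(1) by (auto simp: chains_iff)
        then have "t \<union> s \<in> half b" by (auto simp: lk_iff half_bd_def)
        moreover obtain u where "u \<in> t" "u \<notin> \<sigma>" using t by blast
        moreover obtain z where "z \<in> s" using s by blast
        ultimately show False using t(3) s(1) unfolding half_def one_sided_def by blast
      qed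
      obtain w where w: "w \<in> \<rho>" using \<rho>(3) by blast
      have wV: "w \<in> V" using w \<sigma>V by (auto simp: \<rho>_def)
      have "D V (G (\<not> b)) (\<rho> - {w}) = (\<Sum>v\<in>V - (\<rho> - {w}). if v = w then osign w (\<rho> - {w}) * G (\<not> b) \<rho> else 0)"
        unfolding D_def
      proof (rule sum.cong[OF refl])
        fix v assume v: "v \<in> V - (\<rho> - {w})"
        show "osign v (\<rho> - {w}) * G (\<not> b) (insert v (\<rho> - {w})) = (if v = w then osign w (\<rho> - {w}) * G (\<not> b) \<rho> else 0)"
        proof (cases "v = w")
          case True
          then show ?thesis using w by (simp add: insert_absorb)
        next
          case False
          then have "w \<notin> insert v (\<rho> - {w})" by simp
          then have "insert v (\<rho> - {w}) \<noteq> \<rho>" using w by metis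
          then show ?thesis using False only by simp
        qed
      qed
      also have "\<dots> \<noteq> 0" using V wV G_\<rho> by simp
      finally show ?thesis using DG[of "\<not> b"] by simp
    qed
  qed
  have low: "\<exists>b'\<in>chains F (T b) (Suc k). h = D V b'"
    if k: "k \<noteq> m" and h: "h \<in> chains F (T b) k" "D V h = 0" for k h
  proof (cases "k < m")
    case False
    then have "m < k" using k by simp
    then have "h = 0" by (intro chains_top[OF _ h(1)] le_less_trans[OF T_card])
    then show ?thesis by (intro bexI[of _ 0] chains_zero) simp
  next
    case True
    define Ky Kx where "Ky = {t \<in> S. t \<union> s \<in> half b}" and "Kx = {t \<in> S. t \<union> s \<in> half (\<not> b)}"
    have SK: "S = Kx \<union> Ky"
      using half_cover[of "_ \<union> s" b] subsetD[OF Bd_sub] by (fastforce simp: Kx_def Ky_def lk_iff)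
    \<comment> \<open>Below degree \<open>m\<close> the cap \<open>\<rho>\<close> carries no
      coefficient, so \<open>h\<close> is already a cycle of the sphere \<open>S\<close>.\<close>
    have hS: "t \<in> S" "t \<union> s \<in> half b" "card t = k" if nz: "h t \<noteq> 0" for t
    proof -
      have t: "t \<in> T b" "card t = k" using h(1) nz by (auto simp: chains_iff)
      moreover have "t \<noteq> \<rho>" using t(2) \<rho>(5) True by auto
      ultimately show "t \<in> S" using T_S by blast
      show "t \<union> s \<in> half b" "card t = k" using t by (auto simp: lk_iff half_bd_def)
    qed
    have "h \<in> chains F S k" using hS by (auto simp: chains_iff)
    then obtain e where e: "e \<in> chains F S (Suc k)" "h = D V e"
      using sph_cycle[OF sph_S V SV k _ h(2)] by blast
    have S_down: "t' \<in> S" if "t \<in> S" "t' \<subseteq> t" for t t'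
      using that Bd_down[of "t \<union> s" "t' \<union> s"] by (auto simp: lk_iff)
    have h_down: "t' \<union> s \<in> half b'" if "t \<union> s \<in> half b'" "t' \<subseteq> t" for t t' b'
    proof -
      have "t' \<union> s \<subseteq> t \<union> s" using that(2) by blast
      then show ?thesis by (rule half_down[OF that(1)])
    qed
    have int: "Kx \<inter> Ky \<subseteq> Pow \<rho>"
    proof
      fix t assume "t \<in> Kx \<inter> Ky"
      then have t: "t \<union> s \<in> half b" "t \<union> s \<in> half (\<not> b)" "t \<inter> s = {}" by (auto simp: Kx_def Ky_def lk_iff)
      obtain z where z: "z \<in> s" using s by blast
      have "u \<in> \<sigma>" if "u \<in> t" for u
      proof (rule ccontr)
        assume "u \<notin> \<sigma>"
        then have "side z u = b" "side z u = (\<not> b)"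
          using t that z s(1) unfolding half_def one_sided_def by blast+
        then show False by simp
      qed
      then show "t \<in> Pow \<rho>" using t(3) by (auto simp: \<rho>_def)
    qed
    obtain e' where e': "e' \<in> chains F (Ky \<union> Pow \<rho>) (Suc k)" "D V e' = D V e"
    proof (rule boundary_push[OF V _ _ acyc_Pow[OF \<rho>(4,3), of F] int, of e k])
      show "Pow \<rho> \<subseteq> Pow V" using \<sigma>V by (auto simp: \<rho>_def)
      show "Kx \<union> Ky \<subseteq> Pow V" using SK SV by simp
      show "e \<in> chains F (Kx \<union> Ky) (Suc k)" using e(1) SK by simp
      show "D V e \<in> chains F Ky k" unfolding e(2)[symmetric] using hS by (auto simp: chains_iff Ky_def)
      show "t \<in> Kx" if "s' \<in> Kx" "t \<subseteq> s'" for s' t using S_down h_down that unfolding Kx_def by blast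
      show "t \<in> Ky" if "s' \<in> Ky" "t \<subseteq> s'" for s' t using S_down h_down that unfolding Ky_def by blast
    qed (rule that)
    have "Ky \<union> Pow \<rho> \<subseteq> T b" using S_T pure_T by (auto simp: Ky_def)
    then have "e' \<in> chains F (T b) (Suc k)" by (rule chains_mono[OF e'(1)])
    then show ?thesis using e'(2) e(2) by metis
  qed
  have top: "\<exists>a. \<exists>b'\<in>chains F (T b) (Suc m). h - cscale a (G b) = D V b'"
    if h: "h \<in> chains F (T b) m" "D V h = 0" for h
  proof -
    define a where "a = h \<rho> / G b \<rho>"
    have "h - cscale a (G b) = 0"
    proof (rule off_\<rho>)
      show "h - cscale a (G b) \<in> chains F (T b) m" by (intro chains_diff chains_scale h(1) GT)
      show "D V (h - cscale a (G b)) = 0" by (simp add: D_diff D_scale h(2) DG cs.scale_zero_right)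
      show "(h - cscale a (G b)) \<rho> = 0" using G_\<rho>[of b] by (simp add: cscale_def a_def)
    qed
    then show ?thesis by (intro exI[of _ a] bexI[of _ 0] chains_zero) simp
  qed
  have nonb: "G b \<noteq> D V b'" if "b' \<in> chains F (T b) (Suc m)" for b'
    using T_top[OF that] G_\<rho>[of b] by auto
  show ?thesis
    unfolding sph_iff_D[OF V TV]
    by (rule conjI, intro allI impI ballI low, assumption+, rule bexI[OF _ GT])
      (intro conjI ballI impI DG nonb top)
qed

end

lemma (in chord) half_bd_sphere_face:
  assumes "s \<subseteq> \<sigma>" "s \<noteq> {}"
  shows "sph F (d - card s) (lk (half_bd b) s)"
proof (cases "s = \<sigma>")
  case True
  then show ?thesis using half_bd_top sph_0_empty \<sigma>(2) by simp
next
  case False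
  then interpret chord_face F d \<Delta> \<sigma> x y s
    using assms by unfold_locales auto
  show ?thesis using half_bd_sphere by (simp add: m_def)
qed

section \<open>Handle deletion\<close>

locale chord_handle = chord F d \<Delta> \<sigma> x y
  for F :: "'k::field itself" and d :: nat and \<Delta> :: "'a::linorder set set" and \<sigma> :: "'a set" and x y :: 'a +
  fixes p :: "'a \<Rightarrow> 'a"
  assumes p: "inj_on p \<sigma>" and p_new: "p ` \<sigma> \<inter> V = {}"
begin

definition plus :: "'a \<Rightarrow> 'a" where
  "plus v = (if v \<in> \<sigma> then p v else v)"

text \<open>The decision is made for each \<open>v\<close> in \<open>\<sigma>\<close> separately,
  since \<open>u\<close> may be on different sides of two vertices of \<open>\<sigma>\<close> that
  share no face with it. On a single face through \<open>u\<close> it agrees with either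
  \<open>plus\<close> or the identity.\<close>

definition relabel :: "'a \<Rightarrow> 'a \<Rightarrow> 'a" where
  "relabel u v = (if v \<in> \<sigma> \<and> side v u then p v else v)"

abbreviation \<Gamma> :: "'a set set" where "\<Gamma> \<equiv> handle_deletion \<Delta> \<sigma> x p"

lemma inj_plus: "inj_on plus V" and inj_relabel: "inj_on (relabel u) V"
  using p p_new unfolding inj_on_def plus_def relabel_def by (auto split: if_splits)

lemma plus_face_eq: "plus_face \<sigma> p \<alpha> = plus ` \<alpha>"
  by (auto simp: plus_face_def plus_def image_iff split: if_splits)

lemma xcomponent_iff:
  assumes z: "z \<in> \<sigma>" "z \<in> \<alpha>" and \<alpha>: "\<alpha> \<in> \<Delta>"
  shows "\<alpha> - {z} \<in> xcomponent (lk \<Delta> {z}) (\<sigma> - {z}) x \<longleftrightarrow> (\<forall>u\<in>\<alpha> - \<sigma>. side z u)"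
proof -
  have "induced (lk \<Delta> {z}) (vert (lk \<Delta> {z}) - (\<sigma> - {z})) = lkr {z} {}"
    unfolding induced_def lkr_def vert_def using z(1) by (auto simp: lk_iff)
  moreover have "\<alpha> - {z} \<in> lk \<Delta> {z}" using z \<alpha> by (simp add: lk_iff insert_absorb)
  ultimately show ?thesis
    using z(1) unfolding xcomponent_def side_def induced_def[of _ "_ \<union> _"] by auto
qed

lemma Xset_iff: "\<alpha> \<in> Xset \<Delta> \<sigma> x \<longleftrightarrow> \<alpha> \<in> half True \<and> \<alpha> \<inter> \<sigma> \<noteq> {} \<and> \<not> \<alpha> \<subseteq> \<sigma>"
proof (cases "\<alpha> \<in> \<Delta> \<and> \<alpha> \<inter> \<sigma> \<noteq> {} \<and> \<not> \<alpha> \<subseteq> \<sigma>")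
  case True
  then obtain u where u: "u \<in> \<alpha> - \<sigma>" by blast
  have "\<alpha> \<in> Xset \<Delta> \<sigma> x \<longleftrightarrow> (\<exists>z\<in>\<alpha> \<inter> \<sigma>. \<forall>u\<in>\<alpha> - \<sigma>. side z u)"
    using True xcomponent_iff[of _ \<alpha>] unfolding Xset_def Rx_def Rset_def by blast
  also have "\<dots> \<longleftrightarrow> \<alpha> \<in> half True"
    using True u half_iff[of \<alpha> _ u True] half_iff[of \<alpha> _ _ True] by blast
  finally show ?thesis using True by blast
next
  case False
  then have "\<alpha> \<notin> Xset \<Delta> \<sigma> x" unfolding Xset_def Rx_def Rset_def by blast
  then show ?thesis using False half_subset by blast
qed

text \<open>Faces disjoint from \<open>\<sigma>\<close> lie in both halves and are fixed by
  \<open>plus\<close>; faces inside \<open>\<sigma>\<close> lie in both and are doubled. This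
  accounts for the asymmetric original definition, where the added simplex supplies the second
  copy.\<close>

lemma \<Gamma>_eq: "\<Gamma> = half False \<union> (`) plus ` half True"
proof (intro equalityI subsetI)
  fix \<gamma> assume "\<gamma> \<in> \<Gamma>"
  then consider "\<gamma> \<in> \<Delta>" "\<gamma> \<notin> Xset \<Delta> \<sigma> x" | "\<gamma> \<in> (`) plus ` Xset \<Delta> \<sigma> x" | "\<gamma> \<subseteq> p ` \<sigma>"
    unfolding handle_deletion_def closure_of_face_def by (auto simp: plus_face_eq)
  then show "\<gamma> \<in> half False \<union> (`) plus ` half True"
  proof cases
    case 1
    show ?thesis
    proof (cases "\<gamma> \<in> half True")
      case True
      then have "\<gamma> \<inter> \<sigma> = {} \<or> \<gamma> \<subseteq> \<sigma>" using 1 Xset_iff by blast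
      then have "\<gamma> \<in> half False" using 1(1) half_pure by (auto simp: half_def one_sided_def)
      then show ?thesis by blast
    qed (use half_cover[OF 1(1), of True] in simp)
  next
    case 2
    then show ?thesis using Xset_iff by blast
  next
    case 3
    then obtain s where s: "s \<subseteq> \<sigma>" "\<gamma> = p ` s" by (meson subset_imageE)
    then have "\<gamma> = plus ` s" by (force simp: plus_def image_iff)
    then show ?thesis using half_pure[OF s(1)] by blast
  qed
next
  fix \<gamma> assume "\<gamma> \<in> half False \<union> (`) plus ` half True"
  then consider "\<gamma> \<in> half False" | \<alpha> where "\<alpha> \<in> half True" "\<gamma> = plus ` \<alpha>" by blast
  then show "\<gamma> \<in> \<Gamma>"
  proof cases
    case 1
    have "\<gamma> \<notin> Xset \<Delta> \<sigma> x"
    proof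
      assume "\<gamma> \<in> Xset \<Delta> \<sigma> x"
      then have "\<gamma> \<in> half True" "\<gamma> \<inter> \<sigma> \<noteq> {}" "\<not> \<gamma> \<subseteq> \<sigma>" using Xset_iff by blast+
      then show False using 1 unfolding half_def one_sided_def by blast
    qed
    then show ?thesis using 1 half_subset unfolding handle_deletion_def by blast
  next
    case 2
    consider "\<alpha> \<inter> \<sigma> = {}" | "\<alpha> \<subseteq> \<sigma>" | "\<alpha> \<in> Xset \<Delta> \<sigma> x" using 2 Xset_iff by blast
    then show ?thesis
    proof cases
      case 1
      then have "plus ` \<alpha> = \<alpha>" by (force simp: plus_def image_iff)
      moreover have "\<alpha> \<notin> Xset \<Delta> \<sigma> x" using 1 Xset_iff by blast
      moreover have "\<alpha> \<in> \<Delta>" by (rule subsetD[OF half_subset 2(1)])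
      ultimately show ?thesis using 2(2) unfolding handle_deletion_def by simp
    next
      case pure: 2
      then have "plus ` \<alpha> \<subseteq> p ` \<sigma>" by (auto simp: plus_def)
      then show ?thesis using 2(2) unfolding handle_deletion_def closure_of_face_def by blast
    next
      case 3
      then show ?thesis using 2(2) plus_face_eq unfolding handle_deletion_def by blast
    qed
  qed
qed

section \<open>Stars, links and boundary of the handle deletion\<close>

lemma half_V: "\<alpha> \<in> half b \<Longrightarrow> \<alpha> \<subseteq> V"
  using half_subset \<Delta>V by blast

lemma plus_not_\<sigma>: "v \<in> V \<Longrightarrow> plus v \<notin> \<sigma>"
  using p_new \<sigma>V by (auto simp: plus_def)

lemma plus_old: "v \<in> V \<Longrightarrow> u \<in> V \<Longrightarrow> u \<notin> \<sigma> \<Longrightarrow> plus v = u \<longleftrightarrow> v = u"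
  using p_new by (auto simp: plus_def)

lemma relabel_half:
  assumes "\<alpha> \<in> half b" "u \<in> \<alpha> - \<sigma>"
  shows "relabel u ` \<alpha> = (if b then plus ` \<alpha> else \<alpha>)"
proof -
  have "relabel u v = (if b then plus v else v)" if "v \<in> \<alpha>" for v
    using assms that unfolding half_def one_sided_def relabel_def plus_def by auto
  then show ?thesis by (cases b) (force simp: image_iff)+
qed

lemma star_old:
  assumes u: "u \<in> V" "u \<notin> \<sigma>"
  shows "{\<gamma> \<in> \<Gamma>. u \<in> \<gamma>} = (`) (relabel u) ` {\<alpha> \<in> \<Delta>. u \<in> \<alpha>}"
proof (intro equalityI subsetI)
  fix \<gamma> assume "\<gamma> \<in> {\<gamma> \<in> \<Gamma>. u \<in> \<gamma>}"
  then consider "\<gamma> \<in> half False" "u \<in> \<gamma>" | \<alpha> where "\<alpha> \<in> half True" "\<gamma> = plus ` \<alpha>" "u \<in> plus ` \<alpha>"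
    unfolding \<Gamma>_eq by blast
  then show "\<gamma> \<in> (`) (relabel u) ` {\<alpha> \<in> \<Delta>. u \<in> \<alpha>}"
  proof cases
    case 1
    then have "relabel u ` \<gamma> = \<gamma>" "\<gamma> \<in> \<Delta>" using relabel_half[of \<gamma> False u] u half_subset by auto
    then show ?thesis using 1(2) by blast
  next
    case 2
    then obtain w where w: "w \<in> \<alpha>" "plus w = u" by blast
    then have "w = u" using plus_old[of w u] u half_V[OF 2(1)] by blast
    then have "u \<in> \<alpha>" using w by simp
    moreover from this have "relabel u ` \<alpha> = \<gamma>" using 2 relabel_half[of \<alpha> True u] u by simp
    moreover have "\<alpha> \<in> \<Delta>" by (rule subsetD[OF half_subset 2(1)])
    ultimately show ?thesis by blast
  qed
next
  fix \<gamma> assume "\<gamma> \<in> (`) (relabel u) ` {\<alpha> \<in> \<Delta>. u \<in> \<alpha>}"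
  then obtain \<alpha> where \<alpha>: "\<alpha> \<in> \<Delta>" "u \<in> \<alpha>" "\<gamma> = relabel u ` \<alpha>" by blast
  have "relabel u u = u" using u by (simp add: relabel_def)
  then have "u \<in> \<gamma>" using \<alpha> by force
  moreover have "\<gamma> \<in> \<Gamma>"
    using half_cover[OF \<alpha>(1), of True] relabel_half[of \<alpha> _ u] \<alpha> u unfolding \<Gamma>_eq by auto
  ultimately show "\<gamma> \<in> {\<gamma> \<in> \<Gamma>. u \<in> \<gamma>}" by blast
qed

lemma star_\<sigma>: "z \<in> \<sigma> \<Longrightarrow> {\<gamma> \<in> \<Gamma>. z \<in> \<gamma>} = {\<alpha> \<in> half False. z \<in> \<alpha>}"
  unfolding \<Gamma>_eq using plus_not_\<sigma> half_V by blast

lemma star_plus: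
  assumes z: "z \<in> \<sigma>"
  shows "{\<gamma> \<in> \<Gamma>. plus z \<in> \<gamma>} = (`) plus ` {\<alpha> \<in> half True. z \<in> \<alpha>}"
proof -
  have zV: "z \<in> V" using z \<sigma>V by blast
  have "plus z \<notin> V" using z p_new by (auto simp: plus_def)
  then have "plus z \<notin> \<alpha>" if "\<alpha> \<in> half False" for \<alpha> using half_V[OF that] by blast
  moreover have "plus z \<in> plus ` \<alpha> \<longleftrightarrow> z \<in> \<alpha>" if "\<alpha> \<in> half True" for \<alpha>
    by (rule inj_on_image_mem_iff[OF inj_plus zV half_V[OF that]])
  ultimately show ?thesis unfolding \<Gamma>_eq by blast
qed

text \<open>A face with an old vertex off \<open>\<sigma>\<close> is controlled by the star of that
  vertex; any other one lies inside \<open>\<sigma>\<close> or inside its copy. Each case has its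
  own link computation.\<close>

lemma \<Gamma>_cases:
  assumes "\<gamma> \<in> \<Gamma>" "\<gamma> \<noteq> {}"
  obtains (old) u \<alpha> where "u \<in> V" "u \<notin> \<sigma>" "u \<in> \<gamma>" "\<alpha> \<in> \<Delta>" "u \<in> \<alpha>" "\<gamma> = relabel u ` \<alpha>"
  | (\<sigma>) "\<gamma> \<subseteq> \<sigma>" | (plus) s where "s \<subseteq> \<sigma>" "s \<noteq> {}" "\<gamma> = plus ` s"
proof (cases "\<exists>u\<in>\<gamma>. u \<in> V \<and> u \<notin> \<sigma>")
  case True
  then obtain u where u: "u \<in> \<gamma>" "u \<in> V" "u \<notin> \<sigma>" by blast
  then have "\<gamma> \<in> (`) (relabel u) ` {\<alpha> \<in> \<Delta>. u \<in> \<alpha>}" using star_old[of u] assms by blast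
  then show ?thesis using old u by blast
next
  case False
  consider "\<gamma> \<in> half False" | \<alpha> where "\<alpha> \<in> half True" "\<gamma> = plus ` \<alpha>" using assms \<Gamma>_eq by blast
  then show ?thesis
  proof cases
    case 1
    then show ?thesis using half_V False \<sigma> by blast
  next
    case 2
    have "\<alpha> \<subseteq> \<sigma>"
    proof
      fix v assume v: "v \<in> \<alpha>"
      show "v \<in> \<sigma>"
      proof (rule ccontr)
        assume "v \<notin> \<sigma>"
        then have "v \<in> \<gamma>" using v 2 by (force simp: plus_def)
        then show False using False v \<open>v \<notin> \<sigma>\<close> half_V[OF 2(1)] by blast
      qed
    qed
    then show ?thesis using plus 2 assms(2) by blast
  qed
qed

lemma lk_old:
  assumes u: "u \<notin> \<sigma>" "u \<in> \<tau>" "\<tau> \<in> \<Delta>"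
  shows "lk \<Gamma> (relabel u ` \<tau>) = (`) (relabel u) ` lk \<Delta> \<tau>"
proof (rule lk_image[OF inj_relabel \<Delta>V])
  have "u \<in> V" using u \<Delta>V by blast
  moreover have "relabel u u = u" using u by (simp add: relabel_def)
  ultimately show "{\<gamma> \<in> \<Gamma>. relabel u u \<in> \<gamma>} = (`) (relabel u) ` {\<alpha> \<in> \<Delta>. u \<in> \<alpha>}"
    using star_old u(1) by simp
qed (use u \<Delta>V in auto)

lemma lk_\<sigma>_face:
  assumes s: "s \<subseteq> \<sigma>" "s \<noteq> {}"
  shows "lk \<Gamma> s = lk (half False) s"
proof -
  obtain z where "z \<in> s" using s by blast
  then show ?thesis using star_\<sigma>[of z] s(1) by (intro set_eqI) (simp add: lk_iff, blast)
qed

lemma lk_plus_face: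
  assumes s: "s \<subseteq> \<sigma>" "s \<noteq> {}"
  shows "lk \<Gamma> (plus ` s) = (`) plus ` lk (half True) s"
proof -
  obtain z where z: "z \<in> s" using s by blast
  have h: "half True \<subseteq> Pow V" using half_V by blast
  show ?thesis using lk_image[OF inj_plus h star_plus z] z s(1) \<sigma>V by blast
qed

lemma scomplex_\<Gamma>: "scomplex \<Gamma>"
  unfolding scomplex_def
proof (intro conjI ballI allI impI)
  have "finite \<Delta>" using \<Delta> by (simp add: scomplex_def)
  then have "finite (half b)" for b using finite_subset[OF half_subset] by blast
  then show "finite \<Gamma>" unfolding \<Gamma>_eq by simp
  show "{} \<in> \<Gamma>" unfolding \<Gamma>_eq using half_pure[of "{}"] by blast
  fix \<gamma> assume \<gamma>: "\<gamma> \<in> \<Gamma>"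
  show "finite \<gamma>" using \<gamma> half_subset scomplex_face_finite[OF \<Delta>] unfolding \<Gamma>_eq by blast
  fix t assume t: "t \<subseteq> \<gamma>"
  consider "\<gamma> \<in> half False" | \<alpha> where "\<alpha> \<in> half True" "\<gamma> = plus ` \<alpha>" using \<gamma> \<Gamma>_eq by blast
  then show "t \<in> \<Gamma>"
  proof cases
    case 1
    then show ?thesis using half_down[OF 1 t] \<Gamma>_eq by blast
  next
    case 2
    then obtain \<beta> where "\<beta> \<subseteq> \<alpha>" "t = plus ` \<beta>" using t by (meson subset_imageE)
    then show ?thesis using half_down[OF 2(1)] \<Gamma>_eq by blast
  qed
qed

lemma \<Gamma>_card: "\<gamma> \<in> \<Gamma> \<Longrightarrow> card \<gamma> \<le> Suc d"
proof -
  assume "\<gamma> \<in> \<Gamma>"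
  then consider "\<gamma> \<in> half False" | \<alpha> where "\<alpha> \<in> half True" "\<gamma> = plus ` \<alpha>" using \<Gamma>_eq by blast
  then show ?thesis
  proof cases
    case 1
    then show ?thesis using \<Delta>_card half_subset by blast
  next
    case 2
    have "card (plus ` \<alpha>) = card \<alpha>" by (rule card_image[OF inj_on_subset[OF inj_plus half_V[OF 2(1)]]])
    then show ?thesis using \<Delta>_card[of \<alpha>] 2 half_subset by auto
  qed
qed

lemma relabel_card: "\<tau> \<in> \<Delta> \<Longrightarrow> card (relabel u ` \<tau>) = card \<tau>"
  using \<Delta>V by (intro card_image inj_on_subset[OF inj_relabel]) blast

lemma plus_card: "s \<subseteq> \<sigma> \<Longrightarrow> card (plus ` s) = card s"
  using \<sigma>V by (intro card_image inj_on_subset[OF inj_plus]) blast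

lemma acyc_\<sigma>_face: "s \<subseteq> \<sigma> \<Longrightarrow> s \<noteq> {} \<Longrightarrow> acyc F (lk \<Gamma> s)"
  using lk_\<sigma>_face acyc_half by simp

lemma acyc_plus_face: "s \<subseteq> \<sigma> \<Longrightarrow> s \<noteq> {} \<Longrightarrow> acyc F (lk \<Gamma> (plus ` s))"
  using lk_plus_face acyc_image[OF inj_plus V lk_half_V acyc_half] by simp

lemma acyc_old:
  assumes "u \<notin> \<sigma>" "u \<in> \<tau>" "\<tau> \<in> \<Delta>" "acyc F (lk \<Delta> \<tau>)"
  shows "acyc F (lk \<Gamma> (relabel u ` \<tau>))"
  unfolding lk_old[OF assms(1-3)]
  by (rule acyc_image[OF inj_relabel V lk_V[OF order_refl] assms(4)])

lemma sph_old:
  assumes "u \<notin> \<sigma>" "u \<in> \<tau>" "\<tau> \<in> \<Delta>" "sph F n (lk \<Delta> \<tau>)"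
  shows "sph F n (lk \<Gamma> (relabel u ` \<tau>))"
  unfolding lk_old[OF assms(1-3)]
  by (rule sph_image[OF inj_relabel V lk_V[OF order_refl] assms(4)])

lemma \<Gamma>_ok:
  assumes "\<gamma> \<in> \<Gamma>" "\<gamma> \<noteq> {}"
  shows "lk_ok F (Suc d) \<Gamma> \<gamma>"
  using assms
proof (cases rule: \<Gamma>_cases)
  case (old u \<alpha>)
  have "lk_ok F (Suc d) \<Delta> \<alpha>" using \<Delta>_ok old by blast
  then show ?thesis
    unfolding lk_ok_def old(6) relabel_card[OF old(4)]
    using acyc_old[OF old(2,5,4)] sph_old[OF old(2,5,4)] by blast
qed (use acyc_\<sigma>_face acyc_plus_face assms in \<open>auto simp: lk_ok_def\<close>)

text \<open>The converse direction avoids inverting the relabelling: if the link in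
  \<open>\<Delta>\<close> were not acyclic it would be a sphere, and then so would its relabelled
  image.\<close>

lemma Bd_old:
  assumes "u \<notin> \<sigma>" "u \<in> \<tau>" "\<tau> \<in> \<Delta>"
  shows "relabel u ` \<tau> \<in> Bd F \<Gamma> \<longleftrightarrow> \<tau> \<in> Bd F \<Delta>"
proof
  assume "\<tau> \<in> Bd F \<Delta>"
  then have "acyc F (lk \<Delta> \<tau>)" using assms by (auto simp: Bd_def)
  moreover have "relabel u ` \<tau> \<in> \<Gamma>"
    using star_old[of u] assms \<Delta>V by blast
  ultimately show "relabel u ` \<tau> \<in> Bd F \<Gamma>" using acyc_old[OF assms] assms by (auto simp: Bd_def)
next
  assume "relabel u ` \<tau> \<in> Bd F \<Gamma>"
  then have "acyc F (lk \<Gamma> (relabel u ` \<tau>))" using assms by (auto simp: Bd_def)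
  then have "\<not> sph F (Suc d - card \<tau>) (lk \<Delta> \<tau>)" using sph_old[OF assms] not_acyc_sph by blast
  moreover have "\<tau> \<noteq> {}" using assms by blast
  ultimately have "acyc F (lk \<Delta> \<tau>)" using \<Delta>_ok[OF assms(3)] by (simp add: lk_ok_def)
  then show "\<tau> \<in> Bd F \<Delta>" using assms \<open>\<tau> \<noteq> {}\<close> by (simp add: Bd_def)
qed

lemma Bd_\<sigma>_face: "s \<subseteq> \<sigma> \<Longrightarrow> s \<in> Bd F \<Gamma>"
  using acyc_\<sigma>_face[of s] half_pure[of s False] unfolding Bd_def \<Gamma>_eq by blast

lemma Bd_plus_face: "s \<subseteq> \<sigma> \<Longrightarrow> plus ` s \<in> Bd F \<Gamma>"
  using acyc_plus_face[of s] half_pure[of s True] unfolding Bd_def by (auto simp: \<Gamma>_eq)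

lemma Bd_half:
  assumes "\<alpha> \<in> half b" "\<alpha> \<noteq> {}" "\<alpha> \<inter> \<sigma> \<noteq> {}"
  shows "(if b then plus ` \<alpha> else \<alpha>) \<in> Bd F \<Gamma> \<longleftrightarrow> \<alpha> \<in> half_bd b"
proof (cases "\<alpha> \<subseteq> \<sigma>")
  case True
  then show ?thesis using Bd_\<sigma>_face Bd_plus_face assms by (auto simp: half_bd_def)
next
  case False
  then obtain u where u: "u \<in> \<alpha> - \<sigma>" by blast
  then show ?thesis
    using Bd_old[of u \<alpha>] relabel_half[OF assms(1) u] assms(1) subsetD[OF half_subset assms(1)] False
    by (auto simp: half_bd_def)
qed

lemma Bd_\<Gamma>_sub: "Bd F \<Gamma> \<subseteq> \<Gamma>"
  using Bd_subset scomplex_\<Gamma> scomplex_empty by blast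

lemma lk_Bd_old:
  assumes u: "u \<notin> \<sigma>" "u \<in> \<tau>" "\<tau> \<in> \<Delta>"
  shows "lk (Bd F \<Gamma>) (relabel u ` \<tau>) = (`) (relabel u) ` lk (Bd F \<Delta>) \<tau>"
proof (rule lk_image[OF inj_relabel])
  show "Bd F \<Delta> \<subseteq> Pow V" using Bd_sub \<Delta>V by blast
  have uV: "u \<in> V" using u \<Delta>V by blast
  have ru: "relabel u u = u" using u by (simp add: relabel_def)
  show "{\<gamma> \<in> Bd F \<Gamma>. relabel u u \<in> \<gamma>} = (`) (relabel u) ` {\<alpha> \<in> Bd F \<Delta>. u \<in> \<alpha>}"
  proof (intro equalityI subsetI)
    fix \<gamma> assume "\<gamma> \<in> {\<gamma> \<in> Bd F \<Gamma>. relabel u u \<in> \<gamma>}"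
    then have \<gamma>: "\<gamma> \<in> Bd F \<Gamma>" "u \<in> \<gamma>" using ru by auto
    then have "\<gamma> \<in> {\<gamma> \<in> \<Gamma>. u \<in> \<gamma>}" using subsetD[OF Bd_\<Gamma>_sub] by simp
    then obtain \<alpha> where \<alpha>: "\<alpha> \<in> \<Delta>" "u \<in> \<alpha>" "\<gamma> = relabel u ` \<alpha>"
      unfolding star_old[OF uV u(1)] by blast
    then have "\<alpha> \<in> Bd F \<Delta>" using Bd_old[OF u(1) \<alpha>(2,1)] \<gamma> by simp
    then show "\<gamma> \<in> (`) (relabel u) ` {\<alpha> \<in> Bd F \<Delta>. u \<in> \<alpha>}" using \<alpha> by blast
  next
    fix \<gamma> assume "\<gamma> \<in> (`) (relabel u) ` {\<alpha> \<in> Bd F \<Delta>. u \<in> \<alpha>}"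
    then obtain \<alpha> where \<alpha>: "\<alpha> \<in> Bd F \<Delta>" "u \<in> \<alpha>" "\<gamma> = relabel u ` \<alpha>" by blast
    then have "\<gamma> \<in> Bd F \<Gamma>" using Bd_old[OF u(1) \<alpha>(2) subsetD[OF Bd_sub \<alpha>(1)]] by simp
    moreover have "relabel u u \<in> \<gamma>" unfolding \<alpha>(3) by (rule imageI[OF \<alpha>(2)])
    ultimately show "\<gamma> \<in> {\<gamma> \<in> Bd F \<Gamma>. relabel u u \<in> \<gamma>}" by blast
  qed
  show "u \<in> \<tau>" "\<tau> \<subseteq> V" using u \<Delta>V by auto
qed

lemma lk_Bd_\<sigma>_face:
  assumes s: "s \<subseteq> \<sigma>" "s \<noteq> {}"
  shows "lk (Bd F \<Gamma>) s = lk (half_bd False) s"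
proof -
  obtain z where z: "z \<in> s" "z \<in> \<sigma>" using s by blast
  have "\<gamma> \<in> Bd F \<Gamma> \<longleftrightarrow> \<gamma> \<in> half_bd False" if "z \<in> \<gamma>" for \<gamma>
  proof -
    have "\<gamma> \<in> half False" if "\<gamma> \<in> Bd F \<Gamma>"
    proof -
      have "\<gamma> \<in> {\<gamma> \<in> \<Gamma>. z \<in> \<gamma>}" using that \<open>z \<in> \<gamma>\<close> subsetD[OF Bd_\<Gamma>_sub] by simp
      then show ?thesis unfolding star_\<sigma>[OF z(2)] by simp
    qed
    moreover have "\<gamma> \<noteq> {}" "\<gamma> \<inter> \<sigma> \<noteq> {}" using that z(2) by blast+
    moreover have "\<gamma> \<in> half False" if "\<gamma> \<in> half_bd False" using that by (simp add: half_bd_def)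
    ultimately show ?thesis using Bd_half[of \<gamma> False] by auto
  qed
  then show ?thesis using z(1) by (intro set_eqI) (simp add: lk_iff)
qed

lemma lk_Bd_plus_face:
  assumes s: "s \<subseteq> \<sigma>" "s \<noteq> {}"
  shows "lk (Bd F \<Gamma>) (plus ` s) = (`) plus ` lk (half_bd True) s"
proof -
  obtain z where z: "z \<in> s" "z \<in> \<sigma>" using s by blast
  have h: "half_bd True \<subseteq> Pow V" using half_V by (auto simp: half_bd_def)
  have "{\<gamma> \<in> Bd F \<Gamma>. plus z \<in> \<gamma>} = (`) plus ` {\<alpha> \<in> half_bd True. z \<in> \<alpha>}"
  proof (intro equalityI subsetI)
    fix \<gamma> assume \<gamma>: "\<gamma> \<in> {\<gamma> \<in> Bd F \<Gamma>. plus z \<in> \<gamma>}"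
    then have "\<gamma> \<in> {\<gamma> \<in> \<Gamma>. plus z \<in> \<gamma>}" using subsetD[OF Bd_\<Gamma>_sub] by simp
    then obtain \<alpha> where \<alpha>: "\<alpha> \<in> half True" "z \<in> \<alpha>" "\<gamma> = plus ` \<alpha>"
      unfolding star_plus[OF z(2)] by blast
    moreover have "\<alpha> \<noteq> {}" "\<alpha> \<inter> \<sigma> \<noteq> {}" using \<alpha>(2) z(2) by blast+
    ultimately have "\<alpha> \<in> half_bd True" using Bd_half[of \<alpha> True] \<gamma> by simp
    then show "\<gamma> \<in> (`) plus ` {\<alpha> \<in> half_bd True. z \<in> \<alpha>}" using \<alpha> by blast
  next
    fix \<gamma> assume "\<gamma> \<in> (`) plus ` {\<alpha> \<in> half_bd True. z \<in> \<alpha>}"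
    then obtain \<alpha> where \<alpha>: "\<alpha> \<in> half_bd True" "z \<in> \<alpha>" "\<gamma> = plus ` \<alpha>" by blast
    have "\<alpha> \<in> half True" using \<alpha>(1) by (simp add: half_bd_def)
    moreover have "\<alpha> \<noteq> {}" "\<alpha> \<inter> \<sigma> \<noteq> {}" using \<alpha>(2) z(2) by blast+
    ultimately have "\<gamma> \<in> Bd F \<Gamma>" using Bd_half[of \<alpha> True] \<alpha> by simp
    then show "\<gamma> \<in> {\<gamma> \<in> Bd F \<Gamma>. plus z \<in> \<gamma>}" using \<alpha> by blast
  qed
  then show ?thesis using lk_image[OF inj_plus h _ z(1)] s(1) \<sigma>V by blast
qed

lemma link_manifold_\<Gamma>: "link_manifold F d \<Gamma>"
  unfolding link_manifold_def
proof (intro conjI ballI allI impI)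
  show "scomplex \<Gamma>" by (rule scomplex_\<Gamma>)
  show "card \<gamma> \<le> Suc d" if "\<gamma> \<in> \<Gamma>" for \<gamma> by (rule \<Gamma>_card[OF that])
  show "lk_ok F (Suc d) \<Gamma> \<gamma>" if "\<gamma> \<in> \<Gamma>" "\<gamma> \<noteq> {}" for \<gamma> by (rule \<Gamma>_ok[OF that])
  show "t \<in> Bd F \<Gamma>" if \<gamma>: "\<gamma> \<in> Bd F \<Gamma>" "t \<subseteq> \<gamma>" for \<gamma> t
  proof (cases "t = {}")
    case False
    have \<gamma>\<Gamma>: "\<gamma> \<in> \<Gamma>" using \<gamma> Bd_\<Gamma>_sub by blast
    then have "t \<in> \<Gamma>" using scomplex_subset[OF scomplex_\<Gamma>] \<gamma> by blast
    then show ?thesis using False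
    proof (cases rule: \<Gamma>_cases)
      case (old u \<alpha>)
      \<comment> \<open>Both faces contain \<open>u\<close>, so the same map
        \<open>relabel u\<close> describes them, and closure under subfaces is inherited from
        \<open>\<Delta>\<close>.\<close>
      have "\<gamma> \<in> {\<gamma> \<in> \<Gamma>. u \<in> \<gamma>}" using \<gamma>\<Gamma> \<gamma>(2) old(3) by (simp add: subsetD)
      then obtain \<beta> where \<beta>: "\<beta> \<in> \<Delta>" "u \<in> \<beta>" "\<gamma> = relabel u ` \<beta>"
        unfolding star_old[OF old(1,2)] by blast
      have "\<beta> \<in> Bd F \<Delta>" using Bd_old[OF old(2) \<beta>(2,1)] \<beta> \<gamma> by simp
      moreover have "\<alpha> \<subseteq> \<beta>"
      proof
        fix v assume v: "v \<in> \<alpha>"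
        then have "relabel u v \<in> relabel u ` \<beta>" using old(6) \<gamma>(2) \<beta>(3) by blast
        moreover have "v \<in> V" "\<beta> \<subseteq> V" using v old \<beta> \<Delta>V by auto
        ultimately show "v \<in> \<beta>" using inj_on_image_mem_iff[OF inj_relabel] by blast
      qed
      ultimately have "\<alpha> \<in> Bd F \<Delta>" by (rule Bd_down)
      then show ?thesis using Bd_old[OF old(2,5,4)] old(6) by simp
    qed (use Bd_\<sigma>_face Bd_plus_face in auto)
  qed (simp add: Bd_def)
  show "sph F (d - card \<gamma>) (lk (Bd F \<Gamma>) \<gamma>)" if \<gamma>: "\<gamma> \<in> Bd F \<Gamma>" "\<gamma> \<noteq> {}" for \<gamma>
  proof -
    have "\<gamma> \<in> \<Gamma>" using \<gamma> Bd_\<Gamma>_sub by blast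
    then show ?thesis using \<gamma>(2)
    proof (cases rule: \<Gamma>_cases)
      case (old u \<alpha>)
      then have "\<alpha> \<in> Bd F \<Delta>" "\<alpha> \<noteq> {}" using Bd_old[OF old(2,5,4)] \<gamma>(1) by auto
      then have "sph F (d - card \<alpha>) (lk (Bd F \<Delta>) \<alpha>)" by (rule Bd_sph)
      then show ?thesis
        using sph_image[OF inj_relabel V lk_V[OF Bd_sub]] lk_Bd_old[OF old(2,5,4)] relabel_card[OF old(4)] old(6)
        by simp
    next
      case \<sigma>
      then show ?thesis using half_bd_sphere_face lk_Bd_\<sigma>_face \<gamma>(2) by simp
    next
      case (plus s)
      have "half_bd True \<subseteq> \<Delta>" using half_subset by (auto simp: half_bd_def)
      then have "sph F (d - card s) ((`) plus ` lk (half_bd True) s)"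
        by (intro sph_image[OF inj_plus V lk_V half_bd_sphere_face[OF plus(1,2)]])
      then show ?thesis using plus lk_Bd_plus_face plus_card by simp
    qed
  qed
qed

lemma boundary_facet:
  assumes "\<tau> \<in> Bd F \<Gamma>" "card \<tau> = d"
  shows "facet (Bd F \<Gamma>) \<tau>"
  unfolding facet_def
proof (intro conjI ballI impI)
  fix t assume t: "t \<in> Bd F \<Gamma>" "\<tau> \<subseteq> t"
  have "card t \<le> d" using Bd_card[OF scomplex_\<Gamma> t(1) _ \<Gamma>_card] by (cases "t = {}") auto
  moreover have "finite t" using t(1) Bd_\<Gamma>_sub scomplex_face_finite[OF scomplex_\<Gamma>] by blast
  ultimately show "t = \<tau>" using t(2) assms(2) card_seteq by metis
qed (rule assms(1))

lemma plus_\<sigma>: "plus ` \<sigma> = p ` \<sigma>"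
  by (auto simp: plus_def)

abbreviation \<psi> :: "'a \<Rightarrow> 'a" where "\<psi> \<equiv> the_inv_into \<sigma> p"

text \<open>A vertex in both links would come from a vertex off \<open>\<sigma>\<close> that is seen
  from the same \<open>z\<close> on both sides.\<close>

lemma admissible_\<psi>: "admissible \<Gamma> (p ` \<sigma>) \<sigma> \<psi>"
  unfolding admissible_def
proof (intro conjI ballI)
  show "bij_betw \<psi> (p ` \<sigma>) \<sigma>" using p by (intro bij_betw_the_inv_into) (simp add: bij_betw_def)
  fix v assume "v \<in> p ` \<sigma>"
  then obtain z where z: "z \<in> \<sigma>" "v = p z" by blast
  then have \<psi>v: "\<psi> v = z" using p by (simp add: the_inv_into_f_f)
  have pz: "v = plus z" using z by (simp add: plus_def)
  have "t = {}" if t: "t \<in> lk \<Gamma> {v}" "t \<in> lk \<Gamma> {z}" for t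
  proof (rule ccontr)
    assume "t \<noteq> {}"
    then obtain u where u: "u \<in> t" by blast
    have 1: "insert z t \<in> half False" using t(2) star_\<sigma>[OF z(1)] by (auto simp: lk_iff)
    have "insert v t \<in> {\<gamma> \<in> \<Gamma>. plus z \<in> \<gamma>}" using t(1) pz by (simp add: lk_iff)
    then obtain \<alpha> where \<alpha>: "\<alpha> \<in> half True" "z \<in> \<alpha>" "insert v t = plus ` \<alpha>"
      unfolding star_plus[OF z(1)] by blast
    have uV: "u \<in> V" using 1 u half_V by blast
    obtain w where w: "w \<in> \<alpha>" "u = plus w" using u \<alpha>(3) by blast
    have wV: "w \<in> V" using w \<alpha> half_V by blast
    have "u \<notin> \<sigma>" using plus_not_\<sigma>[OF wV] w by simp
    then have "w = u" using plus_old[OF wV uV] w by simp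
    then have "side z u = True" "side z u = False"
      using \<alpha> w 1 u z(1) \<open>u \<notin> \<sigma>\<close> unfolding half_def one_sided_def by blast+
    then show False by simp
  qed
  moreover have "{} \<in> lk \<Gamma> {v}" "{} \<in> lk \<Gamma> {z}"
    using Bd_\<sigma>_face[of "{z}"] Bd_plus_face[of "{z}"] Bd_\<Gamma>_sub z pz by (auto simp: lk_iff)
  ultimately show "lk \<Gamma> {v} \<inter> lk \<Gamma> {\<psi> v} = {{}}" unfolding \<psi>v by blast
qed

lemma handle_addition_\<psi>: "\<Delta> = handle_addition \<Gamma> (p ` \<sigma>) \<psi>"
proof -
  define unplus where "unplus v = (if v \<in> p ` \<sigma> then \<psi> v else v)" for v
  have unplus_old: "unplus ` \<alpha> = \<alpha>" if "\<alpha> \<subseteq> V" for \<alpha>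
  proof -
    have "unplus v = v" if "v \<in> \<alpha>" for v using that \<open>\<alpha> \<subseteq> V\<close> p_new by (auto simp: unplus_def)
    then show ?thesis by simp
  qed
  have unplus_plus: "unplus ` plus ` \<alpha> = \<alpha>" if "\<alpha> \<subseteq> V" for \<alpha>
  proof -
    have "unplus (plus v) = v" if "v \<in> \<alpha>" for v
      using that \<open>\<alpha> \<subseteq> V\<close> p_new p by (auto simp: unplus_def plus_def the_inv_into_f_f)
    then show ?thesis by (simp add: image_image)
  qed
  have "(`) unplus ` \<Gamma> = half False \<union> half True"
  proof -
    have "(`) unplus ` half False = half False" using unplus_old half_V by force
    moreover have "(`) unplus ` (`) plus ` half True = half True"
      using unplus_plus half_V by (force simp: image_image)
    ultimately show ?thesis unfolding \<Gamma>_eq image_Un by simp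
  qed
  moreover have "half False \<union> half True = \<Delta>" using half_cover[of _ True] half_subset by auto
  moreover have "handle_addition \<Gamma> (p ` \<sigma>) \<psi> = (`) unplus ` \<Gamma>" unfolding handle_addition_def unplus_def ..
  ultimately show ?thesis by simp
qed

end

section \<open>From the hypotheses on an interior face to the chord setting\<close>

theorem theorem3p7:
  fixes F :: "'k::field itself"
    and \<Delta> :: "'a::linorder set set"
    and d :: nat
    and \<sigma> :: "'a set"
    and x :: 'a
    and p :: "'a \<Rightarrow> 'a"
  assumes "hmanifold_with_boundary F (int d) \<Delta>"
    and "\<sigma> \<in> \<Delta>" and "card \<sigma> = d"
    and "\<sigma> \<notin> bdc F (int d) \<Delta>"
    and "bd_of_face \<sigma> \<subseteq> bdc F (int d) \<Delta>"
    and "x \<notin> \<sigma>" and "insert x \<sigma> \<in> \<Delta>"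
    and "inj_on p \<sigma>" and "p ` \<sigma> \<inter> vert \<Delta> = {}"
  shows "hmanifold_with_boundary F (int d) (handle_deletion \<Delta> \<sigma> x p)
    \<and> facet (bdc F (int d) (handle_deletion \<Delta> \<sigma> x p)) (p ` \<sigma>)
    \<and> facet (bdc F (int d) (handle_deletion \<Delta> \<sigma> x p)) \<sigma>
    \<and> admissible (handle_deletion \<Delta> \<sigma> x p) (p ` \<sigma>) \<sigma> (the_inv_into \<sigma> p)
    \<and> \<Delta> = handle_addition (handle_deletion \<Delta> \<sigma> x p) (p ` \<sigma>) (the_inv_into \<sigma> p)"
proof -
  have hm: "link_manifold F d \<Delta>"
    using assms(1) hmanifold_imp_link_manifold by (auto simp: hmanifold_with_boundary_def)
  then have K: "scomplex \<Delta>" and ok: "\<And>s. s \<in> \<Delta> \<Longrightarrow> s \<noteq> {} \<Longrightarrow> lk_ok F (Suc d) \<Delta> s"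
    and card: "\<And>s. s \<in> \<Delta> \<Longrightarrow> card s \<le> Suc d"
    by (auto simp: link_manifold_def)
  note bdc = link_manifold_bdc[OF hm]
  \<comment> \<open>The empty face always belongs to \<open>bdc\<close>, so an interior face is
    nonempty and \<open>d\<close> is positive.\<close>
  have \<sigma>: "\<sigma> \<noteq> {}" using assms(4) by (auto simp: bdc_def)
  have "\<not> acyc F (lk \<Delta> \<sigma>)" using assms(2,4) \<sigma> by (auto simp: bdc Bd_def)
  then have sph: "sph F 1 (lk \<Delta> \<sigma>)" using ok[OF assms(2) \<sigma>] assms(3) by (simp add: lk_ok_def)
  let ?L = "lk \<Delta> \<sigma>" and ?V = "vert \<Delta>"
  have V: "finite ?V" by (rule scomplex_finite_vert[OF K])
  have LV: "?L \<subseteq> Pow ?V" using scomplex_Pow[OF K] by (auto simp: lk_iff)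
  have Lcard: "card t \<le> 1" if "t \<in> ?L" for t
  proof -
    have t: "t \<inter> \<sigma> = {}" "t \<union> \<sigma> \<in> \<Delta>" using that by (auto simp: lk_iff)
    then have "finite (t \<union> \<sigma>)" using scomplex_face_finite[OF K] by blast
    then have "card (t \<union> \<sigma>) = card t + card \<sigma>" using t(1) by (intro card_Un_disjoint) auto
    then show ?thesis using card[OF t(2)] assms(3) by simp
  qed
  have top: "b = 0" if "b \<in> chains F ?L (Suc 1)" for b
    by (rule chains_top[OF le_less_trans[OF Lcard] that]) simp_all
  have x: "{x} \<in> ?L" using assms(6,7) by (simp add: lk_iff)
  have xV: "x \<in> ?V" using x LV by blast
  obtain g where g: "g \<in> chains F ?L 1" "D ?V g = 0" "\<And>b. b \<in> chains F ?L (Suc 1) \<Longrightarrow> g \<noteq> D ?V b"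
    and gen: "\<And>c. c \<in> chains F ?L 1 \<Longrightarrow> D ?V c = 0 \<Longrightarrow> \<exists>a. \<exists>b\<in>chains F ?L (Suc 1). c - cscale a g = D ?V b"
    by (rule sph_gen[OF sph V LV], rule that)
  have g0: "g \<noteq> 0" using g(3)[OF chains_zero] by simp
  \<comment> \<open>The link of \<open>\<sigma>\<close> has no edges, so nothing is divided out and
    its cycles form the line spanned by \<open>g\<close>.\<close>
  have mult: "\<exists>a. \<forall>t. c t = a * g t" if c: "c \<in> chains F ?L 1" "D ?V c = 0" for c
  proof -
    obtain a b where b: "b \<in> chains F ?L (Suc 1)" "c - cscale a g = D ?V b" using gen[OF c] by blast
    have "b = 0" using b(1) by (rule top)
    then have "c - cscale a g = 0" using b(2) by simp
    then show ?thesis by (auto simp: cscale_def fun_eq_iff)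
  qed
  have single: "\<exists>v. t = {v}" if "t \<in> ?L" "card t = 1" for t using that(2) card_1_singletonE by blast
  \<comment> \<open>A reduced cycle of points has coefficient sum zero, so one point alone could not
    carry the nonzero \<open>g\<close>.\<close>
  obtain y where y: "{y} \<in> ?L" "y \<noteq> x"
  proof (rule ccontr)
    assume "\<not> thesis"
    then have only: "\<And>v. {v} \<in> ?L \<Longrightarrow> v = x" using that by blast
    have gx: "g t = 0" if "t \<noteq> {x}" for t
      using g(1) single[of t] only that by (fastforce simp: chains_iff)
    have "0 = (\<Sum>v\<in>?V. g {v})" using g(2) D_empty_eq[of ?V g] by simp
    also have "\<dots> = (\<Sum>v\<in>{x}. g {v})" using V xV gx by (intro sum.mono_neutral_right) auto
    finally have "g {x} = 0" by simp
    then have "g t = 0" for t using gx by (cases "t = {x}") auto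
    then show False using g0 by (simp add: fun_eq_iff)
  qed
  have yV: "y \<in> ?V" using y LV by blast
  \<comment> \<open>A third point \<open>v\<close> would make \<open>point x - point y\<close> and
    \<open>point x - point v\<close> two independent cycles on that line.\<close>
  have uniq: "v = x \<or> v = y" if v: "{v} \<in> ?L" for v
  proof (rule ccontr)
    assume n: "\<not> ?thesis"
    have vV: "v \<in> ?V" using v LV by blast
    obtain a where a: "\<And>t. (point x - point y :: _ \<Rightarrow> 'k) t = a * g t"
      using mult[OF chains_diff[OF point_chains[OF x] point_chains[OF y(1)]] D_point_diff[OF V xV yV]] by blast
    obtain b where b: "\<And>t. (point x - point v :: _ \<Rightarrow> 'k) t = b * g t"
      using mult[OF chains_diff[OF point_chains[OF x] point_chains[OF v]] D_point_diff[OF V xV vV]] by blast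
    have "a * g {x} = 1" "b * g {y} = 0" "a * g {y} = -1" "b * g {x} = 1"
      using a[of "{x}"] b[of "{y}"] a[of "{y}"] b[of "{x}"] y(2) n by (auto simp: point_def)
    then show False by (metis mult_eq_0_iff one_neq_zero neg_equal_0_iff_equal)
  qed
  have L: "?L = {{}, {x}, {y}}"
  proof (intro equalityI subsetI)
    fix t assume t: "t \<in> ?L"
    have "finite t" using t LV V finite_subset by blast
    then consider "t = {}" | v where "t = {v}" using Lcard[OF t] by (metis One_nat_def card_0_eq card_1_singletonE le_Suc_eq le_zero_eq)
    then show "t \<in> {{}, {x}, {y}}" using uniq t by cases auto
  next
    fix t assume "t \<in> {{}, {x}, {y}}"
    then show "t \<in> ?L" using x y(1) assms(2) by (auto simp: lk_iff)
  qed
  have proper: "acyc F (lk \<Delta> s)" if "s \<subset> \<sigma>" "s \<noteq> {}" for s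
    using that assms(5) by (auto simp: bdc Bd_def bd_of_face_def)
  interpret chord_handle F d \<Delta> \<sigma> x y p
    using hm assms \<sigma> L y(2) proper by unfold_locales auto
  note bdc\<Gamma> = link_manifold_bdc[OF link_manifold_\<Gamma>]
  have "\<sigma> \<in> Bd F \<Gamma>" by (rule Bd_\<sigma>_face) simp
  then have "Bd F \<Gamma> \<noteq> {{}}" using \<sigma> by blast
  then have "hmanifold_with_boundary F (int d) \<Gamma>"
    using link_manifold_imp_hmanifold[OF link_manifold_\<Gamma>] by (simp add: hmanifold_with_boundary_def bdc\<Gamma>)
  moreover have "facet (Bd F \<Gamma>) \<sigma>" using boundary_facet Bd_\<sigma>_face assms(3) by simp
  moreover have "facet (Bd F \<Gamma>) (p ` \<sigma>)"
    using boundary_facet[of "plus ` \<sigma>"] Bd_plus_face[of \<sigma>] plus_card[of \<sigma>] assms(3) by (simp add: plus_\<sigma>)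
  ultimately show ?thesis
    unfolding bdc\<Gamma> using admissible_\<psi> handle_addition_\<psi> by blast
qed

end
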